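(* Let $m=\min\{n_1,n_2\}\to\infty$ with $n_1/n_2$ a fixed non-zero constant, and let the rank $r$ and the number of observations $s$ (with $1\le s<n_1n_2$) grow so that $$\rho_r=1-\sqrt{\Bigl(1-\frac r{n_1}\Bigr)\Bigl(1-\frac r{n_2}\Bigr)}\in(0,1],\qquad \rho_s=\frac{s}{n_1n_2}\in(0,1]$$ remain constant. Write $n=n_1n_2$, $q=(1-\rho_r)^2$, $p=1-\rho_s$. Assume the rank-$r$ matrices $\boldsymbol M\in\mathbb R^{n_1\times n_2}$ are generated in such a way that the Kronecker products $\boldsymbol W_q^n=\boldsymbol V_\perp^{n_2}\otimes\boldsymbol U_\perp^{n_1}\in\mathbb R^{n\times qn}$ form a sequence of semi-orthogonal matrices that is concentrated. Let $\boldsymbol W_{pq}^n\in\mathbb R^{pn\times qn}$ be the matrix formed by the rows of $\boldsymbol W_q^n$ corresponding to the unobserved set $\bar\Omega$, where $\bar\Omega$ is a uniformly random subset of $pn$ of the $n$ entry positions, and let $\boldsymbol H_n=\boldsymbol W_{pq}^n(\boldsymbol W_{pq}^n)^\top$. Then, provided $\rho_s\ge1-(1-\rho_r)^2$, the empirical spectral distribution $\mu_{\boldsymbol H_n}$ converges almost surely, as $m\to\infty$, to the deterministic distribution $\mu_{\rho_r\rho_s}$ given by $$d\mu_{\rho_r\rho_s}=\Bigl(\frac{(1-\rho_r)^2-\rho_s}{1-\rho_s}\Bigr)_+\delta(x-1)\,dx+\frac{\sqrt{(\lambda^+-x)(x-\lambda^-)}}{2\pi(1-\rho_s)x(1-x)}\,\mathbb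 I[\lambda^-\le x\le\lambda^+]\,dx,$$ where $$\lambda^\pm=\Bigl(\sqrt{(1-\rho_r)^2\rho_s}\pm\sqrt{\rho_r(2-\rho_r)(1-\rho_s)}\Bigr)^2 .$$
   Context: For a rank-$r$ matrix $\boldsymbol M\in\mathbb R^{n_1\times n_2}$, the columns of $\boldsymbol U_\perp^{n_1}\in\mathbb R^{n_1\times(n_1-r)}$ and $\boldsymbol V_\perp^{n_2}\in\mathbb R^{n_2\times(n_2-r)}$ are orthonormal bases of the orthogonal complements of the column space and of the row space of $\boldsymbol M$, respectively (the remaining left/right singular vectors). Note $(n_1-r)(n_2-r)=qn$. Rows of $\boldsymbol V_\perp^{n_2}\otimes\boldsymbol U_\perp^{n_1}$ are indexed by the entry positions $(i,j)\in[n_1]\times[n_2]$ through column-stacking vectorization. $\Omega\subset[n_1]\times[n_2]$, $|\Omega|=s$, is the set of observed entries and $\bar\Omega$ its complement. The empirical spectral distribution (ESD) of an $N\times N$ real symmetric matrix with eigenvalues $\lambda_1,\dots,\lambda_N$ is $\frac1N\sum_{i=1}^N\delta_{\lambda_i}$, where $\delta_\lambda$ is the Dirac mass at $\lambda$. $\delta(\cdot)$ in the formula is the Dirac delta, $(x)_+=\max(x,0)$, and $\mathbb I$ is the indicator. A matrix $\boldsymbol W\in\mathbb R^{n\times qn}$ is semi-orthogonal if $\boldsymbol W^\top\boldsymbol W=\boldsymbol I_{qn}$. Concentration: let $\boldsymbol W_q^n=[\boldsymbol w_1^n,\dots,\boldsymbol w_n^n]^\top$ with $\boldsymbol w_i^n\in\mathbb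 R^{qn}$, and let $P_n$ be a set of $pn$ indices (the selected rows) chosen uniformly at random from $[n]$. For $j\in P_n$ put $P_n^j=P_n\setminus\{j\}$ and, for $z\in\mathbb C$, $\boldsymbol R_j(z)=\bigl(\sum_{i\in P_n^j}\boldsymbol w_i^n(\boldsymbol w_i^n)^\top-z\boldsymbol I_{qn}\bigr)^{-1}$. The sequence $\{\boldsymbol W_q^n\}$ is concentrated if for any $j\in P_n$ and $z\in\mathbb C$, $$(\boldsymbol w_j^n)^\top\boldsymbol R_j(z)\boldsymbol w_j^n-\mathbb E_{j\mid P_n^j}\bigl[(\boldsymbol w_j^n)^\top\boldsymbol R_j(z)\boldsymbol w_j^n\bigr]\to0\quad\text{in probability as }n\to\infty,$$ where $\mathbb E_{j\mid P_n^j}$ is the conditional expectation over the random index $j$ given $P_n^j$. *)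

theory Defs
  imports
    "HOL-Probability.Probability"
    "Jordan_Normal_Form.Char_Poly"
    "Jordan_Normal_Form.Gauss_Jordan_Elimination"
    "Jordan_Normal_Form.DL_Rank"
    "Jordan_Normal_Form.DL_Submatrix"
begin

no_notation Finite_Cartesian_Product.vec_nth (infixl "$" 90)
hide_const (open) Finite_Cartesian_Product.vec Finite_Cartesian_Product.mat

abbreviation col_space_of :: "real mat \<Rightarrow> real Matrix.vec set" where
  "col_space_of A \<equiv> vec_space.col_space (dim_row A) A"

abbreviation rank_of :: "real mat \<Rightarrow> nat" where
  "rank_of A \<equiv> vec_space.rank (dim_row A) A"

definition orth_compl :: "nat \<Rightarrow> real Matrix.vec set \<Rightarrow> real Matrix.vec set" where
  "orth_compl n S = {x \<in> carrier_vec n. \<forall>y \<in> S. x \<bullet> y = 0}"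

definition semi_orthogonal :: "real mat \<Rightarrow> bool" where
  "semi_orthogonal W \<longleftrightarrow> transpose_mat W * W = 1\<^sub>m (dim_col W)"

definition orthonormal_basis_of :: "real mat \<Rightarrow> real Matrix.vec set \<Rightarrow> bool" where
  "orthonormal_basis_of B S \<longleftrightarrow> semi_orthogonal B \<and> col_space_of B = S"

definition kronecker :: "real mat \<Rightarrow> real mat \<Rightarrow> real mat" where
  "kronecker A B =
     Matrix.mat (dim_row A * dim_row B) (dim_col A * dim_col B)
       (\<lambda>(i, j). A $$ (i div dim_row B, j div dim_col B) * B $$ (i mod dim_row B, j mod dim_col B))"

(* Column-stacking vectorization of an n1-row matrix, with rows and columns counted from 0. *)
definition stack_index :: "nat \<Rightarrow> nat \<times> nat \<Rightarrow> nat" where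
  "stack_index n1 = (\<lambda>(i, j). j * n1 + i)"

(* The real roots of the characteristic polynomial, with multiplicity; for a symmetric N x N
   matrix there are N of them, so each carries mass 1/N. *)
definition esd :: "real mat \<Rightarrow> real measure" where
  "esd A = distr (measure_pmf (pmf_of_multiset (proots (char_poly A)))) borel (\<lambda>x. x)"

definition gram_of_rows :: "real mat \<Rightarrow> nat set \<Rightarrow> real mat" where
  "gram_of_rows W S =
     Matrix.mat (dim_col W) (dim_col W) (\<lambda>(a, b). \<Sum>i\<in>S. W $$ (i, a) * W $$ (i, b))"

definition resolvent :: "real mat \<Rightarrow> complex \<Rightarrow> complex mat" where
  "resolvent A z = the (mat_inverse (map_mat complex_of_real A - z \<cdot>\<^sub>m 1\<^sub>m (dim_row A)))"

definition resolvent_form :: "real mat \<Rightarrow> complex \<Rightarrow> nat set \<Rightarrow> nat \<Rightarrow> complex" where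
  "resolvent_form W z S j =
     (let w = map_vec complex_of_real (Matrix.row W j)
      in w \<bullet> (resolvent (gram_of_rows W S) z *\<^sub>v w))"

definition random_subset :: "'a set \<Rightarrow> nat \<Rightarrow> 'a set pmf" where
  "random_subset A N = pmf_of_set {P. P \<subseteq> A \<and> card P = N}"

(* Joint law of the selected set P and an index j drawn uniformly from P. *)
definition random_selection :: "nat \<Rightarrow> nat \<Rightarrow> (nat set \<times> nat) pmf" where
  "random_selection n N =
     bind_pmf (random_subset {..<n} N) (\<lambda>P. map_pmf (\<lambda>j. (P, j)) (pmf_of_set P))"

definition cond_expectation_index ::
    "nat \<Rightarrow> nat \<Rightarrow> (nat set \<Rightarrow> nat \<Rightarrow> complex) \<Rightarrow> nat set \<Rightarrow> complex" where
  "cond_expectation_index n N X S =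
     measure_pmf.expectation (cond_pmf (random_selection n N) {(P, j). P - {j} = S})
       (\<lambda>(P, j). X (P - {j}) j)"

(* N k is the number of rows selected from W k. The resolvent of a real symmetric matrix is
   certain to exist only off the real axis, so z ranges over the nonreal numbers. *)
definition concentrated :: "(nat \<Rightarrow> real mat) \<Rightarrow> (nat \<Rightarrow> nat) \<Rightarrow> bool" where
  "concentrated W N \<longleftrightarrow>
     (\<forall>z. Im z \<noteq> 0 \<longrightarrow> (\<forall>\<epsilon>>0.
        (\<lambda>k. measure_pmf.prob (random_selection (dim_row (W k)) (N k))
               {(P, j). \<epsilon> < cmod (resolvent_form (W k) z (P - {j}) j
                  - cond_expectation_index (dim_row (W k)) (N k)
                      (resolvent_form (W k) z) (P - {j}))})
        \<longlonglongrightarrow> 0))"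

definition limit_edge_lower :: "real \<Rightarrow> real \<Rightarrow> real" where
  "limit_edge_lower \<rho>r \<rho>s =
     (sqrt ((1 - \<rho>r)\<^sup>2 * \<rho>s) - sqrt (\<rho>r * (2 - \<rho>r) * (1 - \<rho>s)))\<^sup>2"

definition limit_edge_upper :: "real \<Rightarrow> real \<Rightarrow> real" where
  "limit_edge_upper \<rho>r \<rho>s =
     (sqrt ((1 - \<rho>r)\<^sup>2 * \<rho>s) + sqrt (\<rho>r * (2 - \<rho>r) * (1 - \<rho>s)))\<^sup>2"

definition limit_density :: "real \<Rightarrow> real \<Rightarrow> real \<Rightarrow> real" where
  "limit_density \<rho>r \<rho>s x =
     sqrt ((limit_edge_upper \<rho>r \<rho>s - x) * (x - limit_edge_lower \<rho>r \<rho>s))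
       / (2 * pi * (1 - \<rho>s) * x * (1 - x))
       * indicator {limit_edge_lower \<rho>r \<rho>s .. limit_edge_upper \<rho>r \<rho>s} x"

definition limit_law :: "real \<Rightarrow> real \<Rightarrow> real measure" where
  "limit_law \<rho>r \<rho>s = measure_of UNIV (sets borel)
     (\<lambda>A. ennreal (max 0 (((1 - \<rho>r)\<^sup>2 - \<rho>s) / (1 - \<rho>s))) * emeasure (return borel 1) A
        + emeasure (density lborel (\<lambda>x. ennreal (limit_density \<rho>r \<rho>s x))) A)"

lemma sets_limit_law [simp]: "sets (limit_law \<rho>r \<rho>s) = sets borel"
  by (simp add: limit_law_def sets_measure_of_conv sets.sigma_sets_eq[of borel, simplified])

lemma emeasure_limit_law:
  assumes "A \<in> sets borel"
  shows "emeasure (limit_law \<rho>r \<rho>s) A =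
     ennreal (max 0 (((1 - \<rho>r)\<^sup>2 - \<rho>s) / (1 - \<rho>s))) * indicator A 1
       + (\<integral>\<^sup>+x\<in>A. ennreal (limit_density \<rho>r \<rho>s x) \<partial>lborel)"
proof -
  let ?c = "ennreal (max 0 (((1 - \<rho>r)\<^sup>2 - \<rho>s) / (1 - \<rho>s)))"
  let ?D = "density lborel (\<lambda>x. ennreal (limit_density \<rho>r \<rho>s x))"
  let ?\<mu> = "\<lambda>A. ?c * emeasure (return borel (1::real)) A + emeasure ?D A"
  have meas: "(\<lambda>x. ennreal (limit_density \<rho>r \<rho>s x)) \<in> borel_measurable lborel"
    unfolding limit_density_def by measurable
  have "emeasure (limit_law \<rho>r \<rho>s) A = ?\<mu> A"
  proof (rule emeasure_measure_of[OF limit_law_def])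
    show "positive (sets (limit_law \<rho>r \<rho>s)) ?\<mu>"
      by (simp add: positive_def)
    show "countably_additive (sets (limit_law \<rho>r \<rho>s)) ?\<mu>"
    proof (rule countably_additiveI)
      fix F :: "nat \<Rightarrow> real set"
      assume F: "range F \<subseteq> sets (limit_law \<rho>r \<rho>s)" "disjoint_family F"
      have "(\<Sum>i. ?\<mu> (F i))
          = (\<Sum>i. ?c * emeasure (return borel 1) (F i)) + (\<Sum>i. emeasure ?D (F i))"
        by (rule suminf_add[symmetric]) auto
      also have "\<dots> = ?c * (\<Sum>i. emeasure (return borel 1) (F i)) + (\<Sum>i. emeasure ?D (F i))"
        by simp
      also have "(\<Sum>i. emeasure (return borel (1::real)) (F i)) = emeasure (return borel 1) (\<Union>i. F i)"
        using F by (intro suminf_emeasure) auto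
      also have "(\<Sum>i. emeasure ?D (F i)) = emeasure ?D (\<Union>i. F i)"
        using F by (intro suminf_emeasure) auto
      finally show "(\<Sum>i. ?\<mu> (F i)) = ?\<mu> (\<Union>i. F i)" .
    qed
  qed (use assms in auto)
  then show ?thesis
    using assms meas by (simp add: emeasure_density)
qed

end

theory Submission
  imports Defs
begin

text \<open>
Let $G_S = \sum_{i \in S} w_i w_i^T$ be the Gram matrix of the selected rows and $R_S = (G_S - z)^{-1}$.
By Sherman-Morrison, $qn + z\,\mathrm{tr} R_P = \sum_{j \in P} X_j / (1 + X_j)$ with
$X_j = w_j^T R_{P - j} w_j$. Concentration replaces $X_j$ by its average over the unselected indices,
which for a semi-orthogonal matrix equals $((1 - z)\,\mathrm{tr} R_{P - j} - qn) / (n - |P| + 1)$.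
Exchanging one row changes the trace by $O(1)$ only, so $\mathrm{tr} R_P / n$ has variance $O(1/n)$ and its
mean $t$ solves, in the limit, a quadratic equation in $a = zt$; for large imaginary part of $z$
the root near $-q$ is the one selected, and the Stieltjes transform of the limit law, computed by
means of the Poisson kernel, leads to the same root. Since $n_1 / n_2$ is constant and the sizes are distinct, $n$ runs
through $c m^2$ for distinct $m$, so that $\sum 1/n$ converges and Chebyshev with Borel-Cantelli gives
almost sure convergence. Stieltjes transforms along $z = iy$, $y \to \infty$, determine the moments,
hence the characteristic functions.
\<close>

section \<open>Resolvents of Gram matrices\<close>

text \<open>Concentration is convergence in probability without a rate, which cannot feed
  Borel-Cantelli. So the roles are split. Concentration only identifies the limit of the
  deterministic mean \<open>t\<close>, where a bad event of small probability costs little because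
  every \<open>X_j\<close> is bounded. The almost sure part rests on the variance of the trace. The
  Gram matrix of size \<open>qn\<close> is studied instead of \<open>H\<close> of size
  \<open>pn\<close> because adding a row is then a rank-one update of a matrix of fixed size; both
  have the same nonzero eigenvalues. Semi-orthogonality enters twice: it bounds the rows by 1, and
  it makes the sum of \<open>X_j\<close> over all rows a plain trace, so that the sum over the
  unselected rows is affine in the trace and the equation closes. The thresholds for the imaginary
  part are convenient choices: 2 keeps \<open>1 + X_j\<close> away from 0, and 16 separates the two
  roots. The condition \<open>p \<le> q\<close> fixes the sign of a square root at the pole 0, which
  gives the limit law total mass 1 without an atom at 0.\<close>

abbreviation cmat :: "real mat \<Rightarrow> complex mat" where
  "cmat A \<equiv> map_mat complex_of_real A"

abbreviation crow :: "real mat \<Rightarrow> nat \<Rightarrow> complex Matrix.vec" where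
  "crow W j \<equiv> map_vec complex_of_real (Matrix.row W j)"

definition vec_norm2 :: "complex Matrix.vec \<Rightarrow> real" where
  "vec_norm2 v = L2_set (\<lambda>i. cmod (v $ i)) {0..<dim_vec v}"

definition spectral_shift :: "real mat \<Rightarrow> complex \<Rightarrow> complex mat" where
  "spectral_shift A z = cmat A - z \<cdot>\<^sub>m 1\<^sub>m (dim_row A)"

definition mat_trace :: "'a::comm_monoid_add mat \<Rightarrow> 'a" where
  "mat_trace A = (\<Sum>i<dim_row A. A $$ (i, i))"

lemma vec_norm2_nonneg [simp]: "0 \<le> vec_norm2 v"
  by (simp add: vec_norm2_def L2_set_nonneg)

lemma vec_norm2_sq: "(vec_norm2 v)\<^sup>2 = (\<Sum>i=0..<dim_vec v. (cmod (v $ i))\<^sup>2)"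
  by (simp add: vec_norm2_def L2_set_def sum_nonneg)

lemma vec_norm2_eq_0:
  assumes "vec_norm2 v = 0"
  shows "v = 0\<^sub>v (dim_vec v)"
proof (intro eq_vecI)
  fix i assume "i < dim_vec (0\<^sub>v (dim_vec v))"
  then show "v $ i = 0\<^sub>v (dim_vec v) $ i"
    using assms by (auto simp: vec_norm2_def L2_set_eq_0_iff)
qed auto

lemma cmod_scalar_prod_le:
  assumes "dim_vec v = dim_vec w"
  shows "cmod (v \<bullet> w) \<le> vec_norm2 v * vec_norm2 w"
proof -
  have "cmod (v \<bullet> w) \<le> (\<Sum>i=0..<dim_vec w. cmod (v $ i * w $ i))"
    unfolding scalar_prod_def by (rule norm_sum)
  also have "\<dots> = (\<Sum>i=0..<dim_vec w. \<bar>cmod (v $ i)\<bar> * \<bar>cmod (w $ i)\<bar>)"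
    by (simp add: norm_mult)
  also have "\<dots> \<le> vec_norm2 v * vec_norm2 w"
    unfolding vec_norm2_def using L2_set_mult_ineq assms by metis
  finally show ?thesis .
qed

lemma spectral_shift_carrier [simp]:
  "A \<in> carrier_mat d d \<Longrightarrow> spectral_shift A z \<in> carrier_mat d d"
  by (auto simp: spectral_shift_def)

lemma spectral_shift_mult_index:
  assumes "A \<in> carrier_mat d d" "u \<in> carrier_vec d" "i < d"
  shows "(spectral_shift A z *\<^sub>v u) $ i = (\<Sum>j=0..<d. of_real (A $$ (i, j)) * u $ j) - z * u $ i"
proof -
  have "(spectral_shift A z *\<^sub>v u) $ i
      = (\<Sum>j=0..<d. (of_real (A $$ (i, j)) - z * (if i = j then 1 else 0)) * u $ j)"
    using assms by (simp add: spectral_shift_def scalar_prod_def)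
  also have "\<dots> = (\<Sum>j=0..<d. of_real (A $$ (i, j)) * u $ j) - (\<Sum>j=0..<d. if i = j then z * u $ j else 0)"
    unfolding sum_subtractf[symmetric] by (intro sum.cong) (auto simp: algebra_simps)
  also have "(\<Sum>j=0..<d. if i = j then z * u $ j else 0) = z * u $ i"
    using assms by (simp add: sum.delta)
  finally show ?thesis .
qed

text \<open>The quadratic form of a symmetric matrix is real, so only the shift contributes to the
  imaginary part.\<close>

lemma spectral_shift_coercive:
  assumes A: "A \<in> carrier_mat d d" and sym: "transpose_mat A = A" and u: "u \<in> carrier_vec d"
  shows "\<bar>Im z\<bar> * vec_norm2 u \<le> vec_norm2 (spectral_shift A z *\<^sub>v u)"
proof -
  define w where "w = spectral_shift A z *\<^sub>v u"
  define f where "f = (\<Sum>i=0..<d. \<Sum>j=0..<d. cnj (u $ i) * of_real (A $$ (i, j)) * u $ j)"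
  have symA: "A $$ (i, j) = A $$ (j, i)" if "i < d" "j < d" for i j
    using index_transpose_mat(1)[of j A i] sym A that by auto
  have w: "w \<in> carrier_vec d"
    using mult_mat_vec_carrier[OF spectral_shift_carrier[OF A] u] by (simp add: w_def)
  have "cnj f = (\<Sum>i=0..<d. \<Sum>j=0..<d. u $ i * of_real (A $$ (i, j)) * cnj (u $ j))"
    by (simp add: f_def)
  also have "\<dots> = (\<Sum>j=0..<d. \<Sum>i=0..<d. u $ i * of_real (A $$ (i, j)) * cnj (u $ j))"
    by (rule sum.swap)
  also have "\<dots> = f"
    unfolding f_def by (intro sum.cong) (auto simp: symA mult_ac)
  finally have Imf: "Im f = 0"
    by (metis complex_cnj_cancel_iff complex_In_mult_cnj_zero cnj.sel(2) neg_equal_zero)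
  have "(\<Sum>i=0..<d. cnj (u $ i) * w $ i) = f - z * of_real ((vec_norm2 u)\<^sup>2)"
  proof -
    have "(\<Sum>i=0..<d. cnj (u $ i) * w $ i)
       = (\<Sum>i=0..<d. cnj (u $ i) * ((\<Sum>j=0..<d. of_real (A $$ (i, j)) * u $ j) - z * u $ i))"
      using spectral_shift_mult_index[OF A u] by (intro sum.cong) (auto simp: w_def)
    also have "\<dots> = f - (\<Sum>i=0..<d. z * of_real ((cmod (u $ i))\<^sup>2))"
      unfolding f_def sum_subtractf[symmetric]
      by (intro sum.cong) (auto simp: algebra_simps sum_distrib_left complex_norm_square simp del: of_real_power)
    finally show ?thesis
      using u by (simp add: vec_norm2_sq sum_distrib_left)
  qed
  then have "\<bar>Im z\<bar> * (vec_norm2 u)\<^sup>2 = \<bar>Im (\<Sum>i=0..<d. cnj (u $ i) * w $ i)\<bar>"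
    using Imf by (simp add: abs_mult del: of_real_power)
  also have "\<dots> \<le> cmod (\<Sum>i=0..<d. cnj (u $ i) * w $ i)"
    by (rule abs_Im_le_cmod)
  also have "\<dots> \<le> (\<Sum>i=0..<d. \<bar>cmod (u $ i)\<bar> * \<bar>cmod (w $ i)\<bar>)"
    by (rule order_trans[OF norm_sum]) (simp add: norm_mult)
  also have "\<dots> \<le> vec_norm2 u * vec_norm2 w"
    unfolding vec_norm2_def using L2_set_mult_ineq u w by (metis carrier_vecD)
  finally have "vec_norm2 u * (\<bar>Im z\<bar> * vec_norm2 u) \<le> vec_norm2 u * vec_norm2 w"
    by (simp add: power2_eq_square mult_ac)
  then show ?thesis
    using vec_norm2_nonneg[of u] vec_norm2_nonneg[of w]
    by (cases "vec_norm2 u = 0") (auto simp: w_def)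
qed

text \<open>Coercivity leaves no room for a kernel vector off the real axis.\<close>

lemma det_spectral_shift_nonzero:
  assumes "A \<in> carrier_mat d d" "transpose_mat A = A" "Im z \<noteq> 0"
  shows "Determinant.det (spectral_shift A z) \<noteq> 0"
proof
  assume "Determinant.det (spectral_shift A z) = 0"
  then obtain v where v: "v \<in> carrier_vec d" "v \<noteq> 0\<^sub>v d" "spectral_shift A z *\<^sub>v v = 0\<^sub>v d"
    using det_0_iff_vec_prod_zero[OF spectral_shift_carrier[OF assms(1)]] by blast
  have "vec_norm2 (0\<^sub>v d) = 0" by (simp add: vec_norm2_def L2_set_eq_0_iff)
  then have "\<bar>Im z\<bar> * vec_norm2 v \<le> 0"
    using spectral_shift_coercive[OF assms(1,2) v(1), of z] v(3) by simp
  then have "vec_norm2 v = 0"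
    using assms(3) vec_norm2_nonneg[of v] by (auto simp: mult_le_0_iff)
  then show False using vec_norm2_eq_0[of v] v by auto
qed

text \<open>\<open>resolvent\<close> unwraps \<open>mat_inverse\<close> with \<open>the\<close>, so
  it means something only once invertibility is known. Later arguments reach it only through these
  three facts.\<close>

lemma resolvent_inverse:
  assumes A: "A \<in> carrier_mat d d" and "transpose_mat A = A" "Im z \<noteq> 0"
  shows "resolvent A z \<in> carrier_mat d d"
    and "spectral_shift A z * resolvent A z = 1\<^sub>m d"
    and "resolvent A z * spectral_shift A z = 1\<^sub>m d"
proof -
  have "mat_inverse (spectral_shift A z) \<noteq> None"
    using mat_inverse(1)[OF spectral_shift_carrier[OF A], of z] 
      det_non_zero_imp_unit[OF spectral_shift_carrier[OF A] det_spectral_shift_nonzero[OF assms]]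
    by metis
  then obtain B where B: "mat_inverse (spectral_shift A z) = Some B" by blast
  then have "resolvent A z = B" by (simp add: resolvent_def spectral_shift_def)
  then show "resolvent A z \<in> carrier_mat d d" "spectral_shift A z * resolvent A z = 1\<^sub>m d"
    "resolvent A z * spectral_shift A z = 1\<^sub>m d"
    using mat_inverse(2)[OF spectral_shift_carrier[OF A] B] by auto
qed

lemma inverse_unique_mat:
  fixes C :: "complex mat"
  assumes "C \<in> carrier_mat d d" "R \<in> carrier_mat d d" "X \<in> carrier_mat d d"
    and "R * C = 1\<^sub>m d" "C * X = 1\<^sub>m d"
  shows "X = R"
proof -
  have "X = (R * C) * X" using assms by simp
  also have "\<dots> = R * (C * X)" using assms by (intro assoc_mult_mat) auto
  finally show ?thesis using assms by simp
qed

lemma spectral_shift_symmetric: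
  assumes "A \<in> carrier_mat d d" "transpose_mat A = A"
  shows "transpose_mat (spectral_shift A z) = spectral_shift A z"
proof (rule eq_matI)
  fix i j assume "i < dim_row (spectral_shift A z)" "j < dim_col (spectral_shift A z)"
  then have ij: "i < d" "j < d" using assms by (auto simp: spectral_shift_def)
  then have "A $$ (i, j) = A $$ (j, i)"
    using index_transpose_mat(1)[of j A i] assms by auto
  then show "transpose_mat (spectral_shift A z) $$ (i, j) = spectral_shift A z $$ (i, j)"
    using ij assms by (auto simp: spectral_shift_def)
qed (use assms in \<open>auto simp: spectral_shift_def\<close>)

text \<open>Transposing \<open>R * C = 1\<close> exhibits the transpose as a right inverse of the
  same symmetric shift. The resolvent is complex symmetric, not Hermitian, which suits the bilinear
  product \<open>\<bullet>\<close>.\<close>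

lemma resolvent_symmetric:
  assumes A: "A \<in> carrier_mat d d" and "transpose_mat A = A" "Im z \<noteq> 0"
  shows "transpose_mat (resolvent A z) = resolvent A z"
proof (rule inverse_unique_mat)
  note R = resolvent_inverse[OF assms]
  have "spectral_shift A z * transpose_mat (resolvent A z)
      = transpose_mat (resolvent A z * spectral_shift A z)"
    using R A assms by (subst transpose_mult[of _ d d _ d]) (auto simp: spectral_shift_symmetric)
  then show "spectral_shift A z * transpose_mat (resolvent A z) = 1\<^sub>m d"
    using R by simp
qed (use resolvent_inverse[OF assms] A in auto)

text \<open>Coercivity applied to the vector \<open>resolvent A z *v v\<close>, which the shift maps
  back to \<open>v\<close>.\<close>

lemma resolvent_bound:
  assumes A: "A \<in> carrier_mat d d" and "transpose_mat A = A" "Im z \<noteq> 0" and v: "v \<in> carrier_vec d"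
  shows "vec_norm2 (resolvent A z *\<^sub>v v) \<le> vec_norm2 v / \<bar>Im z\<bar>"
proof -
  note R = resolvent_inverse[OF assms(1-3)]
  have "spectral_shift A z *\<^sub>v (resolvent A z *\<^sub>v v) = v"
    using R v A by (subst assoc_mult_mat_vec[symmetric, of _ d d _ d]) auto
  then have "\<bar>Im z\<bar> * vec_norm2 (resolvent A z *\<^sub>v v) \<le> vec_norm2 v"
    using spectral_shift_coercive[OF assms(1,2) mult_mat_vec_carrier[OF R(1) v], of z] by simp
  then show ?thesis using assms(3) by (simp add: field_simps)
qed

section \<open>Gram matrices of selected rows\<close>

lemma gram_of_rows_carrier [simp]: "gram_of_rows W S \<in> carrier_mat (dim_col W) (dim_col W)"
  by (simp add: gram_of_rows_def)

lemma gram_of_rows_symmetric: "transpose_mat (gram_of_rows W S) = gram_of_rows W S"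
  by (rule eq_matI) (auto simp: gram_of_rows_def mult_ac)

abbreviation gres :: "real mat \<Rightarrow> complex \<Rightarrow> nat set \<Rightarrow> complex mat" where
  "gres W z S \<equiv> resolvent (gram_of_rows W S) z"

lemmas gres_inverse = resolvent_inverse[OF gram_of_rows_carrier gram_of_rows_symmetric]
lemmas gres_symmetric = resolvent_symmetric[OF gram_of_rows_carrier gram_of_rows_symmetric]
lemmas gres_bound = resolvent_bound[OF gram_of_rows_carrier gram_of_rows_symmetric]

lemma crow_carrier [simp]: "crow W j \<in> carrier_vec (dim_col W)"
  by (auto simp: Matrix.row_def)

lemma resolvent_form_eq: "resolvent_form W z S j = crow W j \<bullet> (gres W z S *\<^sub>v crow W j)"
  by (simp add: resolvent_form_def Let_def)

text \<open>The squared norm \<open>s\<close> of row \<open>j\<close> is a diagonal entry of the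
  projection \<open>W W^T\<close>. The squared length of column \<open>j\<close> of this projection
  contains the term \<open>s^2\<close>, and by idempotence it equals \<open>s\<close>; hence
  \<open>s^2 \<le> s\<close>.\<close>

lemma vec_norm2_crow_le_1:
  assumes so: "semi_orthogonal W" and j: "j < dim_row W"
  shows "vec_norm2 (crow W j) \<le> 1"
proof -
  define d where "d = dim_col W"
  define n where "n = dim_row W"
  define s where "s = (\<Sum>a=0..<d. (W $$ (j, a))\<^sup>2)"
  have orth: "(\<Sum>i=0..<n. W $$ (i, a) * W $$ (i, b)) = (if a = b then 1 else 0)" if "a < d" "b < d" for a b
  proof -
    have "(transpose_mat W * W) $$ (a, b) = (\<Sum>i=0..<n. W $$ (i, a) * W $$ (i, b))"
      using that by (simp add: scalar_prod_def d_def n_def)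
    then show ?thesis using so that by (simp add: semi_orthogonal_def d_def)
  qed
  have s: "(vec_norm2 (crow W j))\<^sup>2 = s"
    using j unfolding vec_norm2_sq by (simp add: s_def d_def)
  have "s\<^sup>2 = (\<Sum>a=0..<d. W $$ (j, a) * W $$ (j, a))\<^sup>2"
    by (simp add: s_def power2_eq_square)
  also have "\<dots> \<le> (\<Sum>i=0..<n. (\<Sum>a=0..<d. W $$ (i, a) * W $$ (j, a))\<^sup>2)"
    by (rule member_le_sum[of j "{0..<n}" "\<lambda>i. (\<Sum>a=0..<d. W $$ (i, a) * W $$ (j, a))\<^sup>2"])
       (use j in \<open>auto simp: n_def\<close>)
  also have "\<dots> = (\<Sum>i=0..<n. \<Sum>a=0..<d. \<Sum>b=0..<d. W $$ (j, a) * W $$ (j, b) * (W $$ (i, a) * W $$ (i, b)))"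
    by (simp add: power2_eq_square sum_product mult_ac)
  also have "\<dots> = (\<Sum>a=0..<d. \<Sum>i=0..<n. \<Sum>b=0..<d. W $$ (j, a) * W $$ (j, b) * (W $$ (i, a) * W $$ (i, b)))"
    by (rule sum.swap)
  also have "\<dots> = (\<Sum>a=0..<d. \<Sum>b=0..<d. \<Sum>i=0..<n. W $$ (j, a) * W $$ (j, b) * (W $$ (i, a) * W $$ (i, b)))"
    by (intro sum.cong refl sum.swap)
  also have "\<dots> = (\<Sum>a=0..<d. \<Sum>b=0..<d. W $$ (j, a) * W $$ (j, b) * (if a = b then 1 else 0))"
    by (intro sum.cong refl) (simp add: orth flip: sum_distrib_left)
  also have "\<dots> = s"
    by (simp add: s_def power2_eq_square if_distrib[of "\<lambda>x. _ * x"] sum.delta cong: if_cong)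
  finally have "s * s \<le> s * 1" by (simp add: power2_eq_square)
  moreover have "0 \<le> s" by (simp add: s_def sum_nonneg)
  ultimately have "s \<le> 1" by (cases "s = 0") auto
  then show ?thesis using s by (metis abs_le_square_iff abs_one abs_of_nonneg one_power2 vec_norm2_nonneg)
qed

lemma cmod_resolvent_form_le:
  assumes "semi_orthogonal W" "j < dim_row W" "Im z \<noteq> 0"
  shows "cmod (resolvent_form W z S j) \<le> 1 / \<bar>Im z\<bar>"
proof -
  have w: "vec_norm2 (crow W j) \<le> 1" by (rule vec_norm2_crow_le_1[OF assms(1,2)])
  have "cmod (resolvent_form W z S j) \<le> vec_norm2 (crow W j) * vec_norm2 (gres W z S *\<^sub>v crow W j)"
    unfolding resolvent_form_eq
    using gres_inverse(1)[of z W S] assms by (intro cmod_scalar_prod_le) auto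
  also have "\<dots> \<le> 1 * (1 / \<bar>Im z\<bar>)"
    using w order_trans[OF gres_bound[of z "crow W j" W S] divide_right_mono[OF w, of "\<bar>Im z\<bar>"]] assms
    by (intro mult_mono) auto
  finally show ?thesis by simp
qed

text \<open>Sherman-Morrison in vector form, multiplied out so that \<open>1 + X\<close> may
  vanish.\<close>

lemma gres_insert:
  assumes j: "j \<notin> S" "finite S" and z: "Im z \<noteq> 0" and dj: "j < dim_row W"
  shows "gres W z S *\<^sub>v crow W j
       = (1 + resolvent_form W z S j) \<cdot>\<^sub>v (gres W z (insert j S) *\<^sub>v crow W j)"
proof -
  define d where "d = dim_col W"
  define w where "w = crow W j"
  define u where "u = gres W z S *\<^sub>v w"
  define x where "x = resolvent_form W z S j"
  let ?GS = "gram_of_rows W S" and ?GP = "gram_of_rows W (insert j S)"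
  have RS: "gres W z S \<in> carrier_mat d d" "spectral_shift ?GS z * gres W z S = 1\<^sub>m d"
    using gres_inverse[of z W S] z by (auto simp: d_def)
  have RP: "gres W z (insert j S) \<in> carrier_mat d d"
      "gres W z (insert j S) * spectral_shift ?GP z = 1\<^sub>m d"
    using gres_inverse[of z W "insert j S"] z by (auto simp: d_def)
  have w: "w \<in> carrier_vec d" by (simp add: w_def d_def Matrix.row_def)
  have u: "u \<in> carrier_vec d" using RS w by (auto simp: u_def)
  have GS: "?GS \<in> carrier_mat d d" and GP: "?GP \<in> carrier_mat d d" by (simp_all add: d_def)
  have x: "x = (\<Sum>b=0..<d. w $ b * u $ b)"
    using u unfolding x_def resolvent_form_eq w_def[symmetric] u_def[symmetric] scalar_prod_def by simp
  have Su: "spectral_shift ?GS z *\<^sub>v u = w"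
    using RS w GS unfolding u_def by (subst assoc_mult_mat_vec[symmetric, of _ d d _ d]) auto
  \<comment> \<open>The new row adds the matrix \<open>w w^T\<close>, which sends \<open>u\<close>
    to \<open>x w\<close>, while the old shift sends \<open>u\<close> to \<open>w\<close>.\<close>
  have "spectral_shift ?GP z *\<^sub>v u = (1 + x) \<cdot>\<^sub>v w"
  proof (rule eq_vecI)
    fix a assume "a < dim_vec ((1 + x) \<cdot>\<^sub>v w)"
    then have a: "a < d" using w by simp
    have "?GP $$ (a, b) = ?GS $$ (a, b) + W $$ (j, a) * W $$ (j, b)" if "b < d" for b
      using a that j by (simp add: gram_of_rows_def d_def)
    then have "(spectral_shift ?GP z *\<^sub>v u) $ a
        = (spectral_shift ?GS z *\<^sub>v u) $ a + (\<Sum>b=0..<d. of_real (W $$ (j, a)) * of_real (W $$ (j, b)) * u $ b)"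
      unfolding spectral_shift_mult_index[OF GP u a] spectral_shift_mult_index[OF GS u a]
      by (simp add: distrib_right sum.distrib)
    also have "(\<Sum>b=0..<d. of_real (W $$ (j, a)) * of_real (W $$ (j, b)) * u $ b) = w $ a * x"
      unfolding x sum_distrib_left using a dj
      by (intro sum.cong) (auto simp: w_def d_def mult_ac)
    finally show "(spectral_shift ?GP z *\<^sub>v u) $ a = ((1 + x) \<cdot>\<^sub>v w) $ a"
      using Su a w by (simp add: algebra_simps)
  qed (use w GP in \<open>auto simp: spectral_shift_def\<close>)
  then have "gres W z (insert j S) *\<^sub>v (spectral_shift ?GP z *\<^sub>v u)
      = (1 + x) \<cdot>\<^sub>v (gres W z (insert j S) *\<^sub>v w)"
    using RP w by (simp add: mult_mat_vec)
  moreover have "gres W z (insert j S) *\<^sub>v (spectral_shift ?GP z *\<^sub>v u) = u"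
    using RP u GP by (subst assoc_mult_mat_vec[symmetric, of _ d d _ d]) auto
  ultimately show ?thesis by (simp add: u_def x_def w_def)
qed

lemma resolvent_form_insert:
  assumes "j \<notin> S" "finite S" "Im z \<noteq> 0" "j < dim_row W" "1 + resolvent_form W z S j \<noteq> 0"
  shows "resolvent_form W z (insert j S) j = resolvent_form W z S j / (1 + resolvent_form W z S j)"
proof -
  let ?x = "resolvent_form W z S j" and ?v = "gres W z (insert j S) *\<^sub>v crow W j"
  have "?v \<in> carrier_vec (dim_col W)"
    using gres_inverse(1)[of z W "insert j S"] assms by auto
  then have "?x = (1 + ?x) * resolvent_form W z (insert j S) j"
    using gres_insert[OF assms(1-4)] crow_carrier[of W j] unfolding resolvent_form_eq
    by (metis scalar_prod_smult_distrib)
  then show ?thesis using assms(5) by (simp add: field_simps)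
qed

text \<open>Cyclicity of the trace: each form is the trace of \<open>B w_j w_j^T\<close>, and the
  rank-one matrices add up to the Gram matrix.\<close>

lemma sum_quadratic_forms:
  assumes B: "B \<in> carrier_mat (dim_col W) (dim_col W)" and S: "S \<subseteq> {..<dim_row W}" 
  shows "(\<Sum>j\<in>S. crow W j \<bullet> (B *\<^sub>v crow W j)) = mat_trace (B * cmat (gram_of_rows W S))"
proof -
  define d where "d = dim_col W"
  have "(\<Sum>j\<in>S. crow W j \<bullet> (B *\<^sub>v crow W j))
      = (\<Sum>j\<in>S. \<Sum>a=0..<d. \<Sum>b=0..<d. of_real (W $$ (j, a)) * (B $$ (a, b) * of_real (W $$ (j, b))))"
    using B S by (intro sum.cong) (auto simp: scalar_prod_def d_def sum_distrib_left)
  also have "\<dots> = (\<Sum>a=0..<d. \<Sum>j\<in>S. \<Sum>b=0..<d. of_real (W $$ (j, a)) * (B $$ (a, b) * of_real (W $$ (j, b))))"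
    by (rule sum.swap)
  also have "\<dots> = (\<Sum>a=0..<d. \<Sum>b=0..<d. \<Sum>j\<in>S. of_real (W $$ (j, a)) * (B $$ (a, b) * of_real (W $$ (j, b))))"
    by (intro sum.cong refl sum.swap)
  also have "\<dots> = mat_trace (B * cmat (gram_of_rows W S))"
    using B unfolding mat_trace_def
    by (auto simp: scalar_prod_def d_def gram_of_rows_def sum_distrib_left mult_ac atLeast0LessThan intro!: sum.cong)
  finally show ?thesis .
qed

lemma gram_of_rows_all:
  assumes "semi_orthogonal W"
  shows "gram_of_rows W {..<dim_row W} = 1\<^sub>m (dim_col W)"
proof -
  have "gram_of_rows W {..<dim_row W} = transpose_mat W * W"
    by (rule eq_matI) (auto simp: gram_of_rows_def scalar_prod_def atLeast0LessThan)
  then show ?thesis using assms by (simp add: semi_orthogonal_def)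
qed

text \<open>The Gram matrix of all rows is the identity, whatever rows \<open>S\<close> enter the
  resolvent.\<close>

lemma sum_resolvent_forms_all:
  assumes "semi_orthogonal W" "Im z \<noteq> 0"
  shows "(\<Sum>j<dim_row W. resolvent_form W z S j) = mat_trace (gres W z S)"
proof -
  have R: "gres W z S \<in> carrier_mat (dim_col W) (dim_col W)"
    using gres_inverse(1) assms(2) by auto
  have "cmat (1\<^sub>m (dim_col W)) = 1\<^sub>m (dim_col W)"
    by (rule eq_matI) auto
  then show ?thesis
    using sum_quadratic_forms[OF R, of "{..<dim_row W}"] gram_of_rows_all[OF assms(1)] R
    by (simp add: resolvent_form_eq)
qed

text \<open>The inverse equation reads \<open>R G = 1 + z R\<close>; its trace gives the
  claim.\<close>

lemma sum_resolvent_forms: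
  assumes "S \<subseteq> {..<dim_row W}" "Im z \<noteq> 0"
  shows "(\<Sum>j\<in>S. resolvent_form W z S j) = of_nat (dim_col W) + z * mat_trace (gres W z S)"
proof -
  define d where "d = dim_col W"
  let ?R = "gres W z S" and ?G = "cmat (gram_of_rows W S)"
  have R: "?R \<in> carrier_mat d d" and G: "?G \<in> carrier_mat d d" and inv: "?R * spectral_shift (gram_of_rows W S) z = 1\<^sub>m d"
    using gres_inverse assms(2) by (auto simp: d_def)
  have "?R * spectral_shift (gram_of_rows W S) z = ?R * ?G - z \<cdot>\<^sub>m ?R"
  proof -
    have "spectral_shift (gram_of_rows W S) z = ?G - z \<cdot>\<^sub>m 1\<^sub>m d"
      by (simp add: spectral_shift_def d_def gram_of_rows_def)
    then show ?thesis
      using R G by (simp add: mult_minus_distrib_mat[of _ d d] mult_smult_distrib[of _ d d _ d])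
  qed
  then have eq: "?R * ?G - z \<cdot>\<^sub>m ?R = 1\<^sub>m d" using inv by simp
  have "(?R * ?G) $$ (i, i) = 1 + z * ?R $$ (i, i)" if i: "i < d" for i
  proof -
    have "(?R * ?G - z \<cdot>\<^sub>m ?R) $$ (i, i) = (?R * ?G) $$ (i, i) - z * ?R $$ (i, i)"
      using i R G by (metis (no_types, lifting) carrier_matD index_minus_mat(1) index_smult_mat)
    then show ?thesis using eq i by (simp add: algebra_simps)
  qed
  then have "mat_trace (?R * ?G) = of_nat d + z * mat_trace ?R"
    unfolding mat_trace_def using R G by (simp add: sum.distrib sum_distrib_left)
  moreover have "(\<Sum>j\<in>S. resolvent_form W z S j) = mat_trace (?R * ?G)"
    unfolding resolvent_form_eq using sum_quadratic_forms[of ?R W S] R assms(1) by (simp add: d_def)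
  ultimately show ?thesis by (simp add: d_def)
qed

text \<open>The resolvent identity gives \<open>R_S - R_P = R_P (w w^T) R_S\<close>. The trace of
  this rank-one matrix is the product of \<open>R_P w\<close> and \<open>R_S w\<close>, each of norm
  at most \<open>1 / \<bar>Im z\<bar>\<close>.\<close>

lemma trace_gres_insert:
  assumes so: "semi_orthogonal W" and j: "j \<notin> S" "finite S" and z: "Im z \<noteq> 0" and dj: "j < dim_row W"
  shows "cmod (mat_trace (gres W z S) - mat_trace (gres W z (insert j S))) \<le> 1 / \<bar>Im z\<bar>\<^sup>2"
proof -
  define d where "d = dim_col W"
  define w where "w = crow W j"
  let ?GS = "gram_of_rows W S" and ?GP = "gram_of_rows W (insert j S)"
  let ?RS = "gres W z S" and ?RP = "gres W z (insert j S)"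
  let ?CS = "spectral_shift ?GS z" and ?CP = "spectral_shift ?GP z"
  have RS: "?RS \<in> carrier_mat d d" "?CS * ?RS = 1\<^sub>m d" "?CS \<in> carrier_mat d d"
    using gres_inverse[of z W S] z by (auto simp: d_def)
  have RP: "?RP \<in> carrier_mat d d" "?RP * ?CP = 1\<^sub>m d" "?CP \<in> carrier_mat d d"
    using gres_inverse[of z W "insert j S"] z by (auto simp: d_def)
  define D where "D = ?CP - ?CS"
  have D: "D \<in> carrier_mat d d" using RS RP by (auto simp: D_def)
  have Dab: "D $$ (a, b) = w $ a * w $ b" if "a < d" "b < d" for a b
    using that j dj by (simp add: D_def spectral_shift_def gram_of_rows_def d_def w_def)
  have "?RP * (D * ?RS) = ?RP * (?CP * ?RS - ?CS * ?RS)"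
    unfolding D_def using RS RP by (subst minus_mult_distrib_mat[of _ d d]) auto
  also have "\<dots> = ?RP * (?CP * ?RS) - ?RP * (?CS * ?RS)"
    using RS RP by (subst mult_minus_distrib_mat[of _ d d]) auto
  also have "?RP * (?CP * ?RS) = ?RP * ?CP * ?RS"
    using RS RP by (intro assoc_mult_mat[symmetric]) auto
  finally have eq: "?RS - ?RP = ?RP * (D * ?RS)"
    using RS RP by simp
  \<comment> \<open>Symmetry turns the row vector \<open>w^T R_S\<close> into the entries of
    \<open>R_S w\<close>.\<close>
  have symS: "?RS $$ (a, b) = ?RS $$ (b, a)" if "a < d" "b < d" for a b
    using index_transpose_mat(1)[of b ?RS a] gres_symmetric[of z W S] z RS that by auto
  have w: "w \<in> carrier_vec d" by (simp add: w_def d_def Matrix.row_def)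
  have "mat_trace ?RS - mat_trace ?RP = mat_trace (?RS - ?RP)"
    using RS RP by (simp add: mat_trace_def sum_subtractf)
  also have "\<dots> = (\<Sum>i=0..<d. (?RP *\<^sub>v w) $ i * (?RS *\<^sub>v w) $ i)"
    unfolding eq mat_trace_def
  proof (intro sum.cong)
    fix i assume "i \<in> {0..<d}"
    then have i: "i < d" by simp
    have "(?RP * (D * ?RS)) $$ (i, i) = (\<Sum>a=0..<d. ?RP $$ (i, a) * (\<Sum>b=0..<d. w $ a * w $ b * ?RS $$ (b, i)))"
      using RS RP D i Dab by (simp add: scalar_prod_def)
    also have "\<dots> = (\<Sum>a=0..<d. ?RP $$ (i, a) * w $ a) * (\<Sum>b=0..<d. w $ b * ?RS $$ (b, i))"
      unfolding sum_product by (simp add: sum_distrib_left mult_ac)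
    also have "(\<Sum>b=0..<d. w $ b * ?RS $$ (b, i)) = (?RS *\<^sub>v w) $ i"
      using RS w i symS by (simp add: scalar_prod_def mult_ac)
    also have "(\<Sum>a=0..<d. ?RP $$ (i, a) * w $ a) = (?RP *\<^sub>v w) $ i"
      using RP w i by (simp add: scalar_prod_def)
    finally show "(?RP * (D * ?RS)) $$ (i, i) = (?RP *\<^sub>v w) $ i * (?RS *\<^sub>v w) $ i" .
  qed (use RP in auto)
  also have "\<dots> = (?RP *\<^sub>v w) \<bullet> (?RS *\<^sub>v w)"
    using RS by (simp add: scalar_prod_def)
  finally have "cmod (mat_trace ?RS - mat_trace ?RP) \<le> vec_norm2 (?RP *\<^sub>v w) * vec_norm2 (?RS *\<^sub>v w)"
    using cmod_scalar_prod_le[of "?RP *\<^sub>v w" "?RS *\<^sub>v w"] RS RP by simp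
  also have "\<dots> \<le> (1 / \<bar>Im z\<bar>) * (1 / \<bar>Im z\<bar>)"
  proof -
    have "vec_norm2 w \<le> 1" unfolding w_def by (rule vec_norm2_crow_le_1[OF so dj])
    then have "vec_norm2 w / \<bar>Im z\<bar> \<le> 1 / \<bar>Im z\<bar>" by (intro divide_right_mono) auto
    then show ?thesis
      using gres_bound[of z w W S] gres_bound[of z w W "insert j S"] z w
      by (intro mult_mono) (auto simp: d_def)
  qed
  finally show ?thesis by (simp add: power2_eq_square)
qed

section \<open>Spectra of symmetric matrices\<close>

lemma spectral_shift_eq_char_matrix: "spectral_shift A z = char_matrix (cmat A) z"
  by (rule eq_matI) (auto simp: spectral_shift_def char_matrix_def)

lemma poly_char_poly_det:
  assumes A: "(A :: complex mat) \<in> carrier_mat n n"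
  shows "poly (char_poly A) z = (-1) ^ n * Determinant.det (char_matrix A z)"
proof -
  have "- char_matrix A z = (-1) \<cdot>\<^sub>m char_matrix A z"
    by (rule eq_matI) auto
  then show ?thesis
    using A char_poly_matrix[OF A, of z] by (simp add: char_matrix_def)
qed

text \<open>Jacobi's formula with the determinant cleared: the trace of the adjugate is the sum of
  the principal minors, and these are, up to sign, characteristic polynomials of principal
  submatrices, whose sum is the derivative of the full one.\<close>

lemma mat_trace_inverse_char_matrix:
  assumes A: "(A :: complex mat) \<in> carrier_mat n n" and R: "R \<in> carrier_mat n n"
    and inv: "R * char_matrix A z = 1\<^sub>m n"
  shows "mat_trace R * poly (char_poly A) z = - poly (pderiv (char_poly A)) z"
proof -
  let ?C = "char_matrix A z"
  have C: "?C \<in> carrier_mat n n" using A by simp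
  have "Determinant.det ?C \<cdot>\<^sub>m R = R * (?C * adj_mat ?C)"
    using adj_mat[OF C] R by (simp add: mult_smult_distrib[of _ n n _ n])
  also have "\<dots> = adj_mat ?C"
    using adj_mat[OF C] R C inv by (subst assoc_mult_mat[symmetric, of _ n n _ n]) auto
  finally have adj: "Determinant.det ?C \<cdot>\<^sub>m R = adj_mat ?C" .
  have "mat_trace R * Determinant.det ?C = (\<Sum>i<n. (Determinant.det ?C \<cdot>\<^sub>m R) $$ (i, i))"
    using R by (simp add: mat_trace_def sum_distrib_left sum_distrib_right mult.commute)
  also have "\<dots> = (\<Sum>i<n. Determinant.det (mat_delete ?C i i))"
    unfolding adj using C by (simp add: adj_mat_def cofactor_def)
  also have "\<dots> = (\<Sum>i<n. (-1) ^ (n - 1) * poly (char_poly (mat_delete A i i)) z)"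
  proof (intro sum.cong refl)
    fix i assume "i \<in> {..<n}"
    then have i: "i < n" by simp
    have "mat_delete ?C i i = char_matrix (mat_delete A i i) z"
      by (rule eq_matI) (use i A in \<open>auto simp: mat_delete_def char_matrix_def\<close>)
    moreover have "mat_delete A i i \<in> carrier_mat (n - 1) (n - 1)"
      using A by (rule mat_delete_carrier)
    ultimately show "Determinant.det (mat_delete ?C i i) = (-1) ^ (n - 1) * poly (char_poly (mat_delete A i i)) z"
      by (simp add: poly_char_poly_det flip: power_add mult_2)
  qed
  also have "\<dots> = (-1) ^ (n - 1) * poly (pderiv (char_poly A)) z"
    by (simp add: pderiv_char_poly[OF A] poly_sum sum_distrib_left)
  finally have *: "mat_trace R * Determinant.det ?C = (-1) ^ (n - 1) * poly (pderiv (char_poly A)) z" .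
  show ?thesis
  \<comment> \<open>\<open>n - 1\<close> truncates at 0, so the empty matrix is treated apart;
    otherwise the two signs combine to -1.\<close>
  proof (cases n)
    case 0
    then show ?thesis using R pderiv_char_poly[OF A] by (simp add: mat_trace_def)
  next
    case (Suc m)
    have "mat_trace R * poly (char_poly A) z = (-1) ^ n * (mat_trace R * Determinant.det ?C)"
      by (simp add: poly_char_poly_det[OF A])
    then show ?thesis unfolding * using Suc by (simp flip: power_add mult_2)
  qed
qed

text \<open>The logarithmic derivative of a product, cleared of its denominator.\<close>

lemma poly_pderiv_prod_linear_factors:
  fixes z :: complex
  assumes "z \<notin> set as"
  shows "poly (pderiv (\<Prod>a\<leftarrow>as. [:- a, 1:])) z
       = (\<Sum>a\<leftarrow>as. 1 / (z - a)) * poly (\<Prod>a\<leftarrow>as. [:- a, 1:]) z"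
  using assms
proof (induction as)
  case (Cons a as)
  then have "z - a \<noteq> 0" by auto
  moreover define P where "P = (\<Prod>a\<leftarrow>as. [:- a, 1:])"
  moreover have "poly (pderiv ([:- a, 1:] * P)) z = poly P z + (z - a) * poly (pderiv P) z"
    unfolding pderiv_mult by (simp add: pderiv_pCons algebra_simps)
  moreover have "poly ([:- a, 1:] * P) z = (z - a) * poly P z"
    by (simp add: algebra_simps)
  ultimately show ?case
    using Cons.IH Cons.prems unfolding list.map prod_list.Cons sum_list.Cons
    by (simp add: distrib_right)
qed (simp add: pderiv_1)

lemma poly_prod_linear_factors:
  "poly (\<Prod>a\<leftarrow>as. [:- a, 1:]) (z :: complex) = (\<Prod>a\<leftarrow>as. z - a)"
  by (induction as) (auto simp: algebra_simps)

text \<open>The polynomial splits over the complex numbers. A nonreal root would make a nonreal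
  spectral shift singular, so all roots are real, and the factorization descends because embedding
  the coefficients is injective.\<close>

lemma char_poly_symmetric_splits:
  assumes A: "A \<in> carrier_mat n n" and sym: "transpose_mat A = A"
  obtains bs :: "real list" where "char_poly A = (\<Prod>b\<leftarrow>bs. [:- b, 1:])" "length bs = n"
    "char_poly (cmat A) = (\<Prod>b\<leftarrow>map of_real bs. [:- b, 1:])"
proof -
  have cA: "cmat A \<in> carrier_mat n n" using A by simp
  obtain as where as: "char_poly (cmat A) = (\<Prod>a\<leftarrow>as. [:- a, 1:])" "length as = n"
    using char_poly_factorized[OF cA] by blast
  have "a \<in> \<real>" if "a \<in> set as" for a
  proof -
    have "poly (char_poly (cmat A)) a = 0"
      using that unfolding as(1) poly_prod_linear_factors by (simp add: prod_list_zero_iff)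
    then have "Determinant.det (spectral_shift A a) = 0"
      by (simp add: poly_char_poly_det[OF cA] spectral_shift_eq_char_matrix)
    then show ?thesis using det_spectral_shift_nonzero[OF A sym, of a] complex_is_Real_iff by blast
  qed
  then have eq: "as = map of_real (map Re as)"
    by (auto simp: list_eq_iff_nth_eq)
  define bs where "bs = map Re as"
  interpret h: map_poly_inj_comm_ring_hom complex_of_real ..
  have "map_poly complex_of_real (char_poly A) = char_poly (cmat A)"
    by (rule of_real_hom.char_poly_hom[OF A, symmetric])
  also have "\<dots> = (\<Prod>b\<leftarrow>map of_real bs. [:- b, 1:])" using as(1) eq by (simp add: bs_def)
  also have "\<dots> = map_poly complex_of_real (\<Prod>b\<leftarrow>bs. [:- b, 1:])"
  proof (induction bs)
    case (Cons b bs)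
    then show ?case
      unfolding list.map prod_list.Cons h.hom_mult by simp
  qed simp
  finally have "char_poly A = (\<Prod>b\<leftarrow>bs. [:- b, 1:])"
    by (rule h.injectivity)
  moreover have "length bs = n" using as(2) by (simp add: bs_def)
  moreover have "char_poly (cmat A) = (\<Prod>b\<leftarrow>map of_real bs. [:- b, 1:])"
    unfolding as(1) bs_def eq[symmetric] ..
  ultimately show ?thesis by (rule that)
qed

lemma proots_prod_linear_factors: "proots (\<Prod>b\<leftarrow>bs. [:- b, 1:]) = mset (bs :: real list)"
proof (induction bs)
  case (Cons b bs)
  have "(\<Prod>b\<leftarrow>bs. [:- b, 1:]) \<noteq> 0" by (auto simp: prod_list_zero_iff)
  then show ?case
    using Cons proots_mult[of "[:- b, 1:]" "\<Prod>b\<leftarrow>bs. [:- b, 1:]"] by (simp del: mult_pCons_left)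
qed simp

text \<open>The trace of the resolvent is minus the logarithmic derivative of the characteristic
  polynomial. This is what links resolvents to the multiset of roots in \<open>esd\<close>.\<close>

lemma
  assumes A: "A \<in> carrier_mat n n" and sym: "transpose_mat A = A"
  shows size_proots_char_poly_symmetric: "size (proots (char_poly A)) = n"
    and mat_trace_resolvent: "Im z \<noteq> 0 \<Longrightarrow>
      mat_trace (resolvent A z) = (\<Sum>x\<in>#proots (char_poly A). 1 / (complex_of_real x - z))"
proof -
  obtain bs where bs: "char_poly A = (\<Prod>b\<leftarrow>bs. [:- b, 1:])" "length bs = n"
    "char_poly (cmat A) = (\<Prod>b\<leftarrow>map of_real bs. [:- b, 1:])"
    using char_poly_symmetric_splits[OF A sym] by blast
  have roots: "proots (char_poly A) = mset bs"
    unfolding bs(1) by (rule proots_prod_linear_factors)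
  show "size (proots (char_poly A)) = n" using roots bs(2) by simp
  assume z: "Im z \<noteq> 0"
  have cA: "cmat A \<in> carrier_mat n n" using A by simp
  note R = resolvent_inverse[OF A sym z]
  have nz: "poly (char_poly (cmat A)) z \<noteq> 0"
    using det_spectral_shift_nonzero[OF A sym z]
    by (simp add: poly_char_poly_det[OF cA] spectral_shift_eq_char_matrix)
  have notin: "z \<notin> set (map of_real bs)" using z by auto
  have "mat_trace (resolvent A z) * poly (char_poly (cmat A)) z = - poly (pderiv (char_poly (cmat A))) z"
    by (rule mat_trace_inverse_char_matrix[OF cA R(1)])
       (use R(3) in \<open>simp add: spectral_shift_eq_char_matrix\<close>)
  also have "\<dots> = - (\<Sum>a\<leftarrow>map of_real bs. 1 / (z - a)) * poly (char_poly (cmat A)) z"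
    unfolding bs(3) poly_pderiv_prod_linear_factors[OF notin] by simp
  finally have "mat_trace (resolvent A z) = - (\<Sum>a\<leftarrow>map of_real bs. 1 / (z - a))"
    by (rule mult_right_cancel[OF nz, THEN iffD1])
  also have "\<dots> = - (\<Sum>a\<leftarrow>bs. 1 / (z - of_real a))"
    by (simp add: o_def)
  also have "\<dots> = (\<Sum>a\<leftarrow>bs. 1 / (of_real a - z))"
  proof (induction bs)
    case (Cons b bs)
    have "- (1 / (z - complex_of_real b)) = 1 / (of_real b - z)"
      by (metis minus_diff_eq minus_divide_right)
    then show ?case using Cons by simp
  qed simp
  finally show "mat_trace (resolvent A z) = (\<Sum>x\<in>#proots (char_poly A). 1 / (complex_of_real x - z))"
    unfolding roots by (simp flip: sum_mset_sum_list mset_map)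
qed

text \<open>\<open>A A^T\<close> and \<open>A^T A\<close> differ only in the multiplicity of the
  eigenvalue 0, each copy of which contributes -1 to \<open>z\<close> times the trace of the
  resolvent.\<close>

lemma mat_trace_resolvent_outer:
  assumes z: "Im z \<noteq> 0" and A: "A \<in> carrier_mat N d"
  shows "z * mat_trace (resolvent (A * transpose_mat A) z)
       = of_nat d + z * mat_trace (gres A z {..<N}) - of_nat N"
proof -
  let ?H = "A * transpose_mat A" and ?G = "gram_of_rows A {..<N}" and ?R = "gres A z {..<N}"
  let ?A = "cmat A" and ?At = "cmat (transpose_mat A)"
  have H: "?H \<in> carrier_mat N N" using A by simp
  have symH: "transpose_mat ?H = ?H"
    using A by (simp add: transpose_mult[of A N d _ N])
  have cA: "?A \<in> carrier_mat N d" and cAt: "?At \<in> carrier_mat d N" using A by auto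
  have R: "?R \<in> carrier_mat d d" "spectral_shift ?G z * ?R = 1\<^sub>m d"
    using gres_inverse[of z A "{..<N}"] z A by auto
  have "?G = transpose_mat A * A"
    by (rule eq_matI) (use A in \<open>auto simp: gram_of_rows_def scalar_prod_def atLeast0LessThan\<close>)
  then have G: "cmat ?G = ?At * ?A"
    using A by (simp add: of_real_hom.mat_hom_mult[of _ d N _ d])
  have cH: "cmat ?H = ?A * ?At"
    using A by (simp add: of_real_hom.mat_hom_mult[of _ N d _ N])
  \<comment> \<open>By the Woodbury formula \<open>X / z\<close> should be the resolvent of
    \<open>A A^T\<close>; it suffices to check that the shift maps \<open>X\<close> to
    \<open>z\<close> times the identity.\<close>
  define X where "X = ?A * (?R * ?At) - 1\<^sub>m N"
  have ARA: "?A * (?R * ?At) \<in> carrier_mat N N" using cA R cAt by auto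
  have X: "X \<in> carrier_mat N N" using ARA by (auto simp: X_def)
  have AtARA: "?At * (?A * (?R * ?At)) = ?At + z \<cdot>\<^sub>m (?R * ?At)"
  proof -
    have GR: "cmat ?G * ?R - z \<cdot>\<^sub>m ?R = 1\<^sub>m d"
    proof -
      have "spectral_shift ?G z * ?R = cmat ?G * ?R - (z \<cdot>\<^sub>m 1\<^sub>m d) * ?R"
        unfolding spectral_shift_def using R A
        by (subst minus_mult_distrib_mat[of _ d d _ _ d]) (auto simp: gram_of_rows_def)
      also have "(z \<cdot>\<^sub>m 1\<^sub>m d) * ?R = z \<cdot>\<^sub>m ?R"
        using R by (subst mult_smult_assoc_mat[of _ d d _ d]) auto
      finally show ?thesis using R by simp
    qed
    have "cmat ?G * ?R = 1\<^sub>m d + z \<cdot>\<^sub>m ?R"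
    proof (rule eq_matI)
      fix i j assume "i < dim_row (1\<^sub>m d + z \<cdot>\<^sub>m ?R)" "j < dim_col (1\<^sub>m d + z \<cdot>\<^sub>m ?R)"
      then have ij: "i < d" "j < d" using R by auto
      have "(cmat ?G * ?R - z \<cdot>\<^sub>m ?R) $$ (i, j) = (cmat ?G * ?R) $$ (i, j) - z * ?R $$ (i, j)"
        using ij R by (metis (no_types, lifting) carrier_matD index_minus_mat(1) index_smult_mat)
      then show "(cmat ?G * ?R) $$ (i, j) = (1\<^sub>m d + z \<cdot>\<^sub>m ?R) $$ (i, j)"
        unfolding GR using ij R by (simp add: algebra_simps)
    qed (use R A in \<open>auto simp: gram_of_rows_def\<close>)
    moreover have "?At * (?A * (?R * ?At)) = cmat ?G * ?R * ?At"
      unfolding G using cA cAt R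
      by (simp add: assoc_mult_mat[of _ d N _ d] assoc_mult_mat[of _ d d _ d] assoc_mult_mat[of _ N d _ d]
          assoc_mult_mat[of _ d d _ N] assoc_mult_mat[of _ d N _ N] assoc_mult_mat[of _ N d _ N])
    moreover have "(1\<^sub>m d + z \<cdot>\<^sub>m ?R) * ?At = ?At + z \<cdot>\<^sub>m (?R * ?At)"
      using R cAt by (simp add: add_mult_distrib_mat[of _ d d _ _ N] mult_smult_assoc_mat[of _ d d _ N])
    ultimately show ?thesis by simp
  qed
  have "spectral_shift ?H z * X = z \<cdot>\<^sub>m 1\<^sub>m N"
  proof -
    have S: "spectral_shift ?H z = cmat ?H - z \<cdot>\<^sub>m 1\<^sub>m N"
      using A by (simp add: spectral_shift_def)
    have cHc: "cmat ?H \<in> carrier_mat N N" using H by simp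
    have "spectral_shift ?H z * X = cmat ?H * X - z \<cdot>\<^sub>m X"
      unfolding S using cHc X
      by (simp add: minus_mult_distrib_mat[of _ N N _ _ N] mult_smult_assoc_mat[of _ N N _ N])
    also have "cmat ?H * X = cmat ?H * (?A * (?R * ?At)) - cmat ?H"
      unfolding X_def using mult_minus_distrib_mat[OF cHc ARA one_carrier_mat] right_mult_one_mat[OF cHc] by simp
    also have "cmat ?H * (?A * (?R * ?At)) = ?A * (?At * (?A * (?R * ?At)))"
      unfolding cH using cA cAt ARA by (intro assoc_mult_mat) auto
    also have "\<dots> = cmat ?H + z \<cdot>\<^sub>m (?A * (?R * ?At))"
      unfolding AtARA cH using cA cAt R
      by (simp add: mult_add_distrib_mat[of _ N d _ N] mult_smult_distrib[of _ N d _ N])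
    finally have eq: "spectral_shift ?H z * X = cmat ?H + z \<cdot>\<^sub>m (?A * (?R * ?At)) - cmat ?H - z \<cdot>\<^sub>m X" .
    show ?thesis
      unfolding eq by (rule eq_matI) (use cHc ARA in \<open>auto simp: X_def algebra_simps simp del: index_mult_mat(1)\<close>)
  qed
  note RH = resolvent_inverse[OF H symH z]
  from \<open>spectral_shift ?H z * X = z \<cdot>\<^sub>m 1\<^sub>m N\<close> have "spectral_shift ?H z * ((1 / z) \<cdot>\<^sub>m X) = 1\<^sub>m N"
  proof -
    assume *: "spectral_shift ?H z * X = z \<cdot>\<^sub>m 1\<^sub>m N"
    have "spectral_shift ?H z * ((1 / z) \<cdot>\<^sub>m X) = (1 / z) \<cdot>\<^sub>m (z \<cdot>\<^sub>m 1\<^sub>m N)"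
      using * X spectral_shift_carrier[OF H] mult_smult_distrib[of "spectral_shift ?H z" N N X N] by simp
    also have "\<dots> = 1\<^sub>m N" using z by (intro eq_matI) auto
    finally show ?thesis .
  qed
  then have "(1 / z) \<cdot>\<^sub>m X = resolvent ?H z"
    by (rule inverse_unique_mat[OF spectral_shift_carrier[OF H] RH(1) smult_carrier_mat[OF X] RH(3)])
  then have "z * mat_trace (resolvent ?H z) = z * mat_trace ((1 / z) \<cdot>\<^sub>m X)" by simp
  also have "\<dots> = mat_trace X"
  proof -
    have "z \<noteq> 0" using z by auto
    then show ?thesis using X by (simp add: mat_trace_def sum_distrib_left)
  qed
  also have "\<dots> = (\<Sum>i<N. (?A * (?R * ?At)) $$ (i, i) - 1)"
    unfolding mat_trace_def using ARA by (intro sum.cong) (auto simp: X_def simp del: index_mult_mat(1))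
  also have "\<dots> = (\<Sum>i<N. resolvent_form A z {..<N} i) - of_nat N"
    unfolding sum_subtractf
  proof (intro arg_cong2[of _ _ _ _ minus] sum.cong refl)
    fix i assume "i \<in> {..<N}"
    then have i: "i < N" by simp
    have "(?A * (?R * ?At)) $$ (i, i) = Matrix.row ?A i \<bullet> Matrix.col (?R * ?At) i"
      using i cA R cAt by simp
    also have "Matrix.row ?A i = crow A i" using i A by auto
    also have "Matrix.col (?R * ?At) i = ?R *\<^sub>v crow A i"
    proof -
      have "Matrix.col ?At i = crow A i" using i A by (intro eq_vecI) auto
      then show ?thesis using col_mult2[OF R(1) cAt i] by simp
    qed
    finally show "(?A * (?R * ?At)) $$ (i, i) = resolvent_form A z {..<N} i"
      by (simp add: resolvent_form_eq)
  qed simp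
  also have "(\<Sum>i<N. resolvent_form A z {..<N} i) = of_nat d + z * mat_trace (gres A z {..<N})"
    using sum_resolvent_forms[of "{..<N}" A z] A z by simp
  finally show ?thesis .
qed

text \<open>An eigenvalue $x$ satisfies $x^2 \le x$, as compressions of a projection do.\<close>

lemma eigenvalue_outer_in_unit_interval:
  assumes A: "A \<in> carrier_mat N d"
    and contr: "\<And>u. u \<in> carrier_vec d \<Longrightarrow> (A *\<^sub>v u) \<bullet> (A *\<^sub>v u) \<le> u \<bullet> u"
    and root: "poly (char_poly (A * transpose_mat A)) x = 0"
  shows "0 \<le> (x::real)" "x \<le> 1"
proof -
  let ?H = "A * transpose_mat A"
  have H: "?H \<in> carrier_mat N N" using A by simp
  then obtain v where v: "v \<in> carrier_vec N" "v \<noteq> 0\<^sub>v N" "?H *\<^sub>v v = x \<cdot>\<^sub>v v"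
    using root A unfolding eigenvalue_root_char_poly[OF H, symmetric] eigenvalue_def eigenvector_def by auto
  \<comment> \<open>On this vector the contraction hypothesis compares
    \<open>x * x * (v \<bullet> v)\<close> with \<open>x * (v \<bullet> v)\<close>.\<close>
  define u where "u = transpose_mat A *\<^sub>v v"
  have u: "u \<in> carrier_vec d" using A v by (auto simp: u_def)
  have Au: "A *\<^sub>v u = x \<cdot>\<^sub>v v"
    unfolding u_def using v A by (subst assoc_mult_mat_vec[symmetric, of _ N d _ N]) auto
  have "u \<bullet> u = v \<bullet> (A *\<^sub>v u)"
    using transpose_vec_mult_scalar[OF A u v(1)] by (simp add: u_def)
  then have uu: "u \<bullet> u = x * (v \<bullet> v)" using v by (simp add: Au)
  have vv: "v \<bullet> v > 0"
  proof -
    obtain i where i: "i < N" "v $ i \<noteq> 0"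
      using v(1,2) by (metis carrier_vecD eq_vecI index_zero_vec)
    have "0 < v $ i * v $ i" using i(2) not_real_square_gt_zero by blast
    also have "\<dots> \<le> v \<bullet> v"
      unfolding scalar_prod_def using v i
      by (intro member_le_sum[of i _ "\<lambda>i. v $ i * v $ i"]) auto
    finally show ?thesis .
  qed
  have "x * x * (v \<bullet> v) \<le> x * (v \<bullet> v)"
    using contr[OF u] v unfolding Au uu by simp
  then have le: "x * x \<le> x" using vv mult_le_cancel_right_pos by blast
  show "0 \<le> x" "x \<le> 1"
    using le order_trans[OF zero_le_square[of x] le] mult_le_cancel_left_pos[of x x 1] by (cases "x = 0"; simp)+
qed

section \<open>Submatrices of selected rows\<close>

lemma pick_bij:
  assumes "finite S"
  shows "bij_betw (pick S) {..<card S} S"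
proof -
  have "inj_on (pick S) {..<card S}"
    by (rule inj_onI) (metis card_pick lessThan_iff)
  moreover have "pick S ` {..<card S} \<subseteq> S"
    using pick_in_set by auto
  ultimately show ?thesis
    using assms by (metis bij_betw_def card_image card_lessThan card_subset_eq)
qed

context
  fixes W :: "real mat" and S A
  assumes S: "S \<subseteq> {..<dim_row W}"
  defines "A \<equiv> submatrix W S UNIV"
begin

lemma submatrix_rows_carrier: "A \<in> carrier_mat (card S) (dim_col W)"
proof -
  have "{i. i < dim_row W \<and> i \<in> S} = S" using S by auto
  then show ?thesis by (simp add: A_def submatrix_def)
qed

lemma submatrix_rows_row:
  assumes "i < card S"
  shows "Matrix.row A i = Matrix.row W (pick S i)"
proof (rule eq_vecI)
  have eq: "{i. i < dim_row W \<and> i \<in> S} = S" using S by auto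
  have "pick S i \<in> S" using assms by (rule pick_in_set[OF disjI1])
  then have p: "pick S i < dim_row W" using S by auto
  fix b assume "b < dim_vec (Matrix.row W (pick S i))"
  then have b: "b < dim_col W" by simp
  have "pick UNIV b = b"
    using pick_card_in_set[of b UNIV] by simp
  then show "Matrix.row A i $ b = Matrix.row W (pick S i) $ b"
    using submatrix_rows_carrier b assms p submatrix_index[of i W S b UNIV] eq by (simp add: A_def)
qed (use submatrix_rows_carrier in auto)

lemma sum_submatrix_rows: "(\<Sum>i<card S. f (Matrix.row A i)) = (\<Sum>j\<in>S. f (Matrix.row W j))"
proof -
  have fin: "finite S" using S finite_subset by blast
  have "(\<Sum>i<card S. f (Matrix.row A i)) = (\<Sum>i<card S. f (Matrix.row W (pick S i)))"
    by (intro sum.cong) (auto simp: submatrix_rows_row)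
  also have "\<dots> = (\<Sum>j\<in>S. f (Matrix.row W j))"
    using pick_bij[OF fin] by (rule sum.reindex_bij_betw)
  finally show ?thesis .
qed

text \<open>A Gram matrix does not see the order of its rows, so the renumbering by
  \<open>pick\<close> drops out.\<close>

lemma gram_of_rows_submatrix: "gram_of_rows A {..<card S} = gram_of_rows W S"
proof (rule eq_matI)
  fix a b assume "a < dim_row (gram_of_rows W S)" "b < dim_col (gram_of_rows W S)"
  then have ab: "a < dim_col W" "b < dim_col W" by (auto simp: gram_of_rows_def)
  have "(\<Sum>i<card S. A $$ (i, a) * A $$ (i, b)) = (\<Sum>i<card S. Matrix.row A i $ a * Matrix.row A i $ b)"
    using submatrix_rows_carrier ab by (intro sum.cong) auto
  also have "\<dots> = (\<Sum>j\<in>S. Matrix.row W j $ a * Matrix.row W j $ b)"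
    by (rule sum_submatrix_rows)
  also have "\<dots> = (\<Sum>j\<in>S. W $$ (j, a) * W $$ (j, b))"
    using S ab by (intro sum.cong) auto
  finally show "gram_of_rows A {..<card S} $$ (a, b) = gram_of_rows W S $$ (a, b)"
    using ab submatrix_rows_carrier by (auto simp: gram_of_rows_def)
qed (use submatrix_rows_carrier in \<open>auto simp: gram_of_rows_def\<close>)

text \<open>\<open>W\<close> is an isometry, and discarding coordinates of \<open>W u\<close> can
  only shorten it.\<close>

lemma submatrix_rows_contraction:
  assumes so: "semi_orthogonal W" and u: "u \<in> carrier_vec (dim_col W)"
  shows "(A *\<^sub>v u) \<bullet> (A *\<^sub>v u) \<le> u \<bullet> u"
proof -
  have "(A *\<^sub>v u) \<bullet> (A *\<^sub>v u) = (\<Sum>i<card S. (Matrix.row A i \<bullet> u)\<^sup>2)"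
    using submatrix_rows_carrier by (auto simp: scalar_prod_def[of "A *\<^sub>v u"] power2_eq_square intro!: sum.cong)
  also have "\<dots> = (\<Sum>j\<in>S. (Matrix.row W j \<bullet> u)\<^sup>2)"
    by (rule sum_submatrix_rows)
  also have "\<dots> \<le> (\<Sum>j<dim_row W. (Matrix.row W j \<bullet> u)\<^sup>2)"
    using S by (intro sum_mono2) auto
  also have "\<dots> = (W *\<^sub>v u) \<bullet> (W *\<^sub>v u)"
    by (auto simp: scalar_prod_def[of "W *\<^sub>v u"] power2_eq_square intro!: sum.cong)
  also have "\<dots> = (transpose_mat W *\<^sub>v (W *\<^sub>v u)) \<bullet> u"
    using transpose_vec_mult_scalar[of W "dim_row W" "dim_col W" u "W *\<^sub>v u"] u
      mult_mat_vec_carrier[of W "dim_row W" "dim_col W" u] by simp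
  also have "transpose_mat W *\<^sub>v (W *\<^sub>v u) = u"
    using so u by (subst assoc_mult_mat_vec[symmetric, of _ "dim_col W" "dim_row W" _ "dim_col W"])
      (auto simp: semi_orthogonal_def)
  finally show ?thesis .
qed

end

section \<open>Uniformly random subsets\<close>

text \<open>Values in any real vector space let the same lemmas serve complex traces and real error
  terms; \<open>expectation_pmf_of_set\<close> connects these averages with expectations.\<close>

definition avg :: "'a set \<Rightarrow> ('a \<Rightarrow> 'b::real_vector) \<Rightarrow> 'b" where
  "avg A f = (\<Sum>x\<in>A. f x) /\<^sub>R real (card A)"

lemma avg_const: "finite A \<Longrightarrow> A \<noteq> {} \<Longrightarrow> avg A (\<lambda>_. c) = c"
  by (simp add: avg_def sum_constant_scaleR)

lemma avg_add: "avg A (\<lambda>x. f x + g x) = avg A f + avg A g"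
  by (simp add: avg_def sum.distrib scaleR_add_right)

lemma avg_diff: "avg A (\<lambda>x. f x - g x) = avg A f - avg A g"
  by (simp add: avg_def sum_subtractf scaleR_diff_right)

lemma avg_mult_left: "avg A (\<lambda>x. c * f x) = c * (avg A f :: 'b::real_algebra)"
  by (simp add: avg_def sum_distrib_left)

lemma avg_cong: "(\<And>x. x \<in> A \<Longrightarrow> f x = g x) \<Longrightarrow> avg A f = avg A g"
  by (simp add: avg_def)

lemma avg_mono: "(\<And>x. x \<in> A \<Longrightarrow> f x \<le> g x) \<Longrightarrow> avg A f \<le> (avg A g :: real)"
  unfolding avg_def real_scaleR_def by (intro mult_left_mono sum_mono) auto

lemma avg_nonneg: "(\<And>x. x \<in> A \<Longrightarrow> 0 \<le> f x) \<Longrightarrow> 0 \<le> (avg A f :: real)"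
  by (simp add: avg_def sum_nonneg)

lemma norm_avg_le: "norm (avg A f) \<le> avg A (\<lambda>x. norm (f x))"
  unfolding avg_def real_scaleR_def norm_scaleR by (intro mult_mono norm_sum) auto

lemma avg_le_const:
  assumes "finite A" "A \<noteq> {}" "\<And>x. x \<in> A \<Longrightarrow> f x \<le> (c::real)"
  shows "avg A f \<le> c"
  using avg_mono[of A f "\<lambda>_. c"] assms by (simp add: avg_const)

lemma avg_reindex: "bij_betw h A B \<Longrightarrow> avg B f = avg A (\<lambda>x. f (h x))"
  unfolding avg_def by (metis bij_betw_same_card sum.reindex_bij_betw)

text \<open>Bias-variance decomposition: the cross term averages to 0 because
  \<open>f - avg A f\<close> does.\<close>

lemma avg_norm_shift:
  fixes f :: "'a \<Rightarrow> 'b::real_inner"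
  assumes "finite A" "A \<noteq> {}"
  shows "avg A (\<lambda>x. (norm (f x - c))\<^sup>2)
       = avg A (\<lambda>x. (norm (f x - avg A f))\<^sup>2) + (norm (avg A f - c))\<^sup>2"
proof -
  let ?m = "avg A f"
  have "(norm (f x - c))\<^sup>2 = (norm (f x - ?m))\<^sup>2 + (norm (?m - c))\<^sup>2 + 2 * inner (f x - ?m) (?m - c)" for x
    unfolding power2_norm_eq_inner by (simp add: algebra_simps inner_commute)
  then have "avg A (\<lambda>x. (norm (f x - c))\<^sup>2)
     = avg A (\<lambda>x. (norm (f x - ?m))\<^sup>2) + (norm (?m - c))\<^sup>2 + avg A (\<lambda>x. 2 * inner (f x - ?m) (?m - c))"
    using assms by (simp add: avg_add avg_const)
  also have "avg A (\<lambda>x. 2 * inner (f x - ?m) (?m - c)) = 2 * inner (avg A (\<lambda>x. f x - ?m)) (?m - c)"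
    unfolding avg_def by (simp add: inner_sum_left sum_distrib_left mult_ac)
  also have "\<dots> = 0" using assms by (simp add: avg_diff avg_const)
  finally show ?thesis by simp
qed

lemma avg_norm_le_sqrt:
  fixes f :: "'a \<Rightarrow> 'b::real_inner"
  assumes "finite A" "A \<noteq> {}"
  shows "avg A (\<lambda>x. norm (f x)) \<le> sqrt (avg A (\<lambda>x. (norm (f x))\<^sup>2))"
proof -
  let ?g = "\<lambda>x. norm (f x)"
  have "(avg A ?g)\<^sup>2 \<le> avg A (\<lambda>x. (?g x)\<^sup>2)"
    using avg_norm_shift[OF assms, of ?g 0] avg_nonneg[of A "\<lambda>x. (?g x - avg A ?g)\<^sup>2"] by simp
  then show ?thesis by (intro real_le_rsqrt)
qed

definition subsets_of_card :: "'a set \<Rightarrow> nat \<Rightarrow> 'a set set" where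
  "subsets_of_card A N = {P. P \<subseteq> A \<and> card P = N}"

lemma finite_subsets_of_card: "finite A \<Longrightarrow> finite (subsets_of_card A N)"
  by (simp add: subsets_of_card_def)

lemma card_subsets_of_card: "finite A \<Longrightarrow> card (subsets_of_card A N) = card A choose N"
  by (simp add: subsets_of_card_def n_subsets)

lemma subsets_of_card_nonempty: "finite A \<Longrightarrow> N \<le> card A \<Longrightarrow> subsets_of_card A N \<noteq> {}"
  using card_subsets_of_card[of A N] by (metis binomial_eq_0_iff card.empty not_le)

text \<open>Sets with a marked point are counted in two ways: point after set, or set after
  point.\<close>

lemma bij_betw_insert_point:
  assumes "finite A"
  shows "bij_betw (\<lambda>(x, P). (insert x P, x)) (SIGMA x:A. subsets_of_card (A - {x}) N)
           (SIGMA P:subsets_of_card A (Suc N). P)"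
  by (rule bij_betw_byWitness[where f' = "\<lambda>(P, x). (x, P - {x})"])
     (use assms in \<open>auto simp: subsets_of_card_def card_insert_if finite_subset\<close>)

lemma sum_insert_point:
  assumes "finite A"
  shows "(\<Sum>P\<in>subsets_of_card A (Suc N). \<Sum>x\<in>P. h P x)
       = (\<Sum>x\<in>A. \<Sum>P\<in>subsets_of_card (A - {x}) N. h (insert x P) x)"
proof -
  have fin: "finite P" if "P \<in> subsets_of_card A (Suc N)" for P
    using that assms by (auto simp: subsets_of_card_def finite_subset)
  have "(\<Sum>P\<in>subsets_of_card A (Suc N). \<Sum>x\<in>P. h P x)
      = (\<Sum>(P, x)\<in>(SIGMA P:subsets_of_card A (Suc N). P). h P x)"
    using assms fin by (intro sum.Sigma) (auto intro: finite_subsets_of_card)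
  also have "\<dots> = (\<Sum>(x, P)\<in>(SIGMA x:A. subsets_of_card (A - {x}) N). h (insert x P) x)"
    by (subst sum.reindex_bij_betw[OF bij_betw_insert_point[OF assms], symmetric])
       (simp add: case_prod_unfold)
  also have "\<dots> = (\<Sum>x\<in>A. \<Sum>P\<in>subsets_of_card (A - {x}) N. h (insert x P) x)"
    using assms by (intro sum.Sigma[symmetric]) (auto intro: finite_subsets_of_card)
  finally show ?thesis .
qed

text \<open>A uniform subset may be drawn as a uniform first point followed by a uniform subset of
  the rest. Each set arises once for each of its points, whence
  \<open>(N+1) * (a choose (N+1)) = a * ((a-1) choose N)\<close>.\<close>

lemma avg_subsets_Suc:
  assumes "finite A" "Suc N \<le> card A"
  shows "avg (subsets_of_card A (Suc N)) h
       = avg A (\<lambda>x. avg (subsets_of_card (A - {x}) N) (\<lambda>P. h (insert x P)))"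
proof -
  define a where "a = card A"
  have cA: "card (subsets_of_card (A - {x}) N) = (a - 1) choose N" if "x \<in> A" for x
    using that assms by (simp add: card_subsets_of_card a_def)
  have "(\<Sum>P\<in>subsets_of_card A (Suc N). \<Sum>x\<in>P. h P)
      = (\<Sum>P\<in>subsets_of_card A (Suc N). real (Suc N) *\<^sub>R h P)"
    by (intro sum.cong) (auto simp: subsets_of_card_def sum_constant_scaleR)
  then have *: "real (Suc N) *\<^sub>R (\<Sum>P\<in>subsets_of_card A (Suc N). h P)
      = (\<Sum>x\<in>A. \<Sum>P\<in>subsets_of_card (A - {x}) N. h (insert x P))"
    using sum_insert_point[OF assms(1), of "\<lambda>P x. h P" N] by (simp add: scaleR_sum_right)
  have "Suc N * (a choose Suc N) = a * ((a - 1) choose N)"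
    using assms(2) Suc_times_binomial_eq[of "a - 1" N] by (simp add: a_def)
  then have b: "real (Suc N) * real (a choose Suc N) = real a * real ((a - 1) choose N)"
    by (metis of_nat_mult)
  have "avg A (\<lambda>x. avg (subsets_of_card (A - {x}) N) (\<lambda>P. h (insert x P)))
      = (\<Sum>x\<in>A. \<Sum>P\<in>subsets_of_card (A - {x}) N. h (insert x P)) /\<^sub>R (real a * real ((a - 1) choose N))"
    unfolding avg_def by (simp add: cA a_def[symmetric] scaleR_sum_right)
  also have "\<dots> = avg (subsets_of_card A (Suc N)) h"
    unfolding *[symmetric] b[symmetric] avg_def card_subsets_of_card[OF assms(1)] a_def[symmetric]
    by (simp del: of_nat_Suc)
  finally show ?thesis by simp
qed

lemma bij_betw_subsets_transpose:
  assumes "x \<in> A" "y \<in> A"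
  shows "bij_betw ((`) (Transposition.transpose x y)) (subsets_of_card (A - {x}) N) (subsets_of_card (A - {y}) N)"
proof (rule bij_betw_byWitness[where f' = "(`) (Transposition.transpose x y)"])
  let ?t = "Transposition.transpose x y"
  have inv: "?t ` (?t ` P) = P" for P by (simp add: image_image)
  have c: "card (?t ` P) = card P" for P by (intro card_image inj_on_inverseI[of _ ?t]) simp
  show "\<forall>P\<in>subsets_of_card (A - {x}) N. ?t ` (?t ` P) = P"
    "\<forall>P\<in>subsets_of_card (A - {y}) N. ?t ` (?t ` P) = P"
    using inv by auto
  show "(`) ?t ` subsets_of_card (A - {x}) N \<subseteq> subsets_of_card (A - {y}) N"
    "(`) ?t ` subsets_of_card (A - {y}) N \<subseteq> subsets_of_card (A - {x}) N"
    using assms c by (auto simp: subsets_of_card_def Transposition.transpose_def)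
qed

text \<open>Drawing the points of a random subset one after the other, two choices of the first point
  are coupled by transposing them; so each draw contributes at most $K^2$ to the variance.\<close>

lemma variance_subsets_le:
  fixes f :: "'a set \<Rightarrow> 'b::real_inner"
  assumes "finite A" "N \<le> card A" "0 \<le> K"
    and "\<And>T x y. T \<subseteq> A \<Longrightarrow> Suc (card T) = N \<Longrightarrow> x \<in> A - T \<Longrightarrow> y \<in> A - T \<Longrightarrow>
           norm (f (insert x T) - f (insert y T)) \<le> K"
  shows "avg (subsets_of_card A N) (\<lambda>P. (norm (f P - avg (subsets_of_card A N) f))\<^sup>2) \<le> real N * K\<^sup>2"
  using assms
proof (induction N arbitrary: A f)
  case 0
  have "subsets_of_card A 0 = {{}}"
    using 0 by (auto simp: subsets_of_card_def finite_subset)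
  then show ?case by (simp add: avg_def)
next
  case (Suc N)
  note lip = Suc.prems(4)
  have finA: "finite A" and NA: "Suc N \<le> card A" by fact+
  have A0: "A \<noteq> {}" using NA by auto
  let ?S = "\<lambda>x. subsets_of_card (A - {x}) N"
  define g where "g x = avg (?S x) (\<lambda>P. f (insert x P))" for x
  have Sfin: "finite (?S x)" and Sne: "x \<in> A \<Longrightarrow> ?S x \<noteq> {}" for x
    using finA NA by (auto intro!: finite_subsets_of_card simp: subsets_of_card_nonempty)
  define m where "m = avg (subsets_of_card A (Suc N)) f"
  have m: "m = avg A g" unfolding m_def g_def by (rule avg_subsets_Suc) fact+
  have gxy: "norm (g x - g y) \<le> K" if x: "x \<in> A" and y: "y \<in> A" for x y
  proof -
    let ?t = "Transposition.transpose x y"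
    have "g x - g y = avg (?S x) (\<lambda>P. f (insert x P) - f (insert y (?t ` P)))"
      unfolding g_def avg_diff
      by (subst avg_reindex[OF bij_betw_subsets_transpose[OF x y]]) simp
    also have "norm \<dots> \<le> avg (?S x) (\<lambda>P. norm (f (insert x P) - f (insert y (?t ` P))))"
      by (rule norm_avg_le)
    also have "\<dots> \<le> K"
    proof (rule avg_le_const[OF Sfin Sne[OF x]])
      fix P assume P: "P \<in> ?S x"
      show "norm (f (insert x P) - f (insert y (?t ` P))) \<le> K"
      \<comment> \<open>If \<open>y\<close> already lies in \<open>P\<close>, both coupled sets
        coincide; otherwise the transposition fixes \<open>P\<close> and the sets differ by one
        exchange.\<close>
      proof (cases "y \<in> P")
        case True
        then have "insert y (?t ` P) = insert x P"
          using P by (auto simp: subsets_of_card_def Transposition.transpose_def image_iff)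
        then show ?thesis using Suc.prems(3) by simp
      next
        case False
        then have "?t ` P = P"
          using P by (auto simp: subsets_of_card_def Transposition.transpose_def image_iff)
        then show ?thesis using lip[of P x y] P False x y by (auto simp: subsets_of_card_def)
      qed
    qed
    finally show ?thesis .
  qed
  have gm: "norm (g x - m) \<le> K" if x: "x \<in> A" for x
  proof -
    have "g x - m = avg A (\<lambda>y. g x - g y)"
      unfolding m using finA A0 by (simp add: avg_diff avg_const)
    also have "norm \<dots> \<le> avg A (\<lambda>y. norm (g x - g y))" by (rule norm_avg_le)
    also have "\<dots> \<le> K" using finA A0 gxy[OF x] by (intro avg_le_const) auto
    finally show ?thesis .
  qed
  \<comment> \<open>Conditioning on the first point \<open>x\<close>: the variance around
    \<open>g x\<close> is the induction hypothesis for \<open>f\<close> with \<open>x\<close>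
    inserted, and the shift from \<open>g x\<close> to \<open>m\<close> costs at most the square of
    \<open>K\<close>.\<close>
  have "avg (?S x) (\<lambda>P. (norm (f (insert x P) - m))\<^sup>2) \<le> real N * K\<^sup>2 + K\<^sup>2" if x: "x \<in> A" for x
  proof -
    have "avg (?S x) (\<lambda>P. (norm (f (insert x P) - m))\<^sup>2)
        = avg (?S x) (\<lambda>P. (norm (f (insert x P) - g x))\<^sup>2) + (norm (g x - m))\<^sup>2"
      unfolding g_def by (rule avg_norm_shift[OF Sfin Sne[OF x]])
    also have "avg (?S x) (\<lambda>P. (norm (f (insert x P) - g x))\<^sup>2) \<le> real N * K\<^sup>2"
      unfolding g_def
    proof (rule Suc.IH)
      show "finite (A - {x})" "N \<le> card (A - {x})" "0 \<le> K" using finA NA x Suc.prems(3) by auto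
      fix T y z
      assume T: "T \<subseteq> A - {x}" "Suc (card T) = N" "y \<in> A - {x} - T" "z \<in> A - {x} - T"
      then have "x \<notin> T" "finite T" using finA by (auto simp: finite_subset)
      then have "norm (f (insert y (insert x T)) - f (insert z (insert x T))) \<le> K"
        using T x by (intro lip) auto
      then show "norm (f (insert x (insert y T)) - f (insert x (insert z T))) \<le> K"
        by (simp add: insert_commute)
    qed
    also have "(norm (g x - m))\<^sup>2 \<le> K\<^sup>2" using gm[OF x] by (intro power_mono) auto
    finally show ?thesis by simp
  qed
  then have "avg A (\<lambda>x. avg (?S x) (\<lambda>P. (norm (f (insert x P) - m))\<^sup>2)) \<le> real N * K\<^sup>2 + K\<^sup>2"
    by (rule avg_le_const[OF finA A0])
  then show ?case
    unfolding m_def[symmetric]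
    by (subst avg_subsets_Suc[OF finA NA]) (simp add: algebra_simps)
qed

lemma expectation_pmf_of_set:
  fixes f :: "'a \<Rightarrow> 'b::{banach, second_countable_topology}"
  assumes "finite A" "A \<noteq> {}"
  shows "measure_pmf.expectation (pmf_of_set A) f = avg A f"
proof -
  have "measure_pmf.expectation (pmf_of_set A) f = (\<Sum>x\<in>A. pmf (pmf_of_set A) x *\<^sub>R f x)"
    using assms by (intro integral_measure_pmf) auto
  also have "\<dots> = (\<Sum>x\<in>A. (1 / real (card A)) *\<^sub>R f x)"
    using assms by (intro sum.cong) auto
  finally show ?thesis by (simp add: avg_def scaleR_sum_right inverse_eq_divide)
qed

lemma expectation_random_subset:
  assumes "finite A" "N \<le> card A"
  shows "measure_pmf.expectation (random_subset A N) h = (avg (subsets_of_card A N) h :: real)"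
  using assms finite_subsets_of_card[of A N] subsets_of_card_nonempty[of A N]
  by (simp add: random_subset_def expectation_pmf_of_set subsets_of_card_def)

lemma set_random_subset:
  assumes "finite A" "N \<le> card A"
  shows "set_pmf (random_subset A N) = subsets_of_card A N"
  using assms finite_subsets_of_card[of A N] subsets_of_card_nonempty[of A N]
  by (simp add: random_subset_def subsets_of_card_def)

text \<open>Markov's inequality, with nonnegativity and the lower bound demanded only on the
  support.\<close>

lemma prob_le_expectation_ge:
  fixes p :: "'a pmf" and h :: "'a \<Rightarrow> real"
  assumes "finite (set_pmf p)" "\<And>x. x \<in> set_pmf p \<Longrightarrow> 0 \<le> h x" "\<And>x. x \<in> B \<Longrightarrow> x \<in> set_pmf p \<Longrightarrow> c \<le> h x"
  shows "c * measure_pmf.prob p B \<le> measure_pmf.expectation p h"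
proof -
  have "c * measure_pmf.prob p B = measure_pmf.expectation p (\<lambda>x. c * indicator B x)"
    by simp
  also have "\<dots> \<le> measure_pmf.expectation p h"
    using assms by (intro integral_mono_AE integrable_measure_pmf_finite) (auto simp: AE_measure_pmf_iff indicator_def)
  finally show ?thesis .
qed

lemma chebyshev_random_subset:
  fixes f :: "'a set \<Rightarrow> 'b::real_inner"
  assumes A: "finite A" "N \<le> card A" "0 \<le> K" and "0 < \<epsilon>"
    and lip: "\<And>T x y. T \<subseteq> A \<Longrightarrow> Suc (card T) = N \<Longrightarrow> x \<in> A - T \<Longrightarrow> y \<in> A - T \<Longrightarrow>
           norm (f (insert x T) - f (insert y T)) \<le> K"
  shows "measure_pmf.prob (random_subset A N) {P. \<epsilon> < norm (f P - avg (subsets_of_card A N) f)}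
       \<le> real N * K\<^sup>2 / \<epsilon>\<^sup>2"
proof -
  let ?h = "\<lambda>P. (norm (f P - avg (subsets_of_card A N) f))\<^sup>2"
  have "\<epsilon>\<^sup>2 * measure_pmf.prob (random_subset A N) {P. \<epsilon> < norm (f P - avg (subsets_of_card A N) f)}
      \<le> measure_pmf.expectation (random_subset A N) ?h"
    using A \<open>0 < \<epsilon>\<close> finite_subsets_of_card[of A N]
    by (intro prob_le_expectation_ge) (auto simp: set_random_subset intro: power_mono)
  also have "\<dots> \<le> real N * K\<^sup>2"
    unfolding expectation_random_subset[OF A(1,2)] by (rule variance_subsets_le) (use A lip in auto)
  finally show ?thesis using \<open>0 < \<epsilon>\<close> by (simp add: field_simps)
qed

section \<open>Random subsets with a marked index\<close>

definition selections :: "nat \<Rightarrow> nat \<Rightarrow> (nat set \<times> nat) set" where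
  "selections n N = (SIGMA P:subsets_of_card {..<n} N. P)"

text \<open>Every set drawn has the same size \<open>N\<close>, so choosing a set and then a point
  of it is uniform on all pairs.\<close>

lemma random_selection_eq:
  assumes "1 \<le> N" "N \<le> n"
  shows "random_selection n N = pmf_of_set (selections n N)"
proof -
  let ?A = "subsets_of_card {..<n} N"
  have fin: "finite ?A" and ne: "?A \<noteq> {}"
    using assms by (auto intro: finite_subsets_of_card simp: subsets_of_card_nonempty)
  have P: "finite P" "P \<noteq> {}" "card P = N" if "P \<in> ?A" for P
    using that assms by (auto simp: subsets_of_card_def finite_subset)
  have finS: "finite (selections n N)" unfolding selections_def using fin P by auto
  have neS: "selections n N \<noteq> {}"
    using ne P(2) unfolding selections_def by (metis Sigma_empty_iff all_not_in_conv)
  have cS: "card (selections n N) = card ?A * N"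
    unfolding selections_def using fin P by (simp add: card_SigmaI)
  show ?thesis
  proof (rule pmf_eqI)
    fix x :: "nat set \<times> nat"
    obtain Q j where x: "x = (Q, j)" by (cases x)
    have "pmf (random_selection n N) (Q, j) = 
        (\<Sum>P\<in>?A. pmf (map_pmf (\<lambda>j. (P, j)) (pmf_of_set P)) (Q, j)) / real (card ?A)"
      unfolding random_selection_def random_subset_def subsets_of_card_def[symmetric]
      using fin ne by (simp add: pmf_bind integral_pmf_of_set)
    also have "(\<Sum>P\<in>?A. pmf (map_pmf (\<lambda>j. (P, j)) (pmf_of_set P)) (Q, j))
        = (\<Sum>P\<in>?A. if P = Q then indicator Q j / real N else 0)"
    proof (intro sum.cong refl)
      fix P assume PA: "P \<in> ?A"
      have "map_pmf (\<lambda>j. (P, j)) (pmf_of_set P) = pmf_of_set ((\<lambda>j. (P, j)) ` P)"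
        using P[OF PA] by (intro map_pmf_of_set_inj) (auto simp: inj_on_def)
      then show "pmf (map_pmf (\<lambda>j. (P, j)) (pmf_of_set P)) (Q, j) = (if P = Q then indicator Q j / real N else 0)"
        using P[OF PA] by (auto simp: card_image inj_on_def indicator_def)
    qed
    also have "\<dots> = (if Q \<in> ?A then indicator Q j / real N else 0)"
      using fin by (simp add: sum.delta)
    also have "\<dots> / real (card ?A) = pmf (pmf_of_set (selections n N)) (Q, j)"
      using finS neS cS by (auto simp: selections_def indicator_def)
    finally show "pmf (random_selection n N) x = pmf (pmf_of_set (selections n N)) x"
      unfolding x .
  qed
qed

lemma finite_selections: "finite (selections n N)"
  unfolding selections_def by (auto intro!: finite_SigmaI finite_subsets_of_card simp: subsets_of_card_def finite_subset)

lemma selections_nonempty: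
  assumes "1 \<le> N" "N \<le> n"
  shows "selections n N \<noteq> {}"
proof -
  obtain P where "P \<in> subsets_of_card {..<n} N"
    using subsets_of_card_nonempty[of "{..<n}" N] assms by auto
  moreover from this obtain j where "j \<in> P" using assms by (force simp: subsets_of_card_def)
  ultimately show ?thesis by (auto simp: selections_def)
qed

lemma avg_selections:
  assumes "1 \<le> N" "N \<le> n"
  shows "avg (selections n N) (\<lambda>(P, j). h P j) = avg (subsets_of_card {..<n} N) (\<lambda>P. (\<Sum>j\<in>P. h P j) /\<^sub>R real N)"
proof -
  let ?A = "subsets_of_card {..<n} N"
  have fin: "finite ?A" by (auto intro: finite_subsets_of_card)
  have P: "finite P" "card P = N" if "P \<in> ?A" for P
    using that by (auto simp: subsets_of_card_def finite_subset)
  have cS: "card (selections n N) = card ?A * N"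
    unfolding selections_def using fin P by (simp add: card_SigmaI)
  have "(\<Sum>(P, j)\<in>selections n N. h P j) = (\<Sum>P\<in>?A. \<Sum>j\<in>P. h P j)"
    unfolding selections_def using fin P by (intro sum.Sigma[symmetric]) auto
  then show ?thesis
    by (simp add: avg_def cS scaleR_sum_right[symmetric])
qed

text \<open>Given \<open>P - {j} = S\<close> with one point missing, the pair is
  \<open>(insert j S, j)\<close> for some \<open>j\<close> outside \<open>S\<close>, and
  conditioning keeps uniformity. The conditional expectation is thus a plain average over the
  unselected indices.\<close>

lemma cond_expectation_index_eq:
  assumes "1 \<le> N" "N \<le> n" and S: "S \<subseteq> {..<n}" "Suc (card S) = N"
  shows "cond_expectation_index n N X S = avg ({..<n} - S) (X S)"
proof -
  let ?E = "{(P, j). P - {j} = S}"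
  let ?B = "{..<n} - S" and ?h = "\<lambda>j. (insert j S, j)"
  have finS: "finite S" using S finite_subset by blast
  have cB: "card ?B = n - card S" using S finS by (simp add: card_Diff_subset)
  then have Bne: "?B \<noteq> {}" using S assms(2) by (metis card.empty diff_is_0_eq not_less_eq_eq)
  have inter: "selections n N \<inter> ?E = ?h ` ?B"
    using S finS by (auto simp: selections_def subsets_of_card_def image_iff insert_absorb)
  have cond: "cond_pmf (random_selection n N) ?E = pmf_of_set (?h ` ?B)"
  proof (rule pmf_eqI)
    fix x
    have ne: "set_pmf (random_selection n N) \<inter> ?E \<noteq> {}"
      using Bne inter assms by (simp add: random_selection_eq finite_selections selections_nonempty)
    have ne2: "?h ` ?B \<noteq> {}" using Bne by auto
    show "pmf (cond_pmf (random_selection n N) ?E) x = pmf (pmf_of_set (?h ` ?B)) x"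
      unfolding pmf_cond[OF ne]
      using assms ne2 inter finite_selections[of n N] selections_nonempty[of N n]
      by (auto simp: random_selection_eq measure_pmf_of_set indicator_def)
  qed
  have inj: "inj_on ?h ?B" by (auto simp: inj_on_def)
  have "cond_expectation_index n N X S = avg (?h ` ?B) (\<lambda>(P, j). X (P - {j}) j)"
    unfolding cond_expectation_index_def cond using Bne by (subst expectation_pmf_of_set) auto
  also have "\<dots> = avg ?B (\<lambda>j. X (insert j S - {j}) j)"
    by (subst avg_reindex[OF inj_on_imp_bij_betw[OF inj]]) simp
  also have "\<dots> = avg ?B (X S)"
    by (rule avg_cong) (auto intro!: arg_cong2[of _ _ _ _ X])
  finally show ?thesis .
qed

section \<open>The Stieltjes transform of the limit law\<close>

lemma has_integral_cos_multiple:
  assumes "0 < (j::nat)"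
  shows "((\<lambda>\<theta>. cos (real j * \<theta>)) has_integral 0) {0..pi}"
proof -
  have "((\<lambda>\<theta>. cos (real j * \<theta>)) has_integral sin (real j * pi) / real j - sin (real j * 0) / real j) {0..pi}"
    by (rule fundamental_theorem_of_calculus)
       (use assms in \<open>auto intro!: derivative_eq_intros simp flip: has_real_derivative_iff_has_vector_derivative\<close>)
  then show ?thesis by simp
qed

text \<open>Orthogonality of the sines on a half period; only the first harmonic pairs with
  \<open>sin \<theta>\<close>.\<close>

lemma has_integral_sin_multiple_sin:
  "((\<lambda>\<theta>. sin (real (Suc k) * \<theta>) * sin \<theta>) has_integral (if k = 0 then pi / 2 else 0)) {0..pi}"
proof -
  have eq: "sin (real (Suc k) * \<theta>) * sin \<theta> = (cos (real k * \<theta>) - cos (real (k + 2) * \<theta>)) / 2" for \<theta>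
    unfolding sin_times_sin by (simp add: algebra_simps)
  have "((\<lambda>\<theta>. cos (real k * \<theta>)) has_integral (if k = 0 then pi else 0)) {0..pi}"
    using has_integral_cos_multiple[of k] has_integral_const_real[of "1::real" 0 pi] by (cases "k = 0") auto
  then have "((\<lambda>\<theta>. (cos (real k * \<theta>) - cos (real (k + 2) * \<theta>)) / 2) has_integral ((if k = 0 then pi else 0) - 0) / 2) {0..pi}"
    by (intro has_integral_divide has_integral_diff has_integral_cos_multiple) auto
  then show ?thesis unfolding eq by (simp split: if_splits)
qed

text \<open>This is \<open>(1 - w e^(i \<theta>)) (1 - w e^(-i \<theta>))\<close>, the Poisson
  kernel denominator for real \<open>w\<close>, kept analytic in complex \<open>w\<close>.\<close>

definition poisson_denom :: "complex \<Rightarrow> real \<Rightarrow> complex" where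
  "poisson_denom w \<theta> = 1 - 2 * w * of_real (cos \<theta>) + w\<^sup>2"

lemma poisson_denom_bound:
  assumes "cmod w \<le> 1"
  shows "(1 - cmod w)\<^sup>2 \<le> cmod (poisson_denom w \<theta>)"
proof -
  have "of_real (cos \<theta>) = (cis \<theta> + cis (- \<theta>)) / 2"
    by (simp add: complex_eq_iff)
  moreover have "cis \<theta> * cis (- \<theta>) = 1" by (simp add: cis_mult)
  ultimately have eq: "poisson_denom w \<theta> = (1 - w * cis \<theta>) * (1 - w * cis (- \<theta>))"
    unfolding poisson_denom_def by (simp add: field_simps power2_eq_square) algebra
  have "1 - cmod w \<le> cmod (1 - w * cis t)" for t
    using norm_triangle_ineq2[of 1 "w * cis t"] by (simp add: norm_mult)
  then show ?thesis
    unfolding eq norm_mult power2_eq_square using assms by (intro mult_mono) auto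
qed

text \<open>The truncated generating function of the Chebyshev polynomials of the second kind, times
  \<open>sin \<theta>\<close>; it telescopes by their three-term recurrence.\<close>

lemma sum_sin_multiples:
  "(\<Sum>k<K. w ^ k * of_real (sin (real (Suc k) * \<theta>))) * poisson_denom w \<theta>
     = of_real (sin \<theta>) - w ^ K * of_real (sin (real (Suc K) * \<theta>)) + w ^ Suc K * of_real (sin (real K * \<theta>))"
proof (induction K)
  case (Suc K)
  have *: "sin (real (Suc (Suc K)) * \<theta>) = 2 * sin (real (Suc K) * \<theta>) * cos \<theta> - sin (real K * \<theta>)"
  proof -
    have "real (Suc (Suc K)) * \<theta> = real (Suc K) * \<theta> + \<theta>" "real K * \<theta> = real (Suc K) * \<theta> - \<theta>"
      by (simp_all add: algebra_simps)
    then show ?thesis by (simp only: sin_add sin_diff)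
  qed
  show ?case
    unfolding sum.lessThan_Suc distrib_right Suc.IH *
    by (simp add: poisson_denom_def algebra_simps power2_eq_square del: of_nat_Suc)
qed simp

text \<open>Every nonempty partial sum of the generating series, times \<open>sin \<theta>\<close>,
  integrates to \<open>pi / 2\<close> by orthogonality. The remainder is of order
  \<open>cmod w ^ K\<close> uniformly in \<theta>, so the integral, which exists by continuity, has
  the same value.\<close>

lemma has_integral_poisson_open:
  assumes w: "cmod w < 1"
  shows "((\<lambda>\<theta>. of_real ((sin \<theta>)\<^sup>2) / poisson_denom w \<theta>) has_integral of_real (pi / 2)) {0..pi}"
proof -
  let ?f = "\<lambda>\<theta>. complex_of_real ((sin \<theta>)\<^sup>2) / poisson_denom w \<theta>"
  let ?S = "\<lambda>K \<theta>. \<Sum>k<K. w ^ k * complex_of_real (sin (real (Suc k) * \<theta>) * sin \<theta>)"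
  define \<delta> where "\<delta> = (1 - cmod w)\<^sup>2"
  have \<delta>: "0 < \<delta>" using w by (simp add: \<delta>_def)
  have D: "\<delta> \<le> cmod (poisson_denom w \<theta>)" for \<theta>
    unfolding \<delta>_def using w by (intro poisson_denom_bound) auto
  have D0: "poisson_denom w \<theta> \<noteq> 0" for \<theta> using D[of \<theta>] \<delta> by auto
  have "continuous_on {0..pi} ?f"
    using D0 unfolding poisson_denom_def by (intro continuous_intros) auto
  then have "?f integrable_on {0..pi}" by (rule integrable_continuous_real)
  then obtain I where I: "(?f has_integral I) {0..pi}" by blast
  have S: "(?S (Suc K) has_integral of_real (pi / 2)) {0..pi}" for K
  proof -
    have "((\<lambda>\<theta>. w ^ k * complex_of_real (sin (real (Suc k) * \<theta>) * sin \<theta>)) has_integral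
            w ^ k * of_real (if k = 0 then pi / 2 else 0)) {0..pi}" for k
      by (intro has_integral_mult_right has_integral_of_real has_integral_sin_multiple_sin)
    then have "(?S (Suc K) has_integral (\<Sum>k<Suc K. w ^ k * of_real (if k = 0 then pi / 2 else 0))) {0..pi}"
      by (intro has_integral_sum) auto
    also have "(\<Sum>k<Suc K. w ^ k * complex_of_real (if k = 0 then pi / 2 else 0))
        = (\<Sum>k<Suc K. if k = 0 then of_real (pi / 2) else 0)"
      by (intro sum.cong) auto
    also have "\<dots> = of_real (pi / 2)" by (subst sum.delta) auto
    finally show ?thesis .
  qed
  have bound: "cmod (I - of_real (pi / 2)) \<le> 2 * pi / \<delta> * cmod w ^ K" for K
  proof -
    have "cmod (I - of_real (pi / 2)) \<le> (2 * cmod w ^ K / \<delta>) * measure lborel {0..pi}"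
    proof (rule has_integral_bound_real[OF _ finite.emptyI has_integral_diff[OF I S[of K]]])
      show "0 \<le> 2 * cmod w ^ K / \<delta>" using \<delta> by simp
      fix \<theta> :: real
      let ?s = "w ^ Suc K * complex_of_real (sin (real (Suc (Suc K)) * \<theta>)) - w ^ Suc (Suc K) * of_real (sin (real (Suc K) * \<theta>))"
      have "?S (Suc K) \<theta> = of_real (sin \<theta>) * (\<Sum>k<Suc K. w ^ k * of_real (sin (real (Suc k) * \<theta>)))"
        unfolding sum_distrib_left by (intro sum.cong) (simp_all add: mult_ac)
      then have "?S (Suc K) \<theta> * poisson_denom w \<theta> = of_real (sin \<theta>) * (of_real (sin \<theta>) - ?s)"
        using sum_sin_multiples[where K = "Suc K"] by (simp only: mult.assoc) (simp add: algebra_simps)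
      then have "?S (Suc K) \<theta> = of_real (sin \<theta>) * (of_real (sin \<theta>) - ?s) / poisson_denom w \<theta>"
        using D0 by (simp add: field_simps)
      then have "?f \<theta> - ?S (Suc K) \<theta> = of_real (sin \<theta>) * ?s / poisson_denom w \<theta>"
        by (simp add: diff_divide_distrib[symmetric] right_diff_distrib power2_eq_square)
      also have "cmod \<dots> = \<bar>sin \<theta>\<bar> * cmod ?s / cmod (poisson_denom w \<theta>)"
        by (simp only: norm_mult norm_divide norm_of_real)
      also have "\<dots> \<le> 1 * (2 * cmod w ^ K) / \<delta>"
      proof (intro frac_le mult_mono)
        have "cmod ?s \<le> cmod w ^ Suc K * \<bar>sin (real (Suc (Suc K)) * \<theta>)\<bar> + cmod w ^ Suc (Suc K) * \<bar>sin (real (Suc K) * \<theta>)\<bar>"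
          by (rule order_trans[OF norm_triangle_ineq4]) (simp only: norm_mult norm_power norm_of_real order_refl)
        also have "\<dots> \<le> cmod w ^ K * 1 + cmod w ^ K * 1"
          using w by (intro add_mono mult_mono power_decreasing) auto
        finally show "cmod ?s \<le> 2 * cmod w ^ K" by simp
      qed (use D \<delta> in auto)
      finally show "cmod (?f \<theta> - ?S (Suc K) \<theta>) \<le> 2 * cmod w ^ K / \<delta>" by simp
    qed
    then show ?thesis by (simp add: field_simps)
  qed
  have "(\<lambda>K. 2 * pi / \<delta> * cmod w ^ K) \<longlonglongrightarrow> 2 * pi / \<delta> * 0"
    using w by (intro tendsto_intros LIMSEQ_power_zero) auto
  then have "cmod (I - of_real (pi / 2)) \<le> 0"
    using bound by (intro LIMSEQ_le_const) auto
  then have "I = of_real (pi / 2)" by (simp only: norm_le_zero_iff right_minus_eq)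
  then show ?thesis using I by (simp only:)
qed

text \<open>The boundary values \<open>w = 1\<close> and \<open>w = -1\<close> are included because
  an edge of the limit law may touch 0 (when \<open>p = q\<close>) or 1 (when
  \<open>p + q = 1\<close>). There the integrand reduces to
  \<open>(1 + \<sigma> cos \<theta>) / 2\<close> away from the endpoints.\<close>

lemma has_integral_poisson:
  assumes "cmod w < 1 \<or> w = 1 \<or> w = -1"
  shows "((\<lambda>\<theta>. of_real ((sin \<theta>)\<^sup>2) / poisson_denom w \<theta>) has_integral of_real (pi / 2)) {0..pi}"
proof (cases "cmod w < 1")
  case False
  then obtain \<sigma> :: real where \<sigma>: "\<sigma> = 1 \<or> \<sigma> = -1" "w = of_real \<sigma>" using assms by force
  have "((\<lambda>\<theta>. (1 + \<sigma> * cos (real 1 * \<theta>)) / 2) has_integral (pi + \<sigma> * 0) / 2) {0..pi}"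
    using has_integral_const_real[of "1::real" 0 pi]
    by (intro has_integral_divide has_integral_add has_integral_mult_right has_integral_cos_multiple) auto
  then have "((\<lambda>\<theta>. complex_of_real ((1 + \<sigma> * cos \<theta>) / 2)) has_integral of_real (pi / 2)) {0..pi}"
    by (intro has_integral_of_real) simp
  then show ?thesis
  proof (rule has_integral_spike_finite[rotated 2])
    fix \<theta> assume "\<theta> \<in> {0..pi} - {0, pi}"
    then have "0 < \<theta>" "\<theta> < pi" by auto
    then have "0 < sin \<theta>" by (rule sin_gt_zero)
    have "(sin \<theta>)\<^sup>2 = (1 - \<sigma> * cos \<theta>) * (1 + \<sigma> * cos \<theta>)"
      using \<sigma>(1) by (auto simp: algebra_simps sin_squared_eq power2_eq_square)
    moreover from this have "1 - \<sigma> * cos \<theta> \<noteq> 0" using \<open>0 < sin \<theta>\<close> by auto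
    moreover have "poisson_denom w \<theta> = of_real (2 * (1 - \<sigma> * cos \<theta>))"
      using \<sigma> by (auto simp: poisson_denom_def)
    moreover from calculation have "(sin \<theta>)\<^sup>2 / (2 * (1 - \<sigma> * cos \<theta>)) = (1 + \<sigma> * cos \<theta>) / 2"
      by (metis mult.commute mult_divide_mult_cancel_left)
    ultimately show "complex_of_real ((sin \<theta>)\<^sup>2) / poisson_denom w \<theta> = of_real ((1 + \<sigma> * cos \<theta>) / 2)"
      by (metis of_real_divide)
  qed simp
qed (rule has_integral_poisson_open)

text \<open>The Stieltjes transform of the semicircle on $[c - e, c + e]$, after $x = c - e\cos\theta$.
  Of the two roots $g$ the one in the disc of radius $e$ is taken.\<close>

lemma has_integral_semicircle_stieltjes:
  fixes g \<zeta> :: complex and c e :: real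
  assumes e: "0 < e" and g: "g\<^sup>2 - 2 * (of_real c - \<zeta>) * g + (of_real e)\<^sup>2 = 0"
    and "cmod g < e \<or> g = of_real e \<or> g = - of_real e"
  shows "((\<lambda>\<theta>. of_real ((e * sin \<theta>)\<^sup>2) / (of_real (c - e * cos \<theta>) - \<zeta>)) has_integral of_real pi * g) {0..pi}"
proof -
  define w where "w = g / of_real e"
  have gw: "g = of_real e * w" using e by (simp add: w_def)
  have w: "cmod w < 1 \<or> w = 1 \<or> w = -1"
    using assms(3) e by (auto simp: w_def norm_divide field_simps)
  have g0: "g \<noteq> 0" using g e by auto
  \<comment> \<open>The quadratic equation for \<open>g\<close> says exactly that the shifted arc
    point is a multiple of the Poisson denominator at \<open>w = g / e\<close>.\<close>
  have D: "2 * g * (of_real (c - e * cos \<theta>) - \<zeta>) = (of_real e)\<^sup>2 * poisson_denom w \<theta>" for \<theta>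
    using g unfolding poisson_denom_def gw by (simp add: algebra_simps power2_eq_square)
  have eq: "of_real ((e * sin \<theta>)\<^sup>2) / (of_real (c - e * cos \<theta>) - \<zeta>)
      = 2 * g * (of_real ((sin \<theta>)\<^sup>2) / poisson_denom w \<theta>)" for \<theta>
  proof -
    have "of_real ((e * sin \<theta>)\<^sup>2) / (of_real (c - e * cos \<theta>) - \<zeta>)
        = 2 * g * of_real ((e * sin \<theta>)\<^sup>2) / (2 * g * (of_real (c - e * cos \<theta>) - \<zeta>))"
      using g0 by simp
    also have "\<dots> = 2 * g * ((of_real e)\<^sup>2 * of_real ((sin \<theta>)\<^sup>2)) / ((of_real e)\<^sup>2 * poisson_denom w \<theta>)"
      unfolding D by (simp add: power_mult_distrib)
    also have "\<dots> = 2 * g * (of_real ((sin \<theta>)\<^sup>2) / poisson_denom w \<theta>)"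
      using e by simp
    finally show ?thesis .
  qed
  have "((\<lambda>\<theta>. 2 * g * (of_real ((sin \<theta>)\<^sup>2) / poisson_denom w \<theta>)) has_integral 2 * g * of_real (pi / 2)) {0..pi}"
    by (intro has_integral_mult_right has_integral_poisson w)
  then show ?thesis unfolding eq by (simp add: mult.commute)
qed

text \<open>The roots have product \<open>e * e\<close>. If neither were inside the disc, both would
  have modulus \<open>e\<close> and be conjugate, so their sum \<open>2 * \<beta>\<close> would be
  real.\<close>

lemma quadratic_root_in_disc:
  fixes \<beta> :: complex and e :: real
  assumes "0 < e" "Im \<beta> \<noteq> 0"
  obtains g where "g\<^sup>2 - 2 * \<beta> * g + (of_real e)\<^sup>2 = 0" "cmod g < e"
proof -
  define r where "r = csqrt (\<beta>\<^sup>2 - (of_real e)\<^sup>2)"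
  have r: "r\<^sup>2 = \<beta>\<^sup>2 - (of_real e)\<^sup>2" by (simp add: r_def)
  define g1 where "g1 = \<beta> + r"
  define g2 where "g2 = \<beta> - r"
  have prod: "g1 * g2 = (of_real e)\<^sup>2"
    using r by (simp add: g1_def g2_def algebra_simps power2_eq_square)
  have q: "g1\<^sup>2 - 2 * \<beta> * g1 + (of_real e)\<^sup>2 = 0" "g2\<^sup>2 - 2 * \<beta> * g2 + (of_real e)\<^sup>2 = 0"
    using r by (simp_all add: g1_def g2_def algebra_simps power2_eq_square)
  have np: "cmod g1 * cmod g2 = e * e"
    using prod assms(1) by (metis norm_mult norm_of_real abs_of_pos power2_eq_square)
  consider "cmod g1 < e" | "cmod g2 < e" | "e \<le> cmod g1" "e \<le> cmod g2" by linarith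
  then show thesis
  proof cases
    case 3
    have "cmod g1 * e \<le> e * e" using np 3 mult_left_mono[OF 3(2), of "cmod g1"] by simp
    then have "cmod g1 = e" using 3 assms(1) by simp
    then have "g1 * cnj g1 = (of_real e)\<^sup>2" by (metis complex_norm_square of_real_power)
    then have "g1 * cnj g1 = g1 * g2" using prod by simp
    moreover have "g1 \<noteq> 0" using \<open>cmod g1 = e\<close> assms(1) by auto
    ultimately have "g2 = cnj g1" by simp
    moreover have "2 * \<beta> = g1 + g2" by (simp add: g1_def g2_def)
    ultimately have "2 * \<beta> = g1 + cnj g1" by metis
    then have "Im (2 * \<beta>) = 0" by simp
    then show ?thesis using assms(2) by simp
  qed (use q that in auto)
qed

lemma of_real_in_disc:
  assumes "\<bar>g\<bar> \<le> (e::real)"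
  shows "cmod (of_real g) < e \<or> complex_of_real g = of_real e \<or> complex_of_real g = - of_real e"
proof -
  have "\<bar>g\<bar> < e \<or> g = e \<or> g = - e" using assms by linarith
  then show ?thesis by (elim disjE) simp_all
qed

section \<open>Edges, mass and Stieltjes transform of the limit law\<close>

context
  fixes \<rho>r \<rho>s p q c e :: real
  assumes p_pos: "0 < p" and pq: "p \<le> q" and q_less: "q < 1"
    and p_eq: "p = 1 - \<rho>s" and q_eq: "q = (1 - \<rho>r)\<^sup>2"
  defines "c \<equiv> p + q - 2 * p * q" and "e \<equiv> 2 * sqrt (q * (1 - p) * (p * (1 - q)))"
begin

lemma edge_halfwidth_sq: "e\<^sup>2 = 4 * (q * (1 - p) * (p * (1 - q)))"
  using p_pos pq q_less by (simp add: e_def power_mult_distrib)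

lemma edge_halfwidth_pos: "0 < e"
  using p_pos pq q_less by (simp add: e_def)

text \<open>With \<open>a = q * (1 - p)\<close> and \<open>b = p * (1 - q)\<close> the edges are
  \<open>a + b\<close> plus or minus \<open>2 * sqrt (a * b)\<close>; thus \<open>c\<close> is the
  midpoint and \<open>e\<close> the half-width of the support.\<close>

lemma limit_edges: "limit_edge_lower \<rho>r \<rho>s = c - e" "limit_edge_upper \<rho>r \<rho>s = c + e"
proof -
  have x: "(1 - \<rho>r)\<^sup>2 * \<rho>s = q * (1 - p)" and y: "\<rho>r * (2 - \<rho>r) * (1 - \<rho>s) = p * (1 - q)"
  proof -
    have "\<rho>s = 1 - p" "\<rho>r * (2 - \<rho>r) = 1 - q"
      unfolding p_eq q_eq by (simp_all add: algebra_simps power2_eq_square)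
    then show "(1 - \<rho>r)\<^sup>2 * \<rho>s = q * (1 - p)" "\<rho>r * (2 - \<rho>r) * (1 - \<rho>s) = p * (1 - q)"
      using q_eq by simp_all
  qed
  have nn: "0 \<le> q * (1 - p)" "0 \<le> p * (1 - q)" using p_pos pq q_less by auto
  have "2 * (sqrt (q * (1 - p)) * sqrt (p * (1 - q))) = e"
    by (simp add: e_def real_sqrt_mult)
  then show "limit_edge_lower \<rho>r \<rho>s = c - e" "limit_edge_upper \<rho>r \<rho>s = c + e"
    unfolding limit_edge_lower_def limit_edge_upper_def x y using nn
    by (simp_all add: power2_diff power2_sum c_def algebra_simps)
qed

text \<open>Up to the factor 4 these are the discriminants of the quadratic for \<open>g\<close> at
  \<zeta> = 0 and \<zeta> = 1. As perfect squares they make the values at both poles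
  explicit.\<close>

lemma edge_identities: "c\<^sup>2 - e\<^sup>2 = (q - p)\<^sup>2" "(1 - c)\<^sup>2 - e\<^sup>2 = (1 - p - q)\<^sup>2"
  unfolding edge_halfwidth_sq c_def by (simp_all add: algebra_simps power2_eq_square)

lemma edges_in_unit_interval: "0 \<le> c - e" "c + e \<le> 1"
proof -
  have "0 \<le> c"
  proof -
    have "c = q * (1 - p) + p * (1 - q)" by (simp add: c_def algebra_simps)
    then show ?thesis using p_pos pq q_less by simp
  qed
  moreover have "e\<^sup>2 \<le> c\<^sup>2" using edge_identities(1) zero_le_power2[of "q - p"] by linarith
  ultimately have "e \<le> c" by (rule power2_le_imp_le[rotated])
  then show "0 \<le> c - e" by simp
  have "0 \<le> 1 - c"
  proof -
    have "1 - c = (1 - p) * (1 - q) + p * q" by (simp add: c_def algebra_simps)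
    then show ?thesis using p_pos pq q_less by simp
  qed
  moreover have "e\<^sup>2 \<le> (1 - c)\<^sup>2" using edge_identities(2) zero_le_power2[of "1 - p - q"] by linarith
  ultimately have "e \<le> 1 - c" by (rule power2_le_imp_le[rotated])
  then show "c + e \<le> 1" by simp
qed

definition arc_point :: "real \<Rightarrow> real" where
  "arc_point \<theta> = c - e * cos \<theta>"

text \<open>The factor \<open>e * sin \<theta>\<close> occurs twice: once from the square root in
  \<open>limit_density\<close>, once from the Jacobian of \<open>arc_point\<close>.\<close>

definition arc_density :: "real \<Rightarrow> real" where
  "arc_density \<theta> = (e * sin \<theta>)\<^sup>2 / (2 * pi * p * arc_point \<theta> * (1 - arc_point \<theta>))"

lemma arc_point_in_unit_interval: "0 \<le> arc_point \<theta>" "arc_point \<theta> \<le> 1"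
proof -
  have "\<bar>e * cos \<theta>\<bar> \<le> e * 1"
    unfolding abs_mult using edge_halfwidth_pos abs_cos_le_one[of \<theta>] by (intro mult_mono) auto
  then show "0 \<le> arc_point \<theta>" "arc_point \<theta> \<le> 1"
    using edges_in_unit_interval by (auto simp: arc_point_def abs_le_iff)
qed

lemma arc_density_nonneg: "0 \<le> arc_density \<theta>"
  using arc_point_in_unit_interval[of \<theta>] p_pos by (auto simp: arc_density_def)

text \<open>At an endpoint of the arc lying in $\{0, 1\}$ the numerator vanishes too, so the partial
  fraction decompositions below survive division by zero.\<close>

lemma arc_point_degenerate:
  assumes "arc_point \<theta> = 0 \<or> arc_point \<theta> = 1"
  shows "sin \<theta> = 0"
proof -
  have le: "\<bar>cos \<theta>\<bar> \<le> 1" by (rule abs_cos_le_one)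
  have "e \<le> \<bar>e * cos \<theta>\<bar>"
    using assms edges_in_unit_interval edge_halfwidth_pos by (auto simp: arc_point_def)
  then have "1 \<le> \<bar>cos \<theta>\<bar>" using edge_halfwidth_pos by (simp add: abs_mult)
  then have "\<bar>cos \<theta>\<bar> = 1" using le by simp
  then have "(cos \<theta>)\<^sup>2 = 1" by (metis power2_abs one_power2)
  then show ?thesis using sin_cos_squared_add[of \<theta>] by simp
qed

text \<open>The roots are \<open>c\<close> plus or minus \<open>q - p\<close>. Since
  \<open>p \<le> q\<close>, the smaller one is \<open>c - (q - p) = 2 * p * (1 - q)\<close>.\<close>

lemma root_at_0: "((\<lambda>\<theta>. complex_of_real ((e * sin \<theta>)\<^sup>2) / (of_real (arc_point \<theta>) - 0))
    has_integral of_real pi * of_real (2 * p * (1 - q))) {0..pi}"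
  unfolding arc_point_def
proof (rule has_integral_semicircle_stieltjes[OF edge_halfwidth_pos])
  let ?g = "2 * p * (1 - q)"
  have "?g\<^sup>2 - 2 * c * ?g + e\<^sup>2 = 0"
    unfolding edge_halfwidth_sq c_def by (simp add: algebra_simps power2_eq_square)
  then have "complex_of_real (?g\<^sup>2 - 2 * c * ?g + e\<^sup>2) = 0" by simp
  then show "(complex_of_real ?g)\<^sup>2 - 2 * (of_real c - 0) * of_real ?g + (of_real e)\<^sup>2 = 0" by simp
  have "?g\<^sup>2 \<le> e\<^sup>2"
  proof -
    have "p * (1 - q) \<le> q * (1 - p)" using pq by (simp add: algebra_simps)
    then have "p * (1 - q) * (p * (1 - q)) \<le> q * (1 - p) * (p * (1 - q))"
      using p_pos q_less by (intro mult_right_mono) auto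
    moreover have "?g\<^sup>2 = 4 * (p * (1 - q) * (p * (1 - q)))" by (simp add: power2_eq_square)
    ultimately show ?thesis unfolding edge_halfwidth_sq by linarith
  qed
  moreover have "0 < ?g" using p_pos q_less by simp
  ultimately have "?g \<le> e" using edge_halfwidth_pos by (metis less_imp_le power2_le_imp_le)
  then show "cmod (complex_of_real ?g) < e \<or> complex_of_real ?g = of_real e \<or> complex_of_real ?g = - of_real e"
    using \<open>0 < ?g\<close> by (intro of_real_in_disc) linarith
qed

text \<open>The roots are \<open>- b + A\<close> and \<open>- b - A\<close> with
  \<open>b = 1 - c\<close>, and the first lies in the disc. The sign of \<open>1 - p - q\<close> is
  open, hence the absolute value, which later cancels against the atom.\<close>

lemma root_at_1: "((\<lambda>\<theta>. complex_of_real ((e * sin \<theta>)\<^sup>2) / (of_real (arc_point \<theta>) - 1))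
    has_integral of_real pi * of_real (c - 1 + \<bar>1 - p - q\<bar>)) {0..pi}"
proof -
  define A where "A = \<bar>1 - p - q\<bar>"
  define b where "b = 1 - c"
  have A: "A\<^sup>2 = b\<^sup>2 - e\<^sup>2" using edge_identities(2) by (simp add: A_def b_def)
  have A0: "0 \<le> A" by (simp add: A_def)
  have e0: "0 < e" by (rule edge_halfwidth_pos)
  have eb: "e \<le> b" using edges_in_unit_interval by (simp add: b_def)
  have "(A - b)\<^sup>2 + 2 * b * (A - b) + e\<^sup>2 = 0"
    using A by (simp add: power2_eq_square algebra_simps)
  then have "complex_of_real ((A - b)\<^sup>2 + 2 * b * (A - b) + e\<^sup>2) = 0" by (simp only: of_real_0)
  then have g: "(complex_of_real (A - b))\<^sup>2 - 2 * (of_real c - 1) * of_real (A - b) + (of_real e)\<^sup>2 = 0"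
    by (simp add: b_def algebra_simps)
  have "0 \<le> 2 * e * (b - e)" using e0 eb by simp
  then have "(b - e)\<^sup>2 \<le> A\<^sup>2" unfolding A by (simp add: power2_eq_square algebra_simps)
  then have "b - e \<le> A" using A0 by (rule power2_le_imp_le)
  moreover have "A \<le> b"
  proof (rule power2_le_imp_le)
    show "A\<^sup>2 \<le> b\<^sup>2" using A by simp
    show "0 \<le> b" using e0 eb by simp
  qed
  ultimately have "\<bar>A - b\<bar> \<le> e" by linarith
  note has_integral_semicircle_stieltjes[OF edge_halfwidth_pos g of_real_in_disc[OF this]]
  moreover have "c - 1 + \<bar>1 - p - q\<bar> = A - b" by (simp add: A_def b_def)
  ultimately show ?thesis unfolding arc_point_def by simp
qed

text \<open>Partial fractions \<open>1 / (x * (1 - x)) = 1 / x - 1 / (x - 1)\<close> reduce the mass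
  of the continuous part to the Stieltjes values at the two poles.\<close>

lemma has_integral_arc_density:
  "(arc_density has_integral (1 - q + p - \<bar>1 - p - q\<bar>) / (2 * p)) {0..pi}"
proof -
  let ?h = "\<lambda>\<zeta> \<theta>. complex_of_real ((e * sin \<theta>)\<^sup>2) / (of_real (arc_point \<theta>) - \<zeta>)"
  have eq: "complex_of_real (arc_density \<theta>) = of_real (1 / (2 * pi * p)) * (?h 0 \<theta> - ?h 1 \<theta>)" for \<theta>
  proof (cases "arc_point \<theta> = 0 \<or> arc_point \<theta> = 1")
    case True
    then show ?thesis using arc_point_degenerate[of \<theta>] by (simp add: arc_density_def)
  next
    case False
    then have nz: "arc_point \<theta> \<noteq> 0" "arc_point \<theta> - 1 \<noteq> 0" "1 - arc_point \<theta> \<noteq> 0" by auto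
    have "arc_density \<theta> = 1 / (2 * pi * p) * ((e * sin \<theta>)\<^sup>2 / arc_point \<theta> - (e * sin \<theta>)\<^sup>2 / (arc_point \<theta> - 1))"
      unfolding arc_density_def using nz p_pos by (simp add: divide_simps) (simp add: algebra_simps)
    then have "complex_of_real (arc_density \<theta>) = of_real (1 / (2 * pi * p) * ((e * sin \<theta>)\<^sup>2 / arc_point \<theta> - (e * sin \<theta>)\<^sup>2 / (arc_point \<theta> - 1)))"
      by simp
    then show ?thesis by simp
  qed
  have "((\<lambda>\<theta>. of_real (1 / (2 * pi * p)) * (?h 0 \<theta> - ?h 1 \<theta>)) has_integral
     of_real (1 / (2 * pi * p)) * (of_real pi * of_real (2 * p * (1 - q)) - of_real pi * of_real (c - 1 + \<bar>1 - p - q\<bar>))) {0..pi}"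
    by (intro has_integral_mult_right has_integral_diff root_at_0 root_at_1)
  also have "complex_of_real (1 / (2 * pi * p)) * (of_real pi * of_real (2 * p * (1 - q)) - of_real pi * of_real (c - 1 + \<bar>1 - p - q\<bar>))
     = of_real (1 / (2 * pi * p) * (pi * (2 * p * (1 - q)) - pi * (c - 1 + \<bar>1 - p - q\<bar>)))"
    by simp
  also have "1 / (2 * pi * p) * (pi * (2 * p * (1 - q)) - pi * (c - 1 + \<bar>1 - p - q\<bar>)) = (1 - q + p - \<bar>1 - p - q\<bar>) / (2 * p)"
    using p_pos by (simp add: c_def field_simps)
  finally have "((\<lambda>\<theta>. complex_of_real (arc_density \<theta>)) has_integral
      of_real ((1 - q + p - \<bar>1 - p - q\<bar>) / (2 * p))) {0..pi}"
    unfolding eq[symmetric] .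
  from has_integral_linear[OF this bounded_linear_Re] show ?thesis
    by (simp add: o_def del: of_real_divide)
qed

definition atom_mass :: real where
  "atom_mass = max 0 (((1 - \<rho>r)\<^sup>2 - \<rho>s) / (1 - \<rho>s))"

text \<open>\<open>max 0 x = (x + \<bar>x\<bar>) / 2\<close> exposes the absolute value that cancels
  the one from the pole at 1.\<close>

lemma atom_mass_eq: "atom_mass = (p + q - 1 + \<bar>1 - p - q\<bar>) / (2 * p)"
proof -
  have "atom_mass = max 0 ((p + q - 1) / p)" unfolding atom_mass_def using p_eq q_eq by simp
  then show ?thesis using p_pos by (auto simp: max_def abs_if field_simps)
qed

text \<open>The limit law is the image of a single density on the line: the arc $[0, \pi]$ carries the
  continuous part and the unit interval $[4, 5]$ is collapsed to the atom at 1.\<close>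

definition arc_map :: "real \<Rightarrow> real" where
  "arc_map \<theta> = (if \<theta> \<le> pi then arc_point \<theta> else 1)"

definition arc_weight :: "real \<Rightarrow> real" where
  "arc_weight \<theta> = arc_density \<theta> * indicator {0..pi} \<theta> + atom_mass * indicator {4..5} \<theta>"

lemma arc_measurable [measurable]:
  "arc_point \<in> borel_measurable borel" "arc_density \<in> borel_measurable borel"
  "arc_map \<in> borel_measurable borel" "arc_weight \<in> borel_measurable borel"
  unfolding arc_point_def[abs_def] arc_density_def[abs_def] arc_map_def[abs_def] arc_weight_def[abs_def]
  by measurable

lemma arc_weight_nonneg: "0 \<le> arc_weight \<theta>"
  using arc_density_nonneg by (simp add: arc_weight_def atom_mass_def)

text \<open>Substitution along the monotone arc \<open>c - e cos \<theta>\<close>, on which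
  \<open>(c + e - x) * (x - (c - e))\<close> is the square of
  \<open>e * sin \<theta>\<close>.\<close>

lemma limit_law_eq_distr: "limit_law \<rho>r \<rho>s = distr (density lborel (\<lambda>\<theta>. ennreal (arc_weight \<theta>))) borel arc_map"
proof (rule measure_eqI)
  fix A assume "A \<in> sets (limit_law \<rho>r \<rho>s)"
  then have A [measurable]: "A \<in> sets borel" by simp
  have "(\<integral>\<^sup>+x\<in>A. ennreal (limit_density \<rho>r \<rho>s x) \<partial>lborel)
     = (\<integral>\<^sup>+x. (ennreal (limit_density \<rho>r \<rho>s x) * indicator A x) * indicator {arc_point 0..arc_point pi} x \<partial>lborel)"
    by (intro nn_integral_cong) (auto simp: limit_density_def limit_edges arc_point_def indicator_def)
  also have "\<dots> = (\<integral>\<^sup>+\<theta>. (ennreal (limit_density \<rho>r \<rho>s (arc_point \<theta>)) * indicator A (arc_point \<theta>)) * ennreal (e * sin \<theta>) * indicator {0..pi} \<theta> \<partial>lborel)"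
  proof (rule nn_integral_substitution_aux)
    show "(\<lambda>x. ennreal (limit_density \<rho>r \<rho>s x) * indicator A x) \<in> borel_measurable borel"
      unfolding limit_density_def by measurable
    show "(arc_point has_real_derivative e * sin \<theta>) (at \<theta>)" for \<theta>
      unfolding arc_point_def[abs_def] by (auto intro!: derivative_eq_intros)
    show "continuous_on {0..pi} (\<lambda>\<theta>. e * sin \<theta>)" by (intro continuous_intros)
    show "0 \<le> e * sin \<theta>" if "\<theta> \<in> {0..pi}" for \<theta>
      using that edge_halfwidth_pos by (auto intro!: mult_nonneg_nonneg sin_ge_zero)
  qed auto
  also have "\<dots> = (\<integral>\<^sup>+\<theta>. ennreal (arc_density \<theta> * indicator {0..pi} \<theta>) * indicator A (arc_map \<theta>) \<partial>lborel)"
  proof (rule nn_integral_cong)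
    fix \<theta> :: real
    show "ennreal (limit_density \<rho>r \<rho>s (arc_point \<theta>)) * indicator A (arc_point \<theta>) * ennreal (e * sin \<theta>) * indicator {0..pi} \<theta>
        = ennreal (arc_density \<theta> * indicator {0..pi} \<theta>) * indicator A (arc_map \<theta>)"
    proof (cases "\<theta> \<in> {0..pi}")
      case True
      have s: "0 \<le> e * sin \<theta>" using True edge_halfwidth_pos by (auto intro!: mult_nonneg_nonneg sin_ge_zero)
      have cs: "- e \<le> e * cos \<theta>" "e * cos \<theta> \<le> e"
        using edge_halfwidth_pos mult_left_mono[of "cos \<theta>" 1 e] mult_left_mono[of "-1" "cos \<theta>" e] by auto
      have "(c + e - arc_point \<theta>) * (arc_point \<theta> - (c - e)) = e\<^sup>2 * (1 - (cos \<theta>)\<^sup>2)"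
        by (simp add: arc_point_def power2_eq_square algebra_simps)
      also have "\<dots> = (e * sin \<theta>)\<^sup>2" by (simp add: power_mult_distrib sin_squared_eq)
      finally have "(c + e - arc_point \<theta>) * (arc_point \<theta> - (c - e)) = (e * sin \<theta>)\<^sup>2" .
      then have "limit_density \<rho>r \<rho>s (arc_point \<theta>) = e * sin \<theta> / (2 * pi * p * arc_point \<theta> * (1 - arc_point \<theta>))"
        using s cs unfolding limit_density_def limit_edges p_eq[symmetric]
        by (simp add: indicator_def) (simp add: arc_point_def)
      then have "limit_density \<rho>r \<rho>s (arc_point \<theta>) * (e * sin \<theta>) = arc_density \<theta>"
        by (simp add: arc_density_def power2_eq_square)
      then have "ennreal (limit_density \<rho>r \<rho>s (arc_point \<theta>)) * ennreal (e * sin \<theta>) = ennreal (arc_density \<theta>)"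
        using s by (metis ennreal_mult'')
      moreover have "a * i * b = (a * b) * i" for a b i :: ennreal by (simp add: mult_ac)
      ultimately show ?thesis using True by (simp add: arc_map_def)
    qed simp
  qed
  finally have 1: "(\<integral>\<^sup>+x\<in>A. ennreal (limit_density \<rho>r \<rho>s x) \<partial>lborel)
      = (\<integral>\<^sup>+\<theta>. ennreal (arc_density \<theta> * indicator {0..pi} \<theta>) * indicator A (arc_map \<theta>) \<partial>lborel)" .
  have "(\<integral>\<^sup>+\<theta>. ennreal (atom_mass * indicator {4..5} \<theta>) * indicator A (arc_map \<theta>) \<partial>lborel)
     = (\<integral>\<^sup>+\<theta>. ennreal atom_mass * indicator A 1 * indicator {4..5::real} \<theta> \<partial>lborel)"
    \<comment> \<open>Since \<open>pi < 4\<close>, the interval that carries the atom is disjoint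
      from the arc.\<close>
    using pi_less_4 by (intro nn_integral_cong) (auto simp: arc_map_def indicator_def)
  also have "\<dots> = ennreal atom_mass * indicator A 1"
    by (subst nn_integral_cmult_indicator) auto
  finally have 2: "ennreal atom_mass * indicator A 1
      = (\<integral>\<^sup>+\<theta>. ennreal (atom_mass * indicator {4..5} \<theta>) * indicator A (arc_map \<theta>) \<partial>lborel)" ..
  have "emeasure (distr (density lborel (\<lambda>\<theta>. ennreal (arc_weight \<theta>))) borel arc_map) A
     = (\<integral>\<^sup>+\<theta>. ennreal (arc_weight \<theta>) * indicator A (arc_map \<theta>) \<partial>lborel)"
  proof -
    have "arc_map -` A \<in> sets borel" using measurable_sets[OF arc_measurable(3) A] by simp
    then show ?thesis
      by (simp add: emeasure_distr emeasure_density) (auto intro!: nn_integral_cong simp: indicator_def)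
  qed
  also have "\<dots> = (\<integral>\<^sup>+\<theta>. ennreal (arc_density \<theta> * indicator {0..pi} \<theta>) * indicator A (arc_map \<theta>)
       + ennreal (atom_mass * indicator {4..5} \<theta>) * indicator A (arc_map \<theta>) \<partial>lborel)"
  proof (rule nn_integral_cong)
    fix \<theta> :: real
    have "ennreal (arc_weight \<theta>) = ennreal (arc_density \<theta> * indicator {0..pi} \<theta>) + ennreal (atom_mass * indicator {4..5} \<theta>)"
      unfolding arc_weight_def using arc_density_nonneg by (intro ennreal_plus) (auto simp: atom_mass_def)
    then show "ennreal (arc_weight \<theta>) * indicator A (arc_map \<theta>) = ennreal (arc_density \<theta> * indicator {0..pi} \<theta>) * indicator A (arc_map \<theta>)
       + ennreal (atom_mass * indicator {4..5} \<theta>) * indicator A (arc_map \<theta>)"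
      by (simp add: distrib_right)
  qed
  also have "\<dots> = (\<integral>\<^sup>+x\<in>A. ennreal (limit_density \<rho>r \<rho>s x) \<partial>lborel) + ennreal atom_mass * indicator A 1"
    unfolding 1 2 by (rule nn_integral_add) measurable
  also have "\<dots> = emeasure (limit_law \<rho>r \<rho>s) A"
    unfolding emeasure_limit_law[OF A] atom_mass_def by (simp add: add.commute)
  finally show "emeasure (limit_law \<rho>r \<rho>s) A = emeasure (distr (density lborel (\<lambda>\<theta>. ennreal (arc_weight \<theta>))) borel arc_map) A" ..
qed simp

lemma has_integral_arc_weight: "(arc_weight has_integral 1) UNIV"
proof -
  have restr: "(\<lambda>\<theta>. f \<theta> * indicator S \<theta>) = (\<lambda>\<theta>. if \<theta> \<in> S then f \<theta> else 0)" for f :: "real \<Rightarrow> real" and S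
    by (auto simp: indicator_def fun_eq_iff)
  have "((\<lambda>\<theta>. arc_density \<theta> * indicator {0..pi} \<theta>) has_integral (1 - q + p - \<bar>1 - p - q\<bar>) / (2 * p)) UNIV"
    using has_integral_arc_density unfolding restr by (subst has_integral_restrict_UNIV)
  moreover have "((\<lambda>\<theta>. atom_mass * indicator {4..5::real} \<theta>) has_integral atom_mass) UNIV"
    using has_integral_const_real[of atom_mass 4 5] unfolding restr by (subst has_integral_restrict_UNIV) simp
  ultimately have "(arc_weight has_integral (1 - q + p - \<bar>1 - p - q\<bar>) / (2 * p) + atom_mass) UNIV"
    unfolding arc_weight_def[abs_def] by (rule has_integral_add)
  moreover have "(1 - q + p - \<bar>1 - p - q\<bar>) / (2 * p) + atom_mass = 1"
    unfolding atom_mass_eq using p_pos by (simp add: field_simps)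
  ultimately show ?thesis by simp
qed

lemma nn_integral_arc_weight: "(\<integral>\<^sup>+\<theta>. ennreal (arc_weight \<theta>) \<partial>lborel) = 1"
  using nn_integral_has_integral_lborel[OF _ arc_weight_nonneg has_integral_arc_weight] by simp

lemma real_distribution_limit_law: "real_distribution (limit_law \<rho>r \<rho>s)"
proof -
  have "emeasure (density lborel (\<lambda>\<theta>. ennreal (arc_weight \<theta>))) UNIV = 1"
    by (simp add: emeasure_density nn_integral_arc_weight)
  then have "prob_space (density lborel (\<lambda>\<theta>. ennreal (arc_weight \<theta>)))"
    by (intro prob_spaceI) simp
  then have "prob_space (limit_law \<rho>r \<rho>s)"
    unfolding limit_law_eq_distr by (rule prob_space.prob_space_distr) measurable
  then show ?thesis
    by (intro real_distribution.intro real_distribution_axioms.intro) auto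
qed

lemma AE_limit_law: "AE x in limit_law \<rho>r \<rho>s. 0 \<le> x \<and> x \<le> 1"
proof -
  have "0 \<le> arc_map \<theta> \<and> arc_map \<theta> \<le> 1" for \<theta>
    using arc_point_in_unit_interval[of \<theta>] by (simp add: arc_map_def)
  then show ?thesis
    unfolding limit_law_eq_distr by (subst AE_distr_iff) auto
qed

text \<open>Boundedness of \<open>F\<close> gives Lebesgue integrability, so the value can be
  computed as a gauge integral over the arc plus the atom.\<close>

lemma integral_limit_law:
  fixes F :: "real \<Rightarrow> complex"
  assumes [measurable]: "F \<in> borel_measurable borel" and bd: "\<And>x. cmod (F x) \<le> B"
    and I: "((\<lambda>\<theta>. of_real (arc_density \<theta>) * F (arc_point \<theta>)) has_integral I) {0..pi}"
  shows "(\<integral>x. F x \<partial>limit_law \<rho>r \<rho>s) = I + of_real atom_mass * F 1"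
proof -
  have "(\<integral>x. F x \<partial>limit_law \<rho>r \<rho>s) = (\<integral>\<theta>. arc_weight \<theta> *\<^sub>R F (arc_map \<theta>) \<partial>lborel)"
    unfolding limit_law_eq_distr using arc_weight_nonneg by (simp add: integral_distr integral_density)
  also have "\<dots> = I + of_real atom_mass * F 1"
  proof -
    have intw: "integrable lborel arc_weight"
      using arc_weight_nonneg nn_integral_arc_weight by (intro integrableI_nonneg) auto
    have int: "integrable lborel (\<lambda>\<theta>. arc_weight \<theta> *\<^sub>R F (arc_map \<theta>))"
    proof (rule Bochner_Integration.integrable_bound[of _ "\<lambda>\<theta>. B * arc_weight \<theta>"])
      show "integrable lborel (\<lambda>\<theta>. B * arc_weight \<theta>)" using intw by simp
      have "cmod (arc_weight \<theta> *\<^sub>R F (arc_map \<theta>)) \<le> norm (B * arc_weight \<theta>)" for \<theta>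
        using mult_right_mono[OF bd[of "arc_map \<theta>"] arc_weight_nonneg[of \<theta>]] arc_weight_nonneg[of \<theta>]
          order_trans[OF norm_ge_zero bd]
        by (simp add: abs_mult mult.commute)
      then show "AE \<theta> in lborel. cmod (arc_weight \<theta> *\<^sub>R F (arc_map \<theta>)) \<le> norm (B * arc_weight \<theta>)" by simp
    qed measurable
    have "((\<lambda>\<theta>. arc_weight \<theta> *\<^sub>R F (arc_map \<theta>)) has_integral I + of_real atom_mass * F 1) UNIV"
    proof -
      have "((\<lambda>\<theta>. if \<theta> \<in> {0..pi} then of_real (arc_density \<theta>) * F (arc_point \<theta>) else 0) has_integral I) UNIV"
        using I by (subst has_integral_restrict_UNIV)
      moreover have "((\<lambda>\<theta>::real. if \<theta> \<in> {4..5} then of_real atom_mass * F 1 else 0) has_integral of_real atom_mass * F 1) UNIV"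
        using has_integral_const_real[of "of_real atom_mass * F 1" 4 5] by (subst has_integral_restrict_UNIV) simp
      ultimately have "((\<lambda>\<theta>. (if \<theta> \<in> {0..pi} then of_real (arc_density \<theta>) * F (arc_point \<theta>) else 0)
          + (if \<theta> \<in> {4..5} then of_real atom_mass * F 1 else 0)) has_integral I + of_real atom_mass * F 1) UNIV"
        by (rule has_integral_add)
      moreover have "(if \<theta> \<in> {0..pi} then of_real (arc_density \<theta>) * F (arc_point \<theta>) else 0)
          + (if \<theta> \<in> {4..5} then of_real atom_mass * F 1 else 0) = arc_weight \<theta> *\<^sub>R F (arc_map \<theta>)" for \<theta>
        using pi_less_4 by (auto simp: arc_weight_def arc_map_def scaleR_conv_of_real)
      ultimately show ?thesis by simp
    qed
    then show ?thesis
      using has_integral_integral_lborel[OF int] has_integral_unique by blast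
  qed
  finally show ?thesis .
qed

text \<open>Partial fractions with poles 0, 1 and \<open>z\<close> leave three semicircle integrals.
  Only the equation for \<open>g\<close> is exported, not its place in the disc: the later bound on
  \<open>a + q\<close> takes over the choice of the root.\<close>

lemma stieltjes_limit_law:
  assumes z: "Im z \<noteq> 0"
  obtains g where "g\<^sup>2 - 2 * (of_real c - z) * g + (of_real e)\<^sup>2 = 0"
    "(\<integral>x. 1 / (of_real x - z) \<partial>limit_law \<rho>r \<rho>s)
       = - of_real (1 - q) / z + of_real q / (1 - z) + g / (2 * of_real p * z * (1 - z))"
proof -
  obtain g where g: "g\<^sup>2 - 2 * (of_real c - z) * g + (of_real e)\<^sup>2 = 0" "cmod g < e"
    using quadratic_root_in_disc[OF edge_halfwidth_pos, of "of_real c - z"] z by auto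
  have z0: "z \<noteq> 0" "1 - z \<noteq> 0" "of_real x - z \<noteq> 0" for x using z by (auto simp: complex_eq_iff)
  let ?F = "\<lambda>x. 1 / (complex_of_real x - z)"
  let ?h = "\<lambda>\<zeta> \<theta>. complex_of_real ((e * sin \<theta>)\<^sup>2) / (of_real (arc_point \<theta>) - \<zeta>)"
  let ?k = "complex_of_real (1 / (2 * pi * p))"
  have hz: "(?h z has_integral of_real pi * g) {0..pi}"
    unfolding arc_point_def using has_integral_semicircle_stieltjes[OF edge_halfwidth_pos g(1)] g(2) by blast
  have eq: "of_real (arc_density \<theta>) * ?F (arc_point \<theta>)
      = ?k * (- 1 / z * ?h 0 \<theta> - 1 / (1 - z) * ?h 1 \<theta> + 1 / (z * (1 - z)) * ?h z \<theta>)" for \<theta>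
  proof (cases "arc_point \<theta> = 0 \<or> arc_point \<theta> = 1")
    case True
    then show ?thesis using arc_point_degenerate[of \<theta>] by (simp add: arc_density_def)
  next
    case False
    define x where "x = complex_of_real (arc_point \<theta>)"
    define s where "s = complex_of_real ((e * sin \<theta>)\<^sup>2)"
    have nz: "x \<noteq> 0" "x - 1 \<noteq> 0" "1 - x \<noteq> 0" "x - z \<noteq> 0" using False z0 by (auto simp: x_def)
    \<comment> \<open>Naming the five reciprocals makes the decomposition linear: the products
      \<open>u * t\<close> and \<open>v * t\<close> are replaced by differences.\<close>
    have pf: "1 / (x * (1 - x)) * (1 / (x - z)) = - 1 / z * (1 / x) - 1 / (1 - z) * (1 / (x - 1)) + 1 / (z * (1 - z)) * (1 / (x - z))"
    proof -
      define u v t i j where "u = 1 / x" and "v = 1 / (x - 1)" and "t = 1 / (x - z)"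
        and "i = 1 / z" and "j = 1 / (1 - z)"
      have uv: "1 / (x * (1 - x)) = u - v" unfolding u_def v_def using nz by (simp add: field_simps)
      have ut: "u * t = i * (t - u)" unfolding u_def t_def i_def using nz z0(1) by (simp add: field_simps)
      have "v - t = (1 - z) * (v * t)" unfolding v_def t_def using nz by (simp add: field_simps)
      then have vt: "v * t = j * (v - t)" unfolding j_def using z0(2) by simp
      have ij: "1 / (z * (1 - z)) = i + j" unfolding i_def j_def using z0(1,2) by (simp add: field_simps)
      have "(u - v) * t = - i * u - j * v + (i + j) * t"
        unfolding left_diff_distrib ut vt by (simp add: algebra_simps)
      then show ?thesis unfolding uv ij unfolding u_def v_def t_def i_def j_def by simp
    qed
    have gen: "K * s * (A * u - B * v + C * t) = K * (A * (s * u) - B * (s * v) + C * (s * t))" for K A B C u v t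
      by (simp add: algebra_simps)
    have "of_real (arc_density \<theta>) * ?F (arc_point \<theta>) = ?k * s * (1 / (x * (1 - x)) * (1 / (x - z)))"
      unfolding arc_density_def by (simp add: x_def s_def)
    also have "\<dots> = ?k * (- 1 / z * (s * (1 / x)) - 1 / (1 - z) * (s * (1 / (x - 1))) + 1 / (z * (1 - z)) * (s * (1 / (x - z))))"
      unfolding pf by (rule gen)
    also have "\<dots> = ?k * (- 1 / z * (s / (x - 0)) - 1 / (1 - z) * (s / (x - 1)) + 1 / (z * (1 - z)) * (s / (x - z)))"
      by simp
    finally show ?thesis unfolding x_def s_def .
  qed
  have I: "((\<lambda>\<theta>. of_real (arc_density \<theta>) * ?F (arc_point \<theta>)) has_integral
      ?k * (- 1 / z * (of_real pi * of_real (2 * p * (1 - q))) - 1 / (1 - z) * (of_real pi * of_real (c - 1 + \<bar>1 - p - q\<bar>))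
         + 1 / (z * (1 - z)) * (of_real pi * g))) {0..pi}"
    unfolding eq by (intro has_integral_mult_right has_integral_diff has_integral_add root_at_0 root_at_1 hz)
  have bd: "cmod (?F x) \<le> 1 / \<bar>Im z\<bar>" for x
  proof -
    have "\<bar>Im z\<bar> \<le> cmod (of_real x - z)" using abs_Im_le_cmod[of "of_real x - z"] by simp
    then show ?thesis unfolding norm_divide using z by (simp add: frac_le)
  qed
  have "(\<integral>x. ?F x \<partial>limit_law \<rho>r \<rho>s) = ?k * (- 1 / z * (of_real pi * of_real (2 * p * (1 - q))) - 1 / (1 - z) * (of_real pi * of_real (c - 1 + \<bar>1 - p - q\<bar>))
         + 1 / (z * (1 - z)) * (of_real pi * g)) + of_real atom_mass * ?F 1"
    by (rule integral_limit_law[OF _ bd I]) measurable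
  also have "\<dots> = - of_real (1 - q) / z + of_real q / (1 - z) + g / (2 * of_real p * z * (1 - z))"
  proof -
    define P Q C A where "P = complex_of_real p" and "Q = complex_of_real q"
      and "C = complex_of_real c" and "A = complex_of_real \<bar>1 - p - q\<bar>"
    have C: "C = P + Q - 2 * P * Q" by (simp add: C_def P_def Q_def c_def)
    have nz: "P \<noteq> 0" "complex_of_real pi \<noteq> 0" using p_pos by (auto simp: P_def)
    have a: "of_real atom_mass = (P + Q - 1 + A) / (2 * P)"
      unfolding atom_mass_eq by (simp add: P_def Q_def A_def)
    have "1 / (2 * of_real pi * P) * (- 1 / z * (of_real pi * (2 * P * (1 - Q))) - 1 / (1 - z) * (of_real pi * (C - 1 + A))
         + 1 / (z * (1 - z)) * (of_real pi * g)) + (P + Q - 1 + A) / (2 * P) * (1 / (1 - z))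
       = - (1 - Q) / z + Q / (1 - z) + g / (2 * P * z * (1 - z))"
    proof -
      have cancel: "1 / (2 * of_real pi * P) * (- 1 / z * (of_real pi * X) - 1 / (1 - z) * (of_real pi * Y)
         + 1 / (z * (1 - z)) * (of_real pi * g)) = - (X / (2 * P)) / z - (Y / (2 * P)) / (1 - z) + g / (2 * P * z * (1 - z))" for X Y
      proof -
        have "K * (a * (of_real pi * X) - b * (of_real pi * Y) + d * (of_real pi * g))
            = (K * of_real pi) * (a * X - b * Y + d * g)" for K a b d
          by (simp add: algebra_simps)
        moreover have "1 / (2 * of_real pi * P) * of_real pi = 1 / (2 * P)" using nz by simp
        ultimately show ?thesis by (simp only:) (simp add: right_diff_distrib distrib_left)
      qed
      have X: "2 * P * (1 - Q) / (2 * P) = 1 - Q" using nz by simp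
      have Y: "(P + Q - 1 + A) / (2 * P) - (C - 1 + A) / (2 * P) = Q"
        unfolding C diff_divide_distrib[symmetric] using nz by (simp add: field_simps)
      have "(P + Q - 1 + A) / (2 * P) * (1 / (1 - z)) - ((C - 1 + A) / (2 * P)) / (1 - z) = Q / (1 - z)"
      proof -
        have "(P + Q - 1 + A) / (2 * P) * (1 / (1 - z)) - ((C - 1 + A) / (2 * P)) / (1 - z)
            = ((P + Q - 1 + A) / (2 * P) - (C - 1 + A) / (2 * P)) / (1 - z)"
          by (simp only: diff_divide_distrib times_divide_eq_right mult_1_right)
        then show ?thesis unfolding Y .
      qed
      moreover have "a - y + b + t = a + u + b" if "t - y = u" for a y b t u :: complex
        using that by (simp add: algebra_simps)
      ultimately show ?thesis unfolding cancel X by blast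
    qed
    then show ?thesis by (simp add: a P_def Q_def C_def A_def)
  qed
  finally show thesis using that g(1) by blast
qed

text \<open>\<open>a\<close> is the candidate limit of \<open>z t\<close>. Expressed through
  \<open>a\<close>, the quadratic for \<open>g\<close> becomes the self-consistency equation. The
  bound holds because \<open>a + q\<close> is \<open>p\<close> times the integral of
  \<open>x / (x - z)\<close> over a law on the unit interval.\<close>

lemma limit_law_self_consistent:
  assumes z: "Im z \<noteq> 0"
  defines "a \<equiv> of_real p * z * (\<integral>x. 1 / (of_real x - z) \<partial>limit_law \<rho>r \<rho>s) - of_real (q - p)"
  shows "(of_real q + a) * (1 - of_real q - a) + ((of_real q + a) * a - of_real p * a) / z = 0"
    and "cmod (a + of_real q) \<le> p / \<bar>Im z\<bar>"
proof -
  let ?s = "\<integral>x. 1 / (of_real x - z) \<partial>limit_law \<rho>r \<rho>s"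
  obtain g where g: "g\<^sup>2 - 2 * (of_real c - z) * g + (of_real e)\<^sup>2 = 0"
    and s: "?s = - of_real (1 - q) / z + of_real q / (1 - z) + g / (2 * of_real p * z * (1 - z))"
    by (rule stieltjes_limit_law[OF z])
  have z0: "z \<noteq> 0" "1 - z \<noteq> 0" "of_real x - z \<noteq> 0" for x using z by (auto simp: complex_eq_iff)
  define P Q E where "P = complex_of_real p" and "Q = complex_of_real q" and "E = (complex_of_real e)\<^sup>2"
  have P0: "P \<noteq> 0" using p_pos by (simp add: P_def)
  have C: "of_real c = P + Q - 2 * P * Q" by (simp add: P_def Q_def c_def)
  have E: "E = 4 * (Q * (1 - P) * (P * (1 - Q)))"
  proof -
    have "complex_of_real (e\<^sup>2) = of_real (4 * (q * (1 - p) * (p * (1 - q))))"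
      by (simp only: edge_halfwidth_sq)
    then show ?thesis by (simp add: E_def P_def Q_def)
  qed
  have a: "a = P * z * (- (1 - Q) / z + Q / (1 - z) + g / (2 * P * z * (1 - z))) - (Q - P)"
    unfolding a_def s by (simp add: P_def Q_def)
  have "2 * (1 - z) * a = - 2 * P * (1 - Q) * (1 - z) + 2 * P * Q * z + g - 2 * (Q - P) * (1 - z)"
  proof -
    have "a = - P * (1 - Q) + P * z * Q / (1 - z) + g / (2 * (1 - z)) - (Q - P)"
      proof -
      have "P * z * (- (1 - Q) / z) = - P * (1 - Q)" using z0(1) by (simp add: field_simps)
      moreover have "P * z * (g / (2 * P * z * (1 - z))) = g / (2 * (1 - z))" using P0 z0(1) by simp
      moreover have "P * z * (Q / (1 - z)) = P * z * Q / (1 - z)" by simp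
      ultimately show ?thesis unfolding a distrib_left by (simp only:)
    qed
    moreover have "2 * W * (X / W) = 2 * X" "2 * W * (X / (2 * W)) = X" if "W \<noteq> 0" for W X :: complex
      using that by auto
    note this[OF z0(2)]
    ultimately show ?thesis
      by (simp only: distrib_left right_diff_distrib[of "2 * (1 - z)"]) (simp add: algebra_simps)
  qed
  \<comment> \<open>Solving the previous line for \<open>g\<close>; with \<open>A = a + Q\<close>,
    its quadratic then carries a factor \<open>4 * (1 - z)\<close> that can be cancelled.\<close>
  then have gA: "g = 2 * ((1 - z) * (a + Q) - P * Q)" by (simp add: algebra_simps)
  have "(2 * ((1 - z) * A - P * Q))\<^sup>2 - 2 * (P + Q - 2 * P * Q - z) * (2 * ((1 - z) * A - P * Q)) + 4 * (Q * (1 - P) * (P * (1 - Q)))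
      = 4 * (1 - z) * ((1 - z) * A\<^sup>2 - A * (P + Q - z) + P * Q)" for A
    by (simp add: algebra_simps power2_eq_square)
  note this[of "a + Q", folded gA]
  then have "4 * (1 - z) * ((1 - z) * (a + Q)\<^sup>2 - (a + Q) * (P + Q - z) + P * Q) = 0"
    using g unfolding C E_def[symmetric] E by simp
  then have "(1 - z) * (a + Q)\<^sup>2 - (a + Q) * (P + Q - z) + P * Q = 0" using z0(2) by simp
  then have "z * ((Q + a) * (1 - Q - a)) + ((Q + a) * a - P * a) = 0"
    by (simp add: algebra_simps power2_eq_square)
  then have "(z * ((Q + a) * (1 - Q - a)) + ((Q + a) * a - P * a)) / z = 0" by simp
  then show "(of_real q + a) * (1 - of_real q - a) + ((of_real q + a) * a - of_real p * a) / z = 0"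
    using z0(1) by (simp add: add_divide_distrib P_def Q_def)
  interpret L: real_distribution "limit_law \<rho>r \<rho>s" by (rule real_distribution_limit_law)
  have bd: "cmod (1 / (of_real x - z)) \<le> 1 / \<bar>Im z\<bar>" for x
  proof -
    have "\<bar>Im z\<bar> \<le> cmod (of_real x - z)" using abs_Im_le_cmod[of "of_real x - z"] by simp
    then show ?thesis unfolding norm_divide using z by (simp add: frac_le)
  qed
  have int: "integrable (limit_law \<rho>r \<rho>s) (\<lambda>x. 1 / (complex_of_real x - z))"
    by (rule L.integrable_const_bound[of _ "1 / \<bar>Im z\<bar>"]) (use bd in auto)
  have "a + Q = P * (1 + z * ?s)" by (simp add: a_def P_def Q_def algebra_simps)
  also have "1 + z * ?s = (\<integral>x. 1 + z * (1 / (complex_of_real x - z)) \<partial>limit_law \<rho>r \<rho>s)"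
  proof -
    have "(\<integral>x. 1 + z * (1 / (complex_of_real x - z)) \<partial>limit_law \<rho>r \<rho>s)
        = (\<integral>x. 1 \<partial>limit_law \<rho>r \<rho>s) + (\<integral>x. z * (1 / (complex_of_real x - z)) \<partial>limit_law \<rho>r \<rho>s)"
      by (rule Bochner_Integration.integral_add[OF _ integrable_mult_right[OF int]]) simp
    moreover have "(\<integral>x. z * (1 / (complex_of_real x - z)) \<partial>limit_law \<rho>r \<rho>s) = z * ?s"
      by (rule integral_mult_right_zero)
    moreover have "(\<integral>x. 1 \<partial>limit_law \<rho>r \<rho>s) = (1 :: complex)" using L.prob_space by simp
    ultimately show ?thesis by (simp only:)
  qed
  also have "cmod (P * \<dots>) \<le> p * (1 / \<bar>Im z\<bar>)"
  proof -
    have "cmod (\<integral>x. 1 + z * (1 / (complex_of_real x - z)) \<partial>limit_law \<rho>r \<rho>s)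
        \<le> (\<integral>x. cmod (1 + z * (1 / (complex_of_real x - z))) \<partial>limit_law \<rho>r \<rho>s)"
      by (rule integral_norm_bound)
    also have "\<dots> \<le> (\<integral>x. 1 / \<bar>Im z\<bar> \<partial>limit_law \<rho>r \<rho>s)"
    proof (rule integral_mono_AE)
      show "integrable (limit_law \<rho>r \<rho>s) (\<lambda>x. cmod (1 + z * (1 / (complex_of_real x - z))))"
        by (intro integrable_norm Bochner_Integration.integrable_add integrable_mult_right int) simp
      show "AE x in limit_law \<rho>r \<rho>s. cmod (1 + z * (1 / (complex_of_real x - z))) \<le> 1 / \<bar>Im z\<bar>"
        using AE_limit_law
      proof eventually_elim
        case (elim x)
        have "1 + z * (1 / (complex_of_real x - z)) = of_real x * (1 / (of_real x - z))"
          using z0(3)[of x] by (simp add: field_simps)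
        also have "cmod \<dots> \<le> 1 * (1 / \<bar>Im z\<bar>)"
          unfolding norm_mult using elim bd[of x] by (intro mult_mono) auto
        finally show ?case by simp
      qed
    qed simp
    also have "\<dots> = 1 / \<bar>Im z\<bar>" using L.prob_space by simp
    finally show ?thesis unfolding norm_mult by (intro mult_mono) (use p_pos in \<open>auto simp: P_def\<close>)
  qed
  finally show "cmod (a + of_real q) \<le> p / \<bar>Im z\<bar>" by (simp add: Q_def)
qed

end

section \<open>From Stieltjes transforms to weak convergence\<close>

lemma integrable_unit_interval:
  fixes f :: "real \<Rightarrow> 'b::{banach, second_countable_topology}"
  assumes M: "real_distribution M" and AE: "AE x in M. 0 \<le> x \<and> x \<le> 1"
    and [measurable]: "f \<in> borel_measurable borel" and bd: "\<And>x. 0 \<le> x \<Longrightarrow> x \<le> 1 \<Longrightarrow> norm (f x) \<le> B"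
  shows "integrable M f" "norm (\<integral>x. f x \<partial>M) \<le> B"
proof -
  interpret real_distribution M by fact
  have le: "AE x in M. norm (f x) \<le> B" using AE by eventually_elim (use bd in auto)
  have f: "f \<in> borel_measurable M" by simp
  show int: "integrable M f" by (rule integrable_const_bound[OF le f])
  have "norm (\<integral>x. f x \<partial>M) \<le> (\<integral>x. norm (f x) \<partial>M)" by (rule integral_norm_bound)
  also have "\<dots> \<le> (\<integral>x. B \<partial>M)" using le int by (intro integral_mono_AE) auto
  finally show "norm (\<integral>x. f x \<partial>M) \<le> B" using prob_space by simp
qed

context
  fixes M :: "real measure" and y :: real
  assumes M: "real_distribution M" and AE: "AE x in M. 0 \<le> x \<and> x \<le> 1" and y: "0 < y"
begin

lemma norm_stieltjes_kernel: "cmod (1 / (of_real x - \<i> * of_real y)) \<le> 1 / y"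
proof -
  have "y \<le> cmod (of_real x - \<i> * of_real y)"
    using abs_Im_le_cmod[of "of_real x - \<i> * of_real y"] by simp
  then show ?thesis using y by (simp add: norm_divide frac_le)
qed

text \<open>Finite geometric expansion of \<open>1 / (x - z)\<close> in powers of
  \<open>1 / z\<close>, multiplied by \<open>z ^ Suc j\<close>. The remainder
  \<open>x ^ Suc j / (x - z)\<close> is at most \<open>1 / y\<close> on the unit interval.\<close>

lemma moment_from_stieltjes:
  "cmod (of_real (\<integral>x. x ^ j \<partial>M) + (\<i> * of_real y) ^ Suc j * (\<integral>x. 1 / (of_real x - \<i> * of_real y) \<partial>M)
      + (\<Sum>i<j. (\<i> * of_real y) ^ (j - i) * of_real (\<integral>x. x ^ i \<partial>M))) \<le> 1 / y"
proof -
  define z where "z = \<i> * complex_of_real y"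
  interpret real_distribution M by (rule M)
  have xz: "complex_of_real x - z \<noteq> 0" for x using y by (auto simp: z_def complex_eq_iff)
  have intp: "integrable M (\<lambda>x. complex_of_real (x ^ i))" for i
    by (rule integrable_unit_interval[OF M AE, of _ 1]) (auto simp: norm_power power_le_one simp flip: of_real_power)
  have ints: "integrable M (\<lambda>x. 1 / (complex_of_real x - z))"
    by (rule integrable_unit_interval[OF M AE]) (use norm_stieltjes_kernel in \<open>auto simp: z_def\<close>)
  have id: "of_real (x ^ j) + z ^ Suc j * (1 / (of_real x - z)) + (\<Sum>i<j. z ^ (j - i) * of_real (x ^ i))
      = of_real (x ^ Suc j) * (1 / (of_real x - z))" for x
  proof (induction j)
    case 0
    then show ?case using xz[of x] by (simp add: field_simps)
  next
    case (Suc j)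
    have "(\<Sum>i<Suc j. z ^ (Suc j - i) * of_real (x ^ i)) = z * ((\<Sum>i<j. z ^ (j - i) * of_real (x ^ i)) + of_real (x ^ j))"
      by (simp add: sum_distrib_left distrib_left Suc_diff_le mult.assoc)
    then have "of_real (x ^ Suc j) + z ^ Suc (Suc j) * (1 / (of_real x - z)) + (\<Sum>i<Suc j. z ^ (Suc j - i) * of_real (x ^ i))
        = of_real (x ^ Suc j) + z * (of_real (x ^ j) + z ^ Suc j * (1 / (of_real x - z)) + (\<Sum>i<j. z ^ (j - i) * of_real (x ^ i)))"
      by (simp add: algebra_simps)
    also have "\<dots> = of_real (x ^ Suc j) + z * (of_real (x ^ Suc j) * (1 / (of_real x - z)))"
      unfolding Suc.IH ..
    also have "\<dots> = of_real (x ^ Suc (Suc j)) * (1 / (of_real x - z))"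
      using xz[of x] by (simp add: field_simps)
    finally show ?case .
  qed
  have "of_real (\<integral>x. x ^ j \<partial>M) + z ^ Suc j * (\<integral>x. 1 / (of_real x - z) \<partial>M)
      + (\<Sum>i<j. z ^ (j - i) * of_real (\<integral>x. x ^ i \<partial>M))
    = (\<integral>x. of_real (x ^ j) + z ^ Suc j * (1 / (of_real x - z)) + (\<Sum>i<j. z ^ (j - i) * of_real (x ^ i)) \<partial>M)"
  proof -
    have int1: "integrable M (\<lambda>x. z ^ Suc j * (1 / (complex_of_real x - z)))"
      by (rule integrable_mult_right[OF ints])
    have int2: "integrable M (\<lambda>x. \<Sum>i<j. z ^ (j - i) * complex_of_real (x ^ i))"
      by (intro Bochner_Integration.integrable_sum integrable_mult_right intp)
    show ?thesis
      unfolding Bochner_Integration.integral_add[OF Bochner_Integration.integrable_add[OF intp int1] int2]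
        Bochner_Integration.integral_add[OF intp int1] integral_mult_right_zero
        Bochner_Integration.integral_sum[OF integrable_mult_right[OF intp]] integral_complex_of_real ..
  qed
  also have "\<dots> = (\<integral>x. of_real (x ^ Suc j) * (1 / (of_real x - z)) \<partial>M)"
    unfolding id ..
  also have "cmod \<dots> \<le> 1 / y"
  proof (rule integrable_unit_interval[OF M AE])
    fix x :: real assume x: "0 \<le> x" "x \<le> 1"
    have "cmod (of_real (x ^ Suc j) * (1 / (of_real x - z))) \<le> 1 * (1 / y)"
      unfolding norm_mult using norm_stieltjes_kernel[of x] x
      by (intro mult_mono) (auto simp: z_def power_le_one abs_mult mult_le_one simp del: of_real_power of_real_mult)
    then show "cmod (of_real (x ^ Suc j) * (1 / (of_real x - z))) \<le> 1 / y" by simp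
  qed measurable
  finally show ?thesis by (simp add: z_def)
qed

end

text \<open>The lower moments enter with factors \<open>z ^ (j - i)\<close> that grow with the
  height. So the height is fixed before \<open>n\<close> grows, and strong induction supplies the
  lower moments. A sequence of heights is enough, which keeps the almost sure statements
  countable.\<close>

lemma moments_from_stieltjes:
  assumes M: "\<And>n. real_distribution (M n)" "\<And>n. AE x in M n. 0 \<le> x \<and> x \<le> 1"
    and L: "real_distribution L" "AE x in L. 0 \<le> x \<and> x \<le> 1"
    and y: "\<And>l::nat. 0 < y l" "filterlim y at_top sequentially"
    and conv: "\<And>l. (\<lambda>n. \<integral>x. 1 / (of_real x - \<i> * of_real (y l)) \<partial>M n)
                     \<longlonglongrightarrow> (\<integral>x. 1 / (of_real x - \<i> * of_real (y l)) \<partial>L)"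
  shows "(\<lambda>n. \<integral>x. x ^ j \<partial>M n) \<longlonglongrightarrow> (\<integral>x. x ^ j \<partial>L)"
proof (induction j rule: less_induct)
  case (less j)
  define f where "f N l = (\<i> * complex_of_real (y l)) ^ Suc j * (\<integral>x. 1 / (of_real x - \<i> * of_real (y l)) \<partial>N)
      + (\<Sum>i<j. (\<i> * of_real (y l)) ^ (j - i) * of_real (\<integral>x. x ^ i \<partial>N))" for N l
  have f: "(\<lambda>n. f (M n) l) \<longlonglongrightarrow> f L l" for l
    unfolding f_def using less by (intro tendsto_intros conv) auto
  show ?case
  proof (rule LIMSEQ_I)
    fix \<epsilon> :: real assume \<epsilon>: "0 < \<epsilon>"
    \<comment> \<open>Above \<open>4 / \<epsilon>\<close> the two expansion errors
      \<open>1 / y\<close> together stay below \<open>\<epsilon> / 2\<close>.\<close>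
    have "eventually (\<lambda>l. 4 / \<epsilon> < y l) sequentially"
      using y(2) by (simp add: filterlim_at_top_dense)
    then obtain l where "4 / \<epsilon> < y l" by (auto simp: eventually_sequentially)
    then have yl: "2 / y l < \<epsilon> / 2" using \<epsilon> y(1)[of l] by (simp add: field_simps)
    obtain n0 where n0: "\<And>n. n0 \<le> n \<Longrightarrow> cmod (f (M n) l - f L l) < \<epsilon> / 2"
      using LIMSEQ_D[OF f, of "\<epsilon> / 2" l] \<epsilon> by auto
    have "norm ((\<integral>x. x ^ j \<partial>M n) - (\<integral>x. x ^ j \<partial>L)) < \<epsilon>" if n: "n0 \<le> n" for n
    proof -
      let ?a = "\<integral>x. x ^ j \<partial>M n" and ?b = "\<integral>x. x ^ j \<partial>L"
      have 1: "cmod (of_real ?a + f (M n) l) \<le> 1 / y l" "cmod (of_real ?b + f L l) \<le> 1 / y l"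
        using moment_from_stieltjes[OF M(1,2) y(1), of n j l] moment_from_stieltjes[OF L y(1), of j l]
        by (simp_all add: f_def add.assoc)
      have "\<bar>?a - ?b\<bar> = cmod (of_real (?a - ?b))" by (simp only: norm_of_real)
      also have "\<dots> = cmod ((of_real ?a + f (M n) l) - (of_real ?b + f L l) - (f (M n) l - f L l))"
        by (simp add: algebra_simps)
      also have "\<dots> \<le> cmod (of_real ?a + f (M n) l) + cmod (of_real ?b + f L l) + cmod (f (M n) l - f L l)"
        by (meson add_mono norm_triangle_ineq4 order_trans order_refl)
      also have "\<dots> < \<epsilon>" using 1 n0[OF n] yl by (simp add: field_simps)
      finally show ?thesis by simp
    qed
    then show "\<exists>no. \<forall>n\<ge>no. norm ((\<integral>x. x ^ j \<partial>M n) - (\<integral>x. x ^ j \<partial>L)) < \<epsilon>" by blast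
  qed
qed

text \<open>Levy continuity. On the unit interval the Taylor error of the characteristic function is
  bounded uniformly over all laws, so convergence of moments passes to characteristic
  functions.\<close>

lemma weak_conv_from_moments:
  assumes M: "\<And>n. real_distribution (M n)" "\<And>n. AE x in M n. 0 \<le> x \<and> x \<le> 1"
    and L: "real_distribution L" "AE x in L. 0 \<le> x \<and> x \<le> 1"
    and conv: "\<And>j. (\<lambda>n. \<integral>x. x ^ j \<partial>M n) \<longlonglongrightarrow> (\<integral>x. x ^ j \<partial>L)"
  shows "weak_conv_m M L"
proof (rule levy_continuity[OF M(1) L(1)])
  fix t :: real
  define f where "f N j = (\<Sum>k\<le>j. ((\<i> * complex_of_real t) ^ k / fact k) * of_real (\<integral>x. x ^ k \<partial>N))" for N :: "real measure" and j
  have f: "(\<lambda>n. f (M n) j) \<longlonglongrightarrow> f L j" for j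
    unfolding f_def by (intro tendsto_intros conv)
  have approx: "cmod (char N t - f N j) \<le> 2 * (\<bar>t\<bar> ^ j / fact j)"
    if N: "real_distribution N" "AE x in N. 0 \<le> x \<and> x \<le> 1" for N j
  proof -
    have "cmod (char N t - f N j) \<le> (2 * \<bar>t\<bar> ^ j / fact j) * (\<integral>x. \<bar>x\<bar> ^ j \<partial>N)"
      unfolding f_def
    proof (rule real_distribution.char_approx1[OF N(1)])
      show "integrable N (\<lambda>x. x ^ k)" for k
        by (rule integrable_unit_interval[OF N, of _ 1]) (auto simp: power_le_one)
    qed
    also have "\<dots> \<le> (2 * \<bar>t\<bar> ^ j / fact j) * 1"
    proof (rule mult_left_mono)
      have "norm (\<integral>x. \<bar>x\<bar> ^ j \<partial>N) \<le> 1"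
        by (rule integrable_unit_interval[OF N]) (auto simp: power_le_one)
      then show "(\<integral>x. \<bar>x\<bar> ^ j \<partial>N) \<le> 1" by simp
    qed simp
    finally show ?thesis by simp
  qed
  show "(\<lambda>n. char (M n) t) \<longlonglongrightarrow> char L t"
  proof (rule LIMSEQ_I)
    fix \<epsilon> :: real assume \<epsilon>: "0 < \<epsilon>"
    have "(\<lambda>j. \<bar>t\<bar> ^ j / fact j) \<longlonglongrightarrow> 0"
      using summable_LIMSEQ_zero[OF summable_exp[of "\<bar>t\<bar>"]] by (simp add: divide_inverse mult.commute)
    \<comment> \<open>Each of the two Taylor errors is at most twice this, so together they stay
      below \<open>\<epsilon> / 2\<close>.\<close>
    then obtain j where j: "\<bar>t\<bar> ^ j / fact j < \<epsilon> / 8"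
      using LIMSEQ_D[of "\<lambda>j. \<bar>t\<bar> ^ j / fact j" 0 "\<epsilon> / 8"] \<epsilon> by auto
    obtain n0 where n0: "\<And>n. n0 \<le> n \<Longrightarrow> cmod (f (M n) j - f L j) < \<epsilon> / 2"
      using LIMSEQ_D[OF f, of "\<epsilon> / 2" j] \<epsilon> by auto
    have "cmod (char (M n) t - char L t) < \<epsilon>" if n: "n0 \<le> n" for n
    proof -
      have "char (M n) t - char L t = (char (M n) t - f (M n) j) - (char L t - f L j) + (f (M n) j - f L j)"
        by simp
      also have "cmod \<dots> \<le> cmod (char (M n) t - f (M n) j) + cmod (char L t - f L j) + cmod (f (M n) j - f L j)"
        by (meson add_mono norm_triangle_ineq norm_triangle_ineq4 order_trans order_refl)
      also have "\<dots> < \<epsilon>"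
        using approx[OF M(1,2), of n j] approx[OF L, of j] j n0[OF n] by linarith
      finally show ?thesis .
    qed
    then show "\<exists>no. \<forall>n\<ge>no. cmod (char (M n) t - char L t) < \<epsilon>" by blast
  qed
qed

section \<open>The self-consistency equation\<close>

definition normalized_trace :: "real mat \<Rightarrow> complex \<Rightarrow> nat set \<Rightarrow> complex" where
  "normalized_trace W z S = mat_trace (gres W z S) / of_nat (dim_row W)"

context
  fixes W :: "real mat" and z :: complex and n N :: nat
  assumes so: "semi_orthogonal W" and z: "2 \<le> \<bar>Im z\<bar>" and n: "dim_row W = n" and N: "1 \<le> N" "N < n"
begin

text \<open>This is what \<open>2 \<le> \<bar>Im z\<bar>\<close> is for: forms bounded by 1/2 keep
  every Sherman-Morrison denominator at least 1/2.\<close>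

lemma cmod_resolvent_form_le_half:
  assumes "j < n"
  shows "cmod (resolvent_form W z S j) \<le> 1 / 2" "1 / 2 \<le> cmod (1 + resolvent_form W z S j)"
proof -
  have "cmod (resolvent_form W z S j) \<le> 1 / \<bar>Im z\<bar>"
    using cmod_resolvent_form_le[OF so] assms n z by auto
  also have "\<dots> \<le> 1 / 2" using z by (simp add: field_simps)
  finally show *: "cmod (resolvent_form W z S j) \<le> 1 / 2" .
  then show "1 / 2 \<le> cmod (1 + resolvent_form W z S j)"
    using norm_diff_ineq[of 1 "resolvent_form W z S j"] by simp
qed

lemma one_plus_resolvent_form_nonzero: "j < n \<Longrightarrow> 1 + resolvent_form W z S j \<noteq> 0"
  using cmod_resolvent_form_le_half(2)[of j S] by auto

lemma normalized_trace_insert: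
  assumes "j \<notin> S" "finite S" "j < n"
  shows "cmod (normalized_trace W z S - normalized_trace W z (insert j S)) \<le> 1 / real n"
proof -
  have n0: "0 < real n" using N by simp
  have "cmod (mat_trace (gres W z S) - mat_trace (gres W z (insert j S))) \<le> 1 / \<bar>Im z\<bar>\<^sup>2"
    using trace_gres_insert[OF so assms(1,2)] z n assms(3) by auto
  also have "\<dots> \<le> 1"
    using z power_mono[of 2 "\<bar>Im z\<bar>" 2] by (simp add: divide_le_eq)
  finally have "cmod (mat_trace (gres W z S) - mat_trace (gres W z (insert j S))) / real n \<le> 1 / real n"
    using n0 by (intro divide_right_mono) auto
  then show ?thesis
    by (simp add: normalized_trace_def n norm_divide flip: diff_divide_distrib)
qed

lemma normalized_trace_swap:
  assumes "S \<subseteq> {..<n}" "i \<in> {..<n} - S" "j \<in> {..<n} - S"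
  shows "cmod (normalized_trace W z (insert i S) - normalized_trace W z (insert j S)) \<le> 2 / real n"
proof -
  have "finite S" using assms(1) finite_subset by blast
  then have "cmod (normalized_trace W z S - normalized_trace W z (insert i S)) \<le> 1 / real n"
    "cmod (normalized_trace W z S - normalized_trace W z (insert j S)) \<le> 1 / real n"
    using assms by (auto intro!: normalized_trace_insert)
  then have "cmod ((normalized_trace W z S - normalized_trace W z (insert j S))
      - (normalized_trace W z S - normalized_trace W z (insert i S))) \<le> 1 / real n + 1 / real n"
    using norm_triangle_ineq4[of "normalized_trace W z S - normalized_trace W z (insert j S)"
        "normalized_trace W z S - normalized_trace W z (insert i S)"] by linarith
  then show ?thesis by simp
qed

abbreviation mean_trace :: complex where
  "mean_trace \<equiv> avg (subsets_of_card {..<n} N) (normalized_trace W z)"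

text \<open>Exchanging one row moves the normalized trace by at most \<open>2 / n\<close>, and
  \<open>N \<le> n\<close> draws give variance at most \<open>4 / n\<close>. The order
  \<open>1 / n\<close> is the rate that is later summed.\<close>

lemma chebyshev_normalized_trace:
  assumes "0 < \<epsilon>"
  shows "measure_pmf.prob (random_subset {..<n} N) {P. \<epsilon> < cmod (normalized_trace W z P - mean_trace)}
    \<le> 4 / \<epsilon>\<^sup>2 * (1 / real n)"
proof -
  have "measure_pmf.prob (random_subset {..<n} N) {P. \<epsilon> < cmod (normalized_trace W z P - mean_trace)}
      \<le> real N * (2 / real n)\<^sup>2 / \<epsilon>\<^sup>2"
    by (rule chebyshev_random_subset) (use N assms in \<open>auto intro!: normalized_trace_swap\<close>)
  also have "\<dots> \<le> real n * (2 / real n)\<^sup>2 / \<epsilon>\<^sup>2"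
    using N by (intro divide_right_mono mult_right_mono) auto
  also have "\<dots> = 4 / \<epsilon>\<^sup>2 * (1 / real n)"
    using N by (simp add: power2_eq_square)
  finally show ?thesis .
qed

lemma avg_dist_mean_trace_le:
  "avg (subsets_of_card {..<n} N) (\<lambda>P. cmod (normalized_trace W z P - mean_trace)) \<le> 2 / sqrt (real n)"
proof -
  let ?A = "subsets_of_card {..<n} N"
  have A: "finite ?A" "?A \<noteq> {}"
    using N by (auto intro: finite_subsets_of_card simp: subsets_of_card_nonempty)
  have "avg ?A (\<lambda>P. cmod (normalized_trace W z P - mean_trace))
      \<le> sqrt (avg ?A (\<lambda>P. (cmod (normalized_trace W z P - mean_trace))\<^sup>2))"
    by (rule avg_norm_le_sqrt[OF A])
  also have "avg ?A (\<lambda>P. (cmod (normalized_trace W z P - mean_trace))\<^sup>2) \<le> real N * (2 / real n)\<^sup>2"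
    by (rule variance_subsets_le) (use N in \<open>auto intro!: normalized_trace_swap\<close>)
  also have "\<dots> \<le> real n * (2 / real n)\<^sup>2"
    using N by (intro mult_right_mono) auto
  also have "\<dots> = (2 / sqrt (real n))\<^sup>2"
    using N by (simp add: power2_eq_square)
  finally show ?thesis using N by simp
qed

text \<open>The sum of \<open>w_j^T R_P w_j\<close> over \<open>P\<close> is
  \<open>qn + z tr R_P\<close>; each term is rewritten with row \<open>j\<close> removed from the
  resolvent, the form that concentration speaks about.\<close>

lemma normalized_trace_as_sum:
  assumes P: "P \<subseteq> {..<n}"
  shows "of_nat (dim_col W) / of_nat n + z * normalized_trace W z P
     = (\<Sum>j\<in>P. resolvent_form W z (P - {j}) j / (1 + resolvent_form W z (P - {j}) j)) / of_nat n"
proof -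
  have fin: "finite P" using P finite_subset by blast
  have "resolvent_form W z P j = resolvent_form W z (P - {j}) j / (1 + resolvent_form W z (P - {j}) j)" if j: "j \<in> P" for j
  proof -
    have "j < n" using j P by auto
    then show ?thesis
      using resolvent_form_insert[of j "P - {j}" z W] j fin z n one_plus_resolvent_form_nonzero[of j "P - {j}"]
      by (auto simp: insert_absorb)
  qed
  then have "(\<Sum>j\<in>P. resolvent_form W z (P - {j}) j / (1 + resolvent_form W z (P - {j}) j))
      = of_nat (dim_col W) + z * mat_trace (gres W z P)"
    using sum_resolvent_forms[of P W z] P n z by auto
  then show ?thesis by (simp add: normalized_trace_def n add_divide_distrib)
qed

lemma mean_trace_as_avg:
  "of_nat (dim_col W) / of_nat n + z * mean_trace
     = of_nat N / of_nat n * avg (selections n N)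
         (\<lambda>(P, j). resolvent_form W z (P - {j}) j / (1 + resolvent_form W z (P - {j}) j))"
proof -
  let ?A = "subsets_of_card {..<n} N"
  let ?x = "\<lambda>P j. resolvent_form W z (P - {j}) j / (1 + resolvent_form W z (P - {j}) j)"
  have A: "finite ?A" "?A \<noteq> {}"
    using N by (auto intro: finite_subsets_of_card simp: subsets_of_card_nonempty)
  have "of_nat (dim_col W) / of_nat n + z * mean_trace
      = avg ?A (\<lambda>P. of_nat (dim_col W) / of_nat n + z * normalized_trace W z P)"
    by (simp only: avg_add avg_mult_left avg_const[OF A])
  also have "\<dots> = avg ?A (\<lambda>P. of_nat N / of_nat n * ((\<Sum>j\<in>P. ?x P j) /\<^sub>R real N))"
  proof (rule avg_cong)
    fix P assume "P \<in> ?A"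
    then have "of_nat (dim_col W) / of_nat n + z * normalized_trace W z P = (\<Sum>j\<in>P. ?x P j) / of_nat n"
      by (intro normalized_trace_as_sum) (auto simp: subsets_of_card_def)
    also have "\<dots> = of_nat N / of_nat n * ((\<Sum>j\<in>P. ?x P j) /\<^sub>R real N)"
      using N by (simp add: scaleR_conv_of_real)
    finally show "of_nat (dim_col W) / of_nat n + z * normalized_trace W z P
        = of_nat N / of_nat n * ((\<Sum>j\<in>P. ?x P j) /\<^sub>R real N)" .
  qed
  also have "\<dots> = of_nat N / of_nat n * avg (selections n N) (\<lambda>(P, j). ?x P j)"
    unfolding avg_mult_left using avg_selections[of N n ?x] N by simp
  finally show ?thesis .
qed

text \<open>\<open>S\<close> has \<open>N - 1\<close> elements, so \<open>n - N + 1\<close> indices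
  are unselected. Their forms sum to the total over all rows minus the total over \<open>S\<close>,
  that is \<open>tr R - (qn + z tr R)\<close>.\<close>

lemma cond_expectation_resolvent_form:
  assumes S: "S \<subseteq> {..<n}" "Suc (card S) = N"
  defines "Y \<equiv> cond_expectation_index n N (resolvent_form W z) S"
  shows "(of_nat (n - N) + 1) / of_nat n * Y = (1 - z) * normalized_trace W z S - of_nat (dim_col W) / of_nat n"
    and "cmod Y \<le> 1 / 2"
proof -
  let ?B = "{..<n} - S"
  have finS: "finite S" using S finite_subset by blast
  have cB: "card ?B = n - N + 1" using S finS N by (simp add: card_Diff_subset)
  have Y: "Y = avg ?B (resolvent_form W z S)"
    unfolding Y_def using N S by (intro cond_expectation_index_eq) auto
  have "of_nat (n - N + 1) * Y = (\<Sum>j\<in>?B. resolvent_form W z S j)"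
  proof -
    have "of_nat m * (x /\<^sub>R real m) = x" if "0 < m" for m and x :: complex
      using that by (simp add: scaleR_conv_of_real)
    from this[of "n - N + 1"] show ?thesis unfolding Y avg_def cB by (simp only: zero_less_Suc Suc_eq_plus1[symmetric])
  qed
  also have "\<dots> = (\<Sum>j<n. resolvent_form W z S j) - (\<Sum>j\<in>S. resolvent_form W z S j)"
    using S by (intro sum_diff) auto
  also have "\<dots> = (1 - z) * mat_trace (gres W z S) - of_nat (dim_col W)"
    using sum_resolvent_forms_all[OF so, of z S] sum_resolvent_forms[of S W z] S z n
    by (auto simp: algebra_simps)
  finally have "of_nat (n - N + 1) * Y / of_nat n = ((1 - z) * mat_trace (gres W z S) - of_nat (dim_col W)) / of_nat n"
    by simp
  then show "(of_nat (n - N) + 1) / of_nat n * Y = (1 - z) * normalized_trace W z S - of_nat (dim_col W) / of_nat n"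
    by (simp add: normalized_trace_def n diff_divide_distrib add.commute)
  have Bne: "?B \<noteq> {}" using cB by (metis Suc_eq_plus1 card.empty nat.distinct(1))
  have "cmod Y \<le> avg ?B (\<lambda>j. cmod (resolvent_form W z S j))" unfolding Y by (rule norm_avg_le)
  also have "\<dots> \<le> 1 / 2"
    using Bne cmod_resolvent_form_le_half(1) by (intro avg_le_const) auto
  finally show "cmod Y \<le> 1 / 2" .
qed

text \<open>\<open>Y\<close> is the deterministic stand-in for the conditional expectation:
  \<open>n - N + 1\<close> becomes \<open>n - N\<close>, and the trace without row \<open>j\<close>
  becomes the mean trace. The three summands are the tolerance, the bad event and the cost of this
  replacement.\<close>

lemma self_consistency_error:
  fixes \<epsilon> :: real
  assumes "0 \<le> \<epsilon>"
  defines "p \<equiv> real N / real n" and "q \<equiv> real (dim_col W) / real n"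
  defines "Y \<equiv> ((1 - z) * mean_trace - of_real q) / of_real (1 - p)"
  shows "cmod ((of_real q + z * mean_trace) * (1 + Y) - of_real p * Y)
     \<le> 2 * (\<epsilon> + measure_pmf.prob (random_selection n N)
               {(P, j). \<epsilon> < cmod (resolvent_form W z (P - {j}) j
                  - cond_expectation_index n N (resolvent_form W z) (P - {j}))}
          + (cmod (1 - z) * (1 / real n + 2 / sqrt (real n)) + 1 / real n) / (1 - p))"
proof -
  let ?S = "selections n N"
  define X where "X P j = resolvent_form W z (P - {j}) j" for P j
  define C where "C P j = cond_expectation_index n N (resolvent_form W z) (P - {j})" for P j
  define B where "B = {(P, j). \<epsilon> < cmod (X P j - C P j)}"
  have S: "finite ?S" "?S \<noteq> {}" using finite_selections selections_nonempty N by auto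
  have n0: "0 < real n" using N by simp
  have p1: "0 < 1 - p" and p0: "0 \<le> p" using N by (auto simp: p_def)
  have mem: "P \<subseteq> {..<n}" "j \<in> P" "j < n" "card P = N" "finite P" if "(P, j) \<in> ?S" for P j
    using that by (auto simp: selections_def subsets_of_card_def finite_subset)
  have XY: "cmod (X P j - Y) \<le> \<epsilon> + indicator B (P, j)
        + (cmod (1 - z) * (1 / real n + cmod (normalized_trace W z P - mean_trace)) + 1 / real n) / (1 - p)"
    if Pj: "(P, j) \<in> ?S" for P j
  proof -
    note m = mem[OF Pj]
    have cS: "Suc (card (P - {j})) = N" using m N by simp
    have sub: "P - {j} \<subseteq> {..<n}" using m by auto
    note ce = cond_expectation_resolvent_form[OF sub cS]
    have C: "cmod (C P j) \<le> 1 / 2" unfolding C_def by (rule ce(2))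
    \<comment> \<open>On the bad event the trivial bound \<open>1/2 + 1/2\<close> applies, so after
      averaging it contributes exactly its probability.\<close>
    have XC: "cmod (X P j - C P j) \<le> \<epsilon> + indicator B (P, j)"
    proof (cases "(P, j) \<in> B")
      case True
      have "cmod (X P j - C P j) \<le> cmod (X P j) + cmod (C P j)" by (rule norm_triangle_ineq4)
      also have "\<dots> \<le> 1" using C cmod_resolvent_form_le_half(1)[OF m(3), of "P - {j}"] by (simp add: X_def)
      finally show ?thesis using True assms(1) by simp
    qed (simp add: B_def)
    have step: "cmod (normalized_trace W z (P - {j}) - normalized_trace W z P) \<le> 1 / real n"
      using normalized_trace_insert[of j "P - {j}"] m by (simp add: insert_absorb)
    \<comment> \<open>The term \<open>C P j / n\<close> is what remains of the one extra unselected
      index.\<close>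
    have "of_real (1 - p) * (C P j - Y) = (1 - z) * (normalized_trace W z (P - {j}) - mean_trace) - C P j / of_nat n"
    proof -
      have "(of_nat (n - N) + 1) / of_nat n = complex_of_real (1 - p) + 1 / of_nat n"
        using N n0 by (simp add: p_def field_simps of_nat_diff)
      then have e1: "(complex_of_real (1 - p) + 1 / of_nat n) * C P j
          = (1 - z) * normalized_trace W z (P - {j}) - of_real q"
        using ce(1) by (simp add: C_def q_def)
      have e2: "of_real (1 - p) * Y = (1 - z) * mean_trace - of_real q"
        using p1 by (simp add: Y_def del: of_real_diff)
      have "A * (x - y) = (A + b) * x - A * y - b * x" for A b x y :: complex
        by (simp add: algebra_simps)
      from this[of "of_real (1 - p)" "C P j" Y "1 / of_nat n"] show ?thesis
        unfolding e1 e2 by (simp add: right_diff_distrib)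
    qed
    then have "(1 - p) * cmod (C P j - Y) = cmod ((1 - z) * (normalized_trace W z (P - {j}) - mean_trace) - C P j / of_nat n)"
      using p1 by (metis abs_of_pos norm_mult norm_of_real)
    also have "\<dots> \<le> cmod (1 - z) * cmod (normalized_trace W z (P - {j}) - mean_trace) + cmod (C P j) / real n"
      by (rule order_trans[OF norm_triangle_ineq4]) (simp add: norm_mult norm_divide)
    also have "\<dots> \<le> cmod (1 - z) * (1 / real n + cmod (normalized_trace W z P - mean_trace)) + 1 / real n"
    proof (intro add_mono mult_left_mono divide_right_mono)
      show "cmod (normalized_trace W z (P - {j}) - mean_trace) \<le> 1 / real n + cmod (normalized_trace W z P - mean_trace)"
        using step norm_triangle_ineq[of "normalized_trace W z (P - {j}) - normalized_trace W z P"
            "normalized_trace W z P - mean_trace"] by simp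
      show "cmod (C P j) \<le> 1" using C by simp
    qed auto
    finally have CY: "cmod (C P j - Y) \<le> (cmod (1 - z) * (1 / real n + cmod (normalized_trace W z P - mean_trace)) + 1 / real n) / (1 - p)"
      using p1 by (simp add: field_simps)
    have "cmod (X P j - Y) \<le> cmod (X P j - C P j) + cmod (C P j - Y)"
      using norm_triangle_ineq[of "X P j - C P j" "C P j - Y"] by simp
    then show ?thesis using XC CY by linarith
  qed
  have avgXY: "avg ?S (\<lambda>(P, j). cmod (X P j - Y))
     \<le> \<epsilon> + measure_pmf.prob (random_selection n N) B
       + (cmod (1 - z) * (1 / real n + 2 / sqrt (real n)) + 1 / real n) / (1 - p)"
  proof -
    have "avg ?S (\<lambda>(P, j). cmod (X P j - Y)) \<le> avg ?S (\<lambda>Pj. \<epsilon> + indicator B Pj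
        + (cmod (1 - z) * (1 / real n + cmod (normalized_trace W z (fst Pj) - mean_trace)) + 1 / real n) * (1 / (1 - p)))"
      using XY by (intro avg_mono) auto
    also have "\<dots> = \<epsilon> + avg ?S (indicator B)
        + (cmod (1 - z) * (1 / real n + avg ?S (\<lambda>Pj. cmod (normalized_trace W z (fst Pj) - mean_trace))) + 1 / real n) / (1 - p)"
      by (simp only: avg_add avg_mult_left avg_const[OF S] mult.commute[of _ "1 / (1 - p)"]) simp
    also have "avg ?S (indicator B) = measure_pmf.prob (random_selection n N) B"
      using S N by (simp add: random_selection_eq flip: expectation_pmf_of_set)
    also have "avg ?S (\<lambda>Pj. cmod (normalized_trace W z (fst Pj) - mean_trace))
        = avg (subsets_of_card {..<n} N) (\<lambda>P. cmod (normalized_trace W z P - mean_trace))"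
      using avg_selections[of N n "\<lambda>P j. cmod (normalized_trace W z P - mean_trace)"] N
      by (auto simp: case_prod_unfold subsets_of_card_def intro!: avg_cong)
    also have "\<epsilon> + measure_pmf.prob (random_selection n N) B
        + (cmod (1 - z) * (1 / real n + avg (subsets_of_card {..<n} N) (\<lambda>P. cmod (normalized_trace W z P - mean_trace))) + 1 / real n) / (1 - p)
      \<le> \<epsilon> + measure_pmf.prob (random_selection n N) B
        + (cmod (1 - z) * (1 / real n + 2 / sqrt (real n)) + 1 / real n) / (1 - p)"
      by (rule add_left_mono[OF divide_right_mono[OF add_right_mono[OF mult_left_mono[OF
              add_left_mono[OF avg_dist_mean_trace_le]]]]]) (use p1 in auto)
    finally show ?thesis .
  qed
  have "of_real q + z * mean_trace = of_real p * avg ?S (\<lambda>(P, j). X P j / (1 + X P j))"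
    using mean_trace_as_avg by (simp add: p_def q_def X_def)
  then have "(of_real q + z * mean_trace) * (1 + Y) - of_real p * Y
      = of_real p * ((1 + Y) * avg ?S (\<lambda>(P, j). X P j / (1 + X P j)) - Y)"
    by (simp add: algebra_simps)
  also have "(1 + Y) * avg ?S (\<lambda>(P, j). X P j / (1 + X P j)) - Y
      = avg ?S (\<lambda>(P, j). (1 + Y) * (X P j / (1 + X P j)) - Y)"
    by (simp only: case_prod_unfold avg_diff avg_mult_left avg_const[OF S])
  \<comment> \<open>Only \<open>1 + X\<close> occurs as a denominator. Keeping \<open>1 + Y\<close>
    as a factor avoids any lower bound on it, and \<open>1/2 \<le> cmod (1 + X)\<close> yields the
    constant 2.\<close>
  also have "\<dots> = avg ?S (\<lambda>(P, j). (X P j - Y) / (1 + X P j))"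
  proof (intro avg_cong, clarify)
    fix P j assume "(P, j) \<in> ?S"
    then have "1 + X P j \<noteq> 0" using mem one_plus_resolvent_form_nonzero by (simp add: X_def)
    then show "(1 + Y) * (X P j / (1 + X P j)) - Y = (X P j - Y) / (1 + X P j)"
      by (simp add: field_simps)
  qed
  also have "cmod (of_real p * \<dots>) \<le> 1 * (2 * avg ?S (\<lambda>(P, j). cmod (X P j - Y)))"
    unfolding norm_mult
  proof (rule mult_mono)
    show "cmod (of_real p) \<le> 1" using p0 p1 by simp
    have "cmod (avg ?S (\<lambda>(P, j). (X P j - Y) / (1 + X P j))) \<le> avg ?S (\<lambda>Pj. cmod ((\<lambda>(P, j). (X P j - Y) / (1 + X P j)) Pj))"
      by (rule norm_avg_le)
    also have "\<dots> \<le> avg ?S (\<lambda>Pj. 2 * (\<lambda>(P, j). cmod (X P j - Y)) Pj)"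
    proof (rule avg_mono, clarify)
      fix P j assume Pj: "(P, j) \<in> ?S"
      have "1 / 2 \<le> cmod (1 + X P j)"
        unfolding X_def using mem[OF Pj] by (intro cmod_resolvent_form_le_half)
      then have "cmod (X P j - Y) / cmod (1 + X P j) \<le> cmod (X P j - Y) / (1 / 2)"
        by (intro divide_left_mono) (auto intro!: mult_pos_pos)
      then show "cmod ((X P j - Y) / (1 + X P j)) \<le> 2 * cmod (X P j - Y)"
        by (simp add: norm_divide)
    qed
    also have "\<dots> = 2 * avg ?S (\<lambda>(P, j). cmod (X P j - Y))" by (rule avg_mult_left)
    finally show "cmod (avg ?S (\<lambda>(P, j). (X P j - Y) / (1 + X P j))) \<le> 2 * avg ?S (\<lambda>(P, j). cmod (X P j - Y))" .
  qed auto
  also have "\<dots> \<le> 2 * (\<epsilon> + measure_pmf.prob (random_selection n N) B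
       + (cmod (1 - z) * (1 / real n + 2 / sqrt (real n)) + 1 / real n) / (1 - p))"
    unfolding mult_1 by (rule mult_left_mono[OF avgXY]) simp
  finally show ?thesis unfolding B_def X_def C_def .
qed

text \<open>Each quotient \<open>X / (1 + X)\<close> is at most \<open>2 / \<bar>Im z\<bar>\<close>.
  This places \<open>z t\<close> near \<open>-q\<close> and so decides between the roots of the
  self-consistency equation.\<close>

lemma mean_trace_near_root:
  "cmod (z * mean_trace + of_real (real (dim_col W) / real n)) \<le> 2 * (real N / real n) / \<bar>Im z\<bar>"
proof -
  let ?S = "selections n N"
  have S: "finite ?S" "?S \<noteq> {}" using finite_selections selections_nonempty N by auto
  let ?x = "\<lambda>P j. resolvent_form W z (P - {j}) j"
  have "cmod (avg ?S (\<lambda>(P, j). ?x P j / (1 + ?x P j))) \<le> avg ?S (\<lambda>Pj. cmod ((\<lambda>(P, j). ?x P j / (1 + ?x P j)) Pj))"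
    by (rule norm_avg_le)
  also have "\<dots> \<le> 2 / \<bar>Im z\<bar>"
  proof (rule avg_le_const[OF S], clarify)
    fix P j assume "(P, j) \<in> ?S"
    then have j: "j < n" by (auto simp: selections_def subsets_of_card_def)
    have "cmod (?x P j) / cmod (1 + ?x P j) \<le> (1 / \<bar>Im z\<bar>) / (1 / 2)"
      using cmod_resolvent_form_le[OF so, of j z] j n z cmod_resolvent_form_le_half(2)[OF j]
      by (intro frac_le) auto
    then show "cmod (?x P j / (1 + ?x P j)) \<le> 2 / \<bar>Im z\<bar>" by (simp add: norm_divide)
  qed
  finally have "real N / real n * cmod (avg ?S (\<lambda>(P, j). ?x P j / (1 + ?x P j))) \<le> real N / real n * (2 / \<bar>Im z\<bar>)"
    by (intro mult_left_mono) auto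
  moreover have "cmod (z * mean_trace + of_real (real (dim_col W) / real n))
      = real N / real n * cmod (avg ?S (\<lambda>(P, j). ?x P j / (1 + ?x P j)))"
    using arg_cong[OF mean_trace_as_avg, of cmod] by (simp add: norm_mult norm_divide add.commute)
  ultimately show ?thesis by (simp add: mult.commute)
qed

end

text \<open>The two roots of the self-consistency equation in $a = zt$ stay apart, near $-q$ and $1-q$.\<close>

lemma quadratic_stability:
  fixes a b z :: complex and p q :: real
  assumes y: "16 \<le> \<bar>Im z\<bar>" and p: "0 \<le> p" "p \<le> 1" and q: "0 \<le> q" "q \<le> 1"
    and a: "cmod (a + of_real q) \<le> 2 * p / \<bar>Im z\<bar>" and b: "cmod (b + of_real q) \<le> 2 * p / \<bar>Im z\<bar>"
  defines "Q \<equiv> \<lambda>a. (of_real q + a) * (1 - of_real q - a) + ((of_real q + a) * a - of_real p * a) / z"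
  shows "cmod (a - b) \<le> 2 * cmod (Q a - Q b)"
proof -
  have z0: "z \<noteq> 0" using y by auto
  define u where "u = a + of_real q"
  define v where "v = b + of_real q"
  have b8: "2 * p / \<bar>Im z\<bar> \<le> 1 / 8"
    using y p by (simp add: divide_le_eq)
  have u: "cmod u \<le> 1 / 8" and v: "cmod v \<le> 1 / 8" using a b b8 by (auto simp: u_def v_def)
  define w where "w = u + v - of_real (q + p)"
  \<comment> \<open>The second factor is 1 up to a perturbation of at most
    \<open>1/4 + 9/64 < 1/2\<close>, so the difference of the arguments is controlled with constant
    2.\<close>
  have "Q a - Q b = (a - b) * (1 - (u + v) + w / z)"
    unfolding Q_def u_def v_def w_def by (simp add: diff_divide_distrib add_divide_distrib algebra_simps)
  then have eq: "cmod (Q a - Q b) = cmod (a - b) * cmod (1 - (u + v) + w / z)" by (simp add: norm_mult)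
  have "cmod w \<le> cmod (u + v) + cmod (complex_of_real (q + p))" unfolding w_def by (rule norm_triangle_ineq4)
  also have "\<dots> \<le> 1 / 4 + 2"
    using norm_triangle_ineq[of u v] u v p q by (simp add: norm_of_real del: of_real_add)
  finally have w: "cmod w \<le> 9 / 4" by simp
  have "cmod (w / z) \<le> (9 / 4) / 16"
    unfolding norm_divide using w y abs_Im_le_cmod[of z] by (intro frac_le) auto
  moreover have "cmod (u + v) \<le> 1 / 4" using norm_triangle_ineq[of u v] u v by simp
  ultimately have "cmod ((u + v) - w / z) \<le> 1 / 2"
    using norm_triangle_ineq4[of "u + v" "w / z"] by simp
  then have "1 / 2 \<le> cmod (1 - ((u + v) - w / z))"
    using norm_triangle_ineq2[of 1 "(u + v) - w / z"] by simp
  then have "1 / 2 \<le> cmod (1 - (u + v) + w / z)" by (simp add: algebra_simps)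
  then have "cmod (a - b) * (1 / 2) \<le> cmod (a - b) * cmod (1 - (u + v) + w / z)"
    by (intro mult_left_mono) auto
  then show ?thesis using eq by simp
qed

text \<open>The mean trace solves the equation up to a vanishing error, and \<open>a\<close> solves
  it exactly. Both lie near \<open>-q\<close>, where the equation is stable, so they must
  merge.\<close>

lemma mean_trace_tendsto:
  fixes W :: "nat \<Rightarrow> real mat" and N n :: "nat \<Rightarrow> nat" and z a :: complex and p q :: real
  assumes so: "\<And>k. semi_orthogonal (W k)" and n: "\<And>k. dim_row (W k) = n k"
    and p: "0 < p" "p < 1" "\<And>k. real (N k) = p * real (n k)"
    and q: "q \<le> 1" "\<And>k. real (dim_col (W k)) = q * real (n k)"
    and lim: "filterlim n at_top sequentially" and n_pos: "\<And>k. 0 < n k"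
    and conc: "concentrated W N" and z: "16 \<le> \<bar>Im z\<bar>"
    and root: "(of_real q + a) * (1 - of_real q - a) + ((of_real q + a) * a - of_real p * a) / z = 0"
    and near: "cmod (a + of_real q) \<le> p / \<bar>Im z\<bar>"
  shows "(\<lambda>k. z * avg (subsets_of_card {..<n k} (N k)) (normalized_trace (W k) z)) \<longlonglongrightarrow> a"
proof -
  define t where "t k = avg (subsets_of_card {..<n k} (N k)) (normalized_trace (W k) z)" for k
  define Q where "Q = (\<lambda>a. (of_real q + a) * (1 - of_real q - a) + ((of_real q + a) * a - of_real p * a) / z)"
  define Y where "Y k = ((1 - z) * t k - of_real q) / of_real (1 - p)" for k
  define r where "r \<epsilon> k = measure_pmf.prob (random_selection (n k) (N k))
               {(P, j). \<epsilon> < cmod (resolvent_form (W k) z (P - {j}) j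
                  - cond_expectation_index (n k) (N k) (resolvent_form (W k) z) (P - {j}))}" for \<epsilon> k
  define h where "h k = (cmod (1 - z) * (1 / real (n k) + 2 / sqrt (real (n k))) + 1 / real (n k)) / (1 - p)" for k
  have z0: "z \<noteq> 0" and z2: "2 \<le> \<bar>Im z\<bar>" using z by auto
  have pN: "real (N k) / real (n k) = p" and qd: "real (dim_col (W k)) / real (n k) = q" for k
    using p(3)[of k] q(2)[of k] n_pos[of k] by auto
  have q0: "0 \<le> q" using qd[of 0] by (metis divide_nonneg_nonneg of_nat_0_le_iff)
  have N: "1 \<le> N k" "N k < n k" for k
  proof -
    have "0 < real (N k)" using p n_pos[of k] by simp
    then show "1 \<le> N k" by simp
    have "real (N k) < 1 * real (n k)" unfolding p(3) using p n_pos[of k] by (intro mult_strict_right_mono) auto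
    then show "N k < n k" by simp
  qed
  have err: "cmod ((of_real q + z * t k) * (1 + Y k) - of_real p * Y k) \<le> 2 * (\<epsilon> + r \<epsilon> k + h k)" if "0 \<le> \<epsilon>" for \<epsilon> k
    using self_consistency_error[OF so z2 n N that, of k] unfolding pN qd
    by (simp add: t_def Y_def r_def h_def)
  have real_n: "filterlim (\<lambda>k. real (n k)) at_top sequentially"
    using filterlim_compose[OF filterlim_real_sequentially lim] .
  have h: "h \<longlonglongrightarrow> 0"
  proof -
    have "(\<lambda>k. 1 / real (n k)) \<longlonglongrightarrow> 0"
      by (rule real_tendsto_divide_at_top[OF tendsto_const real_n])
    moreover have "(\<lambda>k. 2 / sqrt (real (n k))) \<longlonglongrightarrow> 0"
      by (rule real_tendsto_divide_at_top[OF tendsto_const filterlim_compose[OF sqrt_at_top real_n]])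
    ultimately have "h \<longlonglongrightarrow> (cmod (1 - z) * (0 + 0) + 0) / (1 - p)"
      unfolding h_def using p by (intro tendsto_intros) auto
    then show ?thesis by simp
  qed
  have r: "r \<epsilon> \<longlonglongrightarrow> 0" if "0 < \<epsilon>" for \<epsilon>
    using conc that z unfolding concentrated_def r_def[abs_def] n by fastforce
  have "(\<lambda>k. (of_real q + z * t k) * (1 + Y k) - of_real p * Y k) \<longlonglongrightarrow> 0"
  proof (rule LIMSEQ_I)
    fix \<epsilon> :: real assume \<epsilon>: "0 < \<epsilon>"
    have "(\<lambda>k. r (\<epsilon> / 8) k + h k) \<longlonglongrightarrow> 0 + 0" using \<epsilon> by (intro tendsto_add r h) auto
    then obtain k0 where k0: "\<And>k. k0 \<le> k \<Longrightarrow> norm (r (\<epsilon> / 8) k + h k) < \<epsilon> / 8"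
      using LIMSEQ_D[of "\<lambda>k. r (\<epsilon> / 8) k + h k" 0 "\<epsilon> / 8"] \<epsilon> by auto
    have "cmod ((of_real q + z * t k) * (1 + Y k) - of_real p * Y k) < \<epsilon>" if "k0 \<le> k" for k
    proof -
      have "r (\<epsilon> / 8) k + h k < \<epsilon> / 8"
        using k0[OF that] abs_ge_self[of "r (\<epsilon> / 8) k + h k"] unfolding real_norm_def by linarith
      then show ?thesis using err[of "\<epsilon> / 8" k] \<epsilon> by simp
    qed
    then show "\<exists>k0. \<forall>k\<ge>k0. norm ((of_real q + z * t k) * (1 + Y k) - of_real p * Y k - 0) < \<epsilon>" by auto
  qed
  then have "(\<lambda>k. of_real (1 - p) * ((of_real q + z * t k) * (1 + Y k) - of_real p * Y k)) \<longlonglongrightarrow> of_real (1 - p) * 0"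
    by (intro tendsto_mult tendsto_const)
  \<comment> \<open>Multiplication by \<open>1 - p\<close> clears the denominator of
    \<open>Y\<close> and leaves the quadratic of the limit law at \<open>z t\<close>.\<close>
  moreover have "of_real (1 - p) * ((of_real q + z * t k) * (1 + Y k) - of_real p * Y k) = Q (z * t k)" for k
  proof -
    have Yk: "of_real (1 - p) * Y k = (1 - z) * t k - of_real q"
      using p by (simp add: Y_def del: of_real_diff)
    have "of_real (1 - p) * ((of_real q + z * t k) * (1 + Y k) - of_real p * Y k)
        = (of_real q + z * t k) * (of_real (1 - p) + of_real (1 - p) * Y k) - of_real p * (of_real (1 - p) * Y k)"
      by (simp only: distrib_left right_diff_distrib mult_ac mult_1_right) (simp add: mult_ac)
    also have "\<dots> = Q (z * t k)"
      unfolding Yk Q_def using z0 by (simp add: add_divide_distrib diff_divide_distrib) (simp add: algebra_simps)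
    finally show ?thesis .
  qed
  ultimately have Qlim: "(\<lambda>k. Q (z * t k)) \<longlonglongrightarrow> 0" by simp
  have "cmod (z * t k - a) \<le> 2 * cmod (Q (z * t k))" for k
  proof -
    have "Q a = 0" unfolding Q_def by (rule root)
    moreover have "cmod (z * t k - a) \<le> 2 * cmod (Q (z * t k) - Q a)"
      unfolding Q_def
    proof (rule quadratic_stability[OF z _ _ q0 q(1)])
      show "cmod (z * t k + of_real q) \<le> 2 * p / \<bar>Im z\<bar>"
        using mean_trace_near_root[OF so z2 n N, of k] unfolding pN qd by (simp add: t_def)
      have "p / \<bar>Im z\<bar> \<le> 2 * p / \<bar>Im z\<bar>" using p by (intro divide_right_mono) auto
      then show "cmod (a + of_real q) \<le> 2 * p / \<bar>Im z\<bar>" using near by simp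
    qed (use p in auto)
    ultimately show ?thesis by simp
  qed
  moreover have "(\<lambda>k. 2 * cmod (Q (z * t k))) \<longlonglongrightarrow> 0"
    using tendsto_mult[OF tendsto_const tendsto_norm_zero[OF Qlim], of 2] by simp
  ultimately have "(\<lambda>k. z * t k - a) \<longlonglongrightarrow> 0"
    by (intro Lim_null_comparison[of "\<lambda>k. z * t k - a" "\<lambda>k. 2 * cmod (Q (z * t k))"]) auto
  then show ?thesis unfolding t_def by (simp add: LIM_zero_iff)
qed

section \<open>Convergence of the empirical spectral distribution\<close>

lemma sum_mset_image_eq_sum_count:
  fixes f :: "'a \<Rightarrow> 'b::comm_semiring_1"
  assumes "finite A" "set_mset M \<subseteq> A"
  shows "(\<Sum>x\<in>#M. f x) = (\<Sum>x\<in>A. of_nat (count M x) * f x)"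
  using assms(2)
proof (induction M)
  case (add x M)
  have "(\<Sum>y\<in>A. of_nat (count (add_mset x M) y) * f y)
      = (\<Sum>y\<in>A. (if y = x then f y else 0) + of_nat (count M y) * f y)"
    by (intro sum.cong) (auto simp: distrib_right)
  also have "\<dots> = f x + (\<Sum>y\<in>A. of_nat (count M y) * f y)"
    using add.prems assms(1) by (simp add: sum.distrib sum.delta)
  finally show ?case using add by simp
qed simp

lemma expectation_pmf_of_multiset:
  fixes f :: "'a \<Rightarrow> complex"
  assumes "M \<noteq> {#}"
  shows "measure_pmf.expectation (pmf_of_multiset M) f = (\<Sum>x\<in>#M. f x) / of_nat (size M)"
proof -
  have "measure_pmf.expectation (pmf_of_multiset M) f = (\<Sum>x\<in>set_mset M. pmf (pmf_of_multiset M) x *\<^sub>R f x)"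
    using assms by (intro integral_measure_pmf) auto
  also have "\<dots> = (\<Sum>x\<in>set_mset M. of_nat (count M x) * f x) / of_nat (size M)"
    using assms by (simp add: scaleR_conv_of_real sum_divide_distrib)
  finally show ?thesis by (simp add: sum_mset_image_eq_sum_count[of "set_mset M"])
qed

lemma real_distribution_esd: "real_distribution (esd A)"
proof -
  have "prob_space (esd A)"
    unfolding esd_def by (rule prob_space.prob_space_distr) (auto intro: measure_pmf.prob_space_axioms)
  then show ?thesis
    by (intro real_distribution.intro real_distribution_axioms.intro) (auto simp: esd_def)
qed

context
  fixes W :: "real mat" and P :: "nat set" and A
  assumes so: "semi_orthogonal W" and P: "P \<subseteq> {..<dim_row W}" "P \<noteq> {}"
  defines "A \<equiv> submatrix W P UNIV"
begin

lemma outer_carrier: "A \<in> carrier_mat (card P) (dim_col W)" "A * transpose_mat A \<in> carrier_mat (card P) (card P)"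
  using submatrix_rows_carrier[OF P(1)] by (auto simp: A_def)

lemma outer_symmetric: "transpose_mat (A * transpose_mat A) = A * transpose_mat A"
  using transpose_mult[OF outer_carrier(1), of "transpose_mat A" "card P"] outer_carrier(1) by simp

lemma card_rows_pos: "0 < card P"
  using P finite_subset by (auto simp: card_gt_0_iff)

lemma proots_outer_nonempty: "proots (char_poly (A * transpose_mat A)) \<noteq> {#}"
  using size_proots_char_poly_symmetric[OF outer_carrier(2) outer_symmetric] card_rows_pos
  by (simp add: nonempty_has_size)

lemma AE_esd_outer: "AE x in esd (A * transpose_mat A). 0 \<le> x \<and> x \<le> 1"
proof -
  have "0 \<le> x \<and> x \<le> 1" if "x \<in># proots (char_poly (A * transpose_mat A))" for x
  proof -
    have "poly (char_poly (A * transpose_mat A)) x = 0"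
      using that by (cases "char_poly (A * transpose_mat A) = 0") auto
    then show ?thesis
      using eigenvalue_outer_in_unit_interval[OF outer_carrier(1)]
        submatrix_rows_contraction[OF P(1) so] by (simp add: A_def)
  qed
  then show ?thesis
    unfolding esd_def using proots_outer_nonempty
    by (subst AE_distr_iff) (auto simp: AE_measure_pmf_iff)
qed

text \<open>Carries the transform of the \<open>pn\<close>-dimensional spectrum over to the trace of
  the \<open>qn\<close>-dimensional Gram resolvent.\<close>

lemma stieltjes_esd_outer:
  assumes z: "Im z \<noteq> 0"
  shows "(\<integral>x. 1 / (of_real x - z) \<partial>esd (A * transpose_mat A))
     = (of_nat (dim_col W) + z * mat_trace (gres W z P) - of_nat (card P)) / (z * of_nat (card P))"
proof -
  let ?H = "A * transpose_mat A"
  have z0: "z \<noteq> 0" using z by auto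
  have "(\<integral>x. 1 / (complex_of_real x - z) \<partial>esd ?H)
      = measure_pmf.expectation (pmf_of_multiset (proots (char_poly ?H))) (\<lambda>x. 1 / (complex_of_real x - z))"
    unfolding esd_def by (rule integral_distr) auto
  also have "\<dots> = mat_trace (resolvent ?H z) / of_nat (card P)"
    using mat_trace_resolvent[OF outer_carrier(2) outer_symmetric z]
      size_proots_char_poly_symmetric[OF outer_carrier(2) outer_symmetric]
    by (simp add: expectation_pmf_of_multiset[OF proots_outer_nonempty])
  also have "\<dots> = (z * mat_trace (resolvent ?H z)) / (z * of_nat (card P))"
    using z0 by simp
  also have "z * mat_trace (resolvent ?H z) = of_nat (dim_col W) + z * mat_trace (gres W z P) - of_nat (card P)"
    using mat_trace_resolvent_outer[OF z outer_carrier(1)] gram_of_rows_submatrix[OF P(1)] by (simp add: A_def)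
  finally show ?thesis .
qed

end

text \<open>The thresholds \<open>1 / (m + 1)\<close> reduce convergence to countably many uses of
  the first Borel-Cantelli lemma, which asks for no independence across \<open>k\<close>.\<close>

lemma (in prob_space) AE_tendsto_0_of_summable:
  fixes D :: "nat \<Rightarrow> 'a \<Rightarrow> real"
  assumes meas: "\<And>k \<epsilon>. {\<omega> \<in> space M. \<epsilon> < D k \<omega>} \<in> sets M"
    and sum: "\<And>\<epsilon>. 0 < \<epsilon> \<Longrightarrow> summable (\<lambda>k. prob {\<omega> \<in> space M. \<epsilon> < D k \<omega>})"
    and nonneg: "\<And>k \<omega>. 0 \<le> D k \<omega>"
  shows "AE \<omega> in M. (\<lambda>k. D k \<omega>) \<longlonglongrightarrow> 0"
proof -
  have "AE \<omega> in M. \<forall>m::nat. eventually (\<lambda>k. \<omega> \<in> space M - {\<omega> \<in> space M. 1 / real (Suc m) < D k \<omega>}) sequentially"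
    unfolding AE_all_countable
  proof (rule allI, rule borel_cantelli_AE1)
    fix m show "summable (\<lambda>k. prob {\<omega> \<in> space M. 1 / real (Suc m) < D k \<omega>})" by (rule sum) simp
    show "emeasure M {\<omega> \<in> space M. 1 / real (Suc m) < D k \<omega>} < \<infinity>" for k
      by (rule le_less_trans[OF emeasure_le_1]) simp
  qed (use meas in auto)
  then show ?thesis
  proof eventually_elim
    case (elim \<omega>)
    show ?case
    proof (rule LIMSEQ_I)
      fix \<epsilon> :: real assume "0 < \<epsilon>"
      then obtain m where m: "1 / real (Suc m) < \<epsilon>" by (metis inverse_eq_divide reals_Archimedean)
      from elim[rule_format, of m] obtain k0 where "\<And>k. k0 \<le> k \<Longrightarrow> D k \<omega> \<le> 1 / real (Suc m)"
        unfolding eventually_sequentially by (auto simp: not_less)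
      then have "\<And>k. k0 \<le> k \<Longrightarrow> norm (D k \<omega> - 0) < \<epsilon>"
        using m nonneg[of _ \<omega>] by (fastforce simp del: of_nat_Suc)
      then show "\<exists>k0. \<forall>k\<ge>k0. norm (D k \<omega> - 0) < \<epsilon>" by blast
    qed
  qed
qed

section \<open>From entry positions to row indices, and the final assembly\<close>

lemma bij_betw_stack_index: "bij_betw (stack_index n1) ({..<n1} \<times> {..<n2}) {..<n1 * n2}"
proof (rule bij_betw_byWitness[where f' = "\<lambda>i. (i mod n1, i div n1)"])
  show "stack_index n1 ` ({..<n1} \<times> {..<n2}) \<subseteq> {..<n1 * n2}"
  proof clarsimp
    fix i j assume ij: "i < n1" "j < n2"
    have "j * n1 + i < Suc j * n1" using ij by simp
    also have "\<dots> \<le> n2 * n1" using ij by (intro mult_right_mono) auto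
    finally show "stack_index n1 (i, j) < n1 * n2" by (simp add: stack_index_def mult.commute)
  qed
  show "(\<lambda>i. (i mod n1, i div n1)) ` {..<n1 * n2} \<subseteq> {..<n1} \<times> {..<n2}"
  proof clarsimp
    fix i assume i: "i < n1 * n2"
    then have "0 < n1" by (cases n1) auto
    then show "i mod n1 < n1 \<and> i div n1 < n2"
      using i by (simp add: less_mult_imp_div_less mult.commute)
  qed
qed (auto simp: stack_index_def)

lemma map_pmf_random_subset:
  assumes bij: "bij_betw f A B" and "finite A" "N \<le> card A"
  shows "map_pmf ((`) f) (random_subset A N) = random_subset B N"
proof -
  have inj: "inj_on f A" and img: "f ` A = B" using bij by (auto simp: bij_betw_def)
  have injP: "inj_on ((`) f) (subsets_of_card A N)"
    by (rule inj_on_subset[OF inj_on_image_Pow[OF inj]]) (auto simp: subsets_of_card_def)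
  have "(`) f ` subsets_of_card A N = subsets_of_card B N"
  proof
    show "(`) f ` subsets_of_card A N \<subseteq> subsets_of_card B N"
      using inj img by (auto simp: subsets_of_card_def card_image inj_on_subset)
    show "subsets_of_card B N \<subseteq> (`) f ` subsets_of_card A N"
    proof
      fix Q assume Q: "Q \<in> subsets_of_card B N"
      then obtain P where P: "P \<subseteq> A" "Q = f ` P"
        using img by (auto simp: subsets_of_card_def subset_image_iff)
      then show "Q \<in> (`) f ` subsets_of_card A N"
        using Q inj by (auto simp: subsets_of_card_def card_image inj_on_subset)
    qed
  qed
  then show ?thesis
    using map_pmf_of_set_inj[OF injP] subsets_of_card_nonempty[of A N] finite_subsets_of_card[of A N] assms
    by (simp add: random_subset_def subsets_of_card_def)
qed

theorem theorem3:
  fixes PM :: "'w measure"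
    and n1 n2 r s :: "nat \<Rightarrow> nat"
    and c \<rho>r \<rho>s :: real
    and M U V :: "nat \<Rightarrow> real mat"
    and \<Omega> :: "nat \<Rightarrow> 'w \<Rightarrow> (nat \<times> nat) set"
  defines "W \<equiv> \<lambda>k. kronecker (V k) (U k)"
  defines "pos \<equiv> \<lambda>k. {..<n1 k} \<times> {..<n2 k}"
  defines "Wpq \<equiv> \<lambda>k \<omega>. submatrix (W k) (stack_index (n1 k) ` (pos k - \<Omega> k \<omega>)) UNIV"
  defines "H \<equiv> \<lambda>k \<omega>. Wpq k \<omega> * transpose_mat (Wpq k \<omega>)"
  assumes "prob_space PM"
    and "filterlim (\<lambda>k. min (n1 k) (n2 k)) at_top sequentially"
    and "inj (\<lambda>k. n1 k * n2 k)"
    and "c \<noteq> 0" and "\<And>k. real (n1 k) / real (n2 k) = c"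
    and "\<And>k. 1 \<le> s k" and "\<And>k. s k < n1 k * n2 k"
    and "\<And>k. \<rho>r = 1 - sqrt ((1 - real (r k) / real (n1 k)) * (1 - real (r k) / real (n2 k)))"
    and "0 < \<rho>r" and "\<rho>r \<le> 1"
    and "\<And>k. \<rho>s = real (s k) / (real (n1 k) * real (n2 k))"
    and "0 < \<rho>s" and "\<rho>s \<le> 1"
    and "\<And>k. M k \<in> carrier_mat (n1 k) (n2 k)"
    and "\<And>k. rank_of (M k) = r k"
    and "\<And>k. U k \<in> carrier_mat (n1 k) (n1 k - r k)"
    and "\<And>k. V k \<in> carrier_mat (n2 k) (n2 k - r k)"
    and "\<And>k. orthonormal_basis_of (U k) (orth_compl (n1 k) (col_space_of (M k)))"
    and "\<And>k. orthonormal_basis_of (V k) (orth_compl (n2 k) (col_space_of (transpose_mat (M k))))"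
    and "\<And>k. semi_orthogonal (W k)"
    and "concentrated W (\<lambda>k. n1 k * n2 k - s k)"
    and "\<And>k. \<Omega> k \<in> PM \<rightarrow>\<^sub>M count_space (Pow (pos k))"
    and "\<And>k. distr PM (count_space UNIV) (\<lambda>\<omega>. pos k - \<Omega> k \<omega>)
               = measure_pmf (random_subset (pos k) (n1 k * n2 k - s k))"
    and "\<rho>s \<ge> 1 - (1 - \<rho>r)\<^sup>2"
  shows "AE \<omega> in PM. weak_conv_m (\<lambda>k. esd (H k \<omega>)) (limit_law \<rho>r \<rho>s)"
proof -
  note min_lim = assms(6) and n_inj = assms(7) and c = assms(8,9) and s = assms(10,11)
    and \<rho>r = assms(12-14) and \<rho>s = assms(15-17) and M = assms(18,19) and UV = assms(20,21)
    and so = assms(24) and conc = assms(25) and meas = assms(26) and law = assms(27) and le = assms(28)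
  interpret PM: prob_space PM by fact
  define n where "n k = n1 k * n2 k" for k
  define N where "N k = n k - s k" for k
  define p where "p = 1 - \<rho>s"
  define q where "q = (1 - \<rho>r)\<^sup>2"
  \<comment> \<open>A zero size would make the quotient 0 by the division convention, against
    \<open>c \<noteq> 0\<close>.\<close>
  have pos12: "0 < n1 k" "0 < n2 k" for k using c(2)[of k] c(1) by (cases "n1 k"; cases "n2 k"; simp)+
  have n_pos: "0 < n k" for k using pos12 by (simp add: n_def)
  have real_s: "real (s k) = \<rho>s * real (n k)" for k using \<rho>s(1)[of k] pos12[of k] by (simp add: n_def)
  have sn: "s k < n k" for k using s by (simp add: n_def)
  have p: "0 < p" "p < 1"
  proof -
    have "\<rho>s * real (n 0) < 1 * real (n 0)" using sn[of 0] unfolding real_s[of 0, symmetric] by simp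
    then show "0 < p" using n_pos[of 0] by (simp add: p_def mult_less_cancel_right)
    show "p < 1" using \<rho>s by (simp add: p_def)
  qed
  have real_N: "real (N k) = p * real (n k)" for k
    using sn[of k] real_s[of k] by (simp add: N_def p_def of_nat_diff algebra_simps)
  have pq: "p \<le> q" using le by (simp add: p_def q_def)
  have q1: "q < 1" using \<rho>r(2,3) by (simp add: q_def abs_square_less_1)
  \<comment> \<open>The value 1 would give \<open>q = 0 < p\<close>.\<close>
  have \<rho>r1: "\<rho>r < 1" using pq p \<rho>r(3) by (cases "\<rho>r = 1") (auto simp: q_def)
  have dim_W: "dim_row (W k) = n k" "real (dim_col (W k)) = q * real (n k)" for k
  proof -
    show "dim_row (W k) = n k" using UV[of k] by (simp add: W_def kronecker_def n_def)
    define x where "x = 1 - real (r k) / real (n1 k)"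
    define y where "y = 1 - real (r k) / real (n2 k)"
    have sq: "sqrt (x * y) = 1 - \<rho>r" using \<rho>r(1)[of k] by (simp add: x_def y_def)
    then have xy: "0 < x * y" using \<rho>r1 by (metis diff_gt_0_iff_gt real_sqrt_gt_0_iff)
    then have q: "q = x * y" using sq by (simp add: q_def flip: sq)
    \<comment> \<open>A positive product still allows two negative factors; the rank bound rules
      them out. Then \<open>r k\<close> is below both sizes and the truncated differences in
      \<open>dim_col (W k)\<close> are exact.\<close>
    have "r k \<le> n2 k" using vec_space.rank_le_nc[of "M k" "n1 k" "n2 k"] M[of k] by auto
    then have "0 \<le> y" using pos12[of k] by (simp add: y_def)
    then have "0 < x" "0 < y" using xy by (auto simp: zero_less_mult_iff)
    then have "real (r k) < real (n1 k)" "real (r k) < real (n2 k)"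
      using pos12[of k] by (simp_all add: x_def y_def)
    moreover have "dim_col (W k) = (n2 k - r k) * (n1 k - r k)" using UV[of k] by (simp add: W_def kronecker_def)
    ultimately have "real (dim_col (W k)) = (real (n2 k) - real (r k)) * (real (n1 k) - real (r k))"
      by (simp add: of_nat_diff)
    also have "\<dots> = q * real (n k)"
      using pos12[of k] by (simp add: q x_def y_def n_def field_simps)
    finally show "real (dim_col (W k)) = q * real (n k)" .
  qed
  have N: "1 \<le> N k" "N k < n k" for k using sn[of k] s(1)[of k] by (auto simp: N_def)
  have n_lim: "filterlim n at_top sequentially"
  proof (rule filterlim_at_top_mono[OF min_lim])
    have "min (n1 k) (n2 k) \<le> n k" for k
      using pos12[of k] by (simp add: n_def min_le_iff_disj)
    then show "eventually (\<lambda>k. min (n1 k) (n2 k) \<le> n k) sequentially" by simp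
  qed
  have n_sum: "summable (\<lambda>k. 1 / real (n k))"
  proof -
    have n1: "real (n1 k) = c * real (n2 k)" for k using c(2)[of k] pos12[of k] by (simp add: field_simps)
    have n: "real (n k) = c * (real (n2 k))\<^sup>2" for k by (simp add: n_def n1 power2_eq_square)
    have "inj n2"
    proof (rule injI)
      fix k l assume "n2 k = n2 l"
      then have "real (n k) = real (n l)" by (simp only: n)
      then have "n1 k * n2 k = n1 l * n2 l" unfolding n_def of_nat_eq_iff .
      then show "k = l" by (rule injD[OF n_inj])
    qed
    have "summable ((\<lambda>m. inverse ((real m)\<^sup>2)) \<circ> n2)"
      by (rule summable_reindex[OF _ \<open>inj n2\<close>]) (auto intro: inverse_power_summable)
    then have "summable (\<lambda>k. inverse c * inverse ((real (n2 k))\<^sup>2))"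
      by (intro summable_mult) (simp add: o_def)
    then show ?thesis by (simp add: n divide_inverse)
  qed
  define S where "S k \<omega> = stack_index (n1 k) ` (pos k - \<Omega> k \<omega>)" for k \<omega>
  have card_pos: "finite (pos k)" "N k \<le> card (pos k)" for k
    using N[of k] by (auto simp: pos_def n_def)
  have meas_compl: "(\<lambda>\<omega>. pos k - \<Omega> k \<omega>) \<in> PM \<rightarrow>\<^sub>M count_space UNIV" for k
    by (rule measurable_compose[OF meas]) simp
  have meas_S: "S k \<in> PM \<rightarrow>\<^sub>M count_space UNIV" for k
    unfolding S_def[abs_def] by (rule measurable_compose[OF meas_compl]) simp
  have law_S: "distr PM (count_space UNIV) (S k) = measure_pmf (random_subset {..<n k} (N k))" for k
  proof -
    have "distr PM (count_space UNIV) (S k)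
        = distr (distr PM (count_space UNIV) (\<lambda>\<omega>. pos k - \<Omega> k \<omega>)) (count_space UNIV) ((`) (stack_index (n1 k)))"
      by (subst distr_distr) (auto simp: meas_compl S_def[abs_def] o_def)
    also have "\<dots> = distr (measure_pmf (random_subset (pos k) (N k))) (count_space UNIV) ((`) (stack_index (n1 k)))"
      using law[of k] by (simp add: N_def n_def)
    also have "\<dots> = measure_pmf (map_pmf ((`) (stack_index (n1 k))) (random_subset (pos k) (N k)))"
      by (simp add: map_pmf_rep_eq)
    also have "map_pmf ((`) (stack_index (n1 k))) (random_subset (pos k) (N k)) = random_subset {..<n k} (N k)"
      unfolding n_def using card_pos[of k]
      by (intro map_pmf_random_subset) (simp_all add: pos_def bij_betw_stack_index)
    finally show ?thesis .
  qed
  have S_in: "AE \<omega> in PM. S k \<omega> \<in> subsets_of_card {..<n k} (N k)" for k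
  proof -
    have "AE P in distr PM (count_space UNIV) (S k). P \<in> subsets_of_card {..<n k} (N k)"
      unfolding law_S using N[of k] by (simp add: AE_measure_pmf_iff set_random_subset)
    then show ?thesis using meas_S by (simp add: AE_distr_iff)
  qed
  \<comment> \<open>Heights start at 16, where the quadratic is stable, and tend to infinity, as the
    recovery of moments demands; there are only countably many of them.\<close>
  define z where "z l = \<i> * complex_of_real (real l + 16)" for l :: nat
  define t where "t k l = avg (subsets_of_card {..<n k} (N k)) (normalized_trace (W k) (z l))" for k l
  have z: "16 \<le> \<bar>Im (z l)\<bar>" "2 \<le> \<bar>Im (z l)\<bar>" "Im (z l) \<noteq> 0" "z l \<noteq> 0" for l
    by (auto simp: z_def complex_eq_iff)
  have T_lim: "AE \<omega> in PM. (\<lambda>k. cmod (normalized_trace (W k) (z l) (S k \<omega>) - t k l)) \<longlonglongrightarrow> 0" for l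
  proof (rule PM.AE_tendsto_0_of_summable)
    define B where "B \<epsilon> k = {P. \<epsilon> < cmod (normalized_trace (W k) (z l) P - t k l)}" for \<epsilon> k
    have ev: "{\<omega> \<in> space PM. \<epsilon> < cmod (normalized_trace (W k) (z l) (S k \<omega>) - t k l)} = S k -` B \<epsilon> k \<inter> space PM" for \<epsilon> k
      by (auto simp: B_def)
    show "{\<omega> \<in> space PM. \<epsilon> < cmod (normalized_trace (W k) (z l) (S k \<omega>) - t k l)} \<in> PM.events" for \<epsilon> k
      unfolding ev by (rule measurable_sets[OF meas_S]) simp
    fix \<epsilon> :: real assume \<epsilon>: "0 < \<epsilon>"
    have "PM.prob (S k -` B \<epsilon> k \<inter> space PM) \<le> 4 / \<epsilon>\<^sup>2 * (1 / real (n k))" for k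
    proof -
      have "PM.prob (S k -` B \<epsilon> k \<inter> space PM) = measure (distr PM (count_space UNIV) (S k)) (B \<epsilon> k)"
        by (rule measure_distr[OF meas_S, symmetric]) simp
      also have "\<dots> \<le> 4 / \<epsilon>\<^sup>2 * (1 / real (n k))"
        unfolding law_S B_def t_def by (rule chebyshev_normalized_trace[OF so z(2) dim_W(1) N \<epsilon>])
      finally show ?thesis .
    qed
    then show "summable (\<lambda>k. PM.prob {\<omega> \<in> space PM. \<epsilon> < cmod (normalized_trace (W k) (z l) (S k \<omega>) - t k l)})"
      unfolding ev
      by (intro summable_comparison_test'[OF summable_mult[OF n_sum, of "4 / \<epsilon>\<^sup>2"], of 0]) simp
  qed simp
  define \<mu> where "\<mu> = limit_law \<rho>r \<rho>s"
  note params = p(1) pq q1 p_def q_def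
  \<comment> \<open>Obtained by solving \<open>(q + a - p) / (z p) = s\<close> for \<open>a\<close>,
    where \<open>s\<close> is the transform of \<mu>: the left side is the shape of the empirical
    transform.\<close>
  define a where "a l = of_real p * z l * (\<integral>x. 1 / (of_real x - z l) \<partial>\<mu>) - of_real (q - p)" for l
  have t_lim: "(\<lambda>k. z l * t k l) \<longlonglongrightarrow> a l" for l
    unfolding t_def
  proof (rule mean_trace_tendsto[OF so dim_W(1) p real_N _ dim_W(2) n_lim n_pos _ z(1)])
    show "concentrated W N" using conc by (simp add: N_def[abs_def] n_def)
  qed (use q1 limit_law_self_consistent[OF params z(3), of l] in \<open>simp_all add: a_def \<mu>_def\<close>)
  \<comment> \<open>Countably many conditions, so one null set serves all sizes and all heights; the
    rest is deterministic.\<close>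
  have "AE \<omega> in PM. (\<forall>k. S k \<omega> \<in> subsets_of_card {..<n k} (N k)) \<and>
     (\<forall>l. (\<lambda>k. cmod (normalized_trace (W k) (z l) (S k \<omega>) - t k l)) \<longlonglongrightarrow> 0)"
    unfolding AE_conj_iff AE_all_countable using S_in T_lim by blast
  then show ?thesis
  proof eventually_elim
    case (elim \<omega>)
    have S: "S k \<omega> \<subseteq> {..<dim_row (W k)}" "card (S k \<omega>) = N k" "S k \<omega> \<noteq> {}" for k
    proof -
      have "S k \<omega> \<in> subsets_of_card {..<n k} (N k)" using elim by blast
      then show "S k \<omega> \<subseteq> {..<dim_row (W k)}" "card (S k \<omega>) = N k"
        by (auto simp: subsets_of_card_def dim_W)
      then show "S k \<omega> \<noteq> {}" using N(1)[of k] by (metis card.empty not_one_le_zero)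
    qed
    have H: "H k \<omega> = submatrix (W k) (S k \<omega>) UNIV * transpose_mat (submatrix (W k) (S k \<omega>) UNIV)" for k
      by (simp add: H_def Wpq_def S_def)
    have \<mu>: "real_distribution \<mu>" "AE x in \<mu>. 0 \<le> x \<and> x \<le> 1"
      unfolding \<mu>_def by (rule real_distribution_limit_law[OF params]) (rule AE_limit_law[OF params])
    have E: "real_distribution (esd (H k \<omega>))" "AE x in esd (H k \<omega>). 0 \<le> x \<and> x \<le> 1" for k
      unfolding H by (rule real_distribution_esd) (rule AE_esd_outer[OF so S(1,3)])
    have stieltjes: "(\<lambda>k. \<integral>x. 1 / (of_real x - z l) \<partial>esd (H k \<omega>)) \<longlonglongrightarrow> (\<integral>x. 1 / (of_real x - z l) \<partial>\<mu>)" for l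
    proof -
      let ?T = "\<lambda>k. normalized_trace (W k) (z l) (S k \<omega>)"
      have "(\<lambda>k. ?T k - t k l) \<longlonglongrightarrow> 0" using elim by (simp add: tendsto_norm_zero_iff)
      then have "(\<lambda>k. z l * t k l + z l * (?T k - t k l)) \<longlonglongrightarrow> a l + z l * 0"
        by (intro tendsto_intros t_lim)
      then have "(\<lambda>k. z l * ?T k) \<longlonglongrightarrow> a l" by (simp add: algebra_simps)
      then have "(\<lambda>k. (of_real q + z l * ?T k - of_real p) / (z l * of_real p))
          \<longlonglongrightarrow> (of_real q + a l - of_real p) / (z l * of_real p)"
        using p z by (intro tendsto_intros) auto
      moreover have "(of_real q + a l - of_real p) / (z l * of_real p) = (\<integral>x. 1 / (of_real x - z l) \<partial>\<mu>)"
        using p z(4)[of l] by (simp add: a_def)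
      moreover have "(\<integral>x. 1 / (of_real x - z l) \<partial>esd (H k \<omega>)) = (of_real q + z l * ?T k - of_real p) / (z l * of_real p)" for k
      proof -
        have nk: "complex_of_nat (n k) \<noteq> 0" using n_pos[of k] by simp
        have d: "of_nat (dim_col (W k)) = complex_of_real q * of_nat (n k)"
          using dim_W(2)[of k] by (metis of_real_mult of_real_of_nat_eq)
        have Nk: "of_nat (N k) = complex_of_real p * of_nat (n k)"
          using real_N[of k] by (metis of_real_mult of_real_of_nat_eq)
        have T: "mat_trace (gres (W k) (z l) (S k \<omega>)) = ?T k * of_nat (n k)"
          using nk by (simp add: normalized_trace_def dim_W)
        have "(\<integral>x. 1 / (of_real x - z l) \<partial>esd (H k \<omega>))
          = (of_nat (n k) * (of_real q + z l * ?T k - of_real p)) / (of_nat (n k) * (z l * of_real p))"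
          unfolding H stieltjes_esd_outer[OF so S(1,3) z(3)] S(2) d Nk T by (simp add: algebra_simps)
        then show ?thesis using nk by simp
      qed
      ultimately show ?thesis by simp
    qed
    have "(\<lambda>k. \<integral>x. x ^ j \<partial>esd (H k \<omega>)) \<longlonglongrightarrow> (\<integral>x. x ^ j \<partial>\<mu>)" for j
    proof (rule moments_from_stieltjes[OF E \<mu>, of "\<lambda>l. real l + 16"])
      show "filterlim (\<lambda>l. real l + 16) at_top sequentially"
        by (rule filterlim_at_top_mono[OF filterlim_real_sequentially]) simp
    qed (use stieltjes in \<open>auto simp: z_def\<close>)
    then show ?case unfolding \<mu>_def[symmetric] by (rule weak_conv_from_moments[OF E \<mu>])
  qed
qed

end
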